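(* Let $\Omega\subset\mathbb{R}^N$ be a bounded Lipschitz domain and let $M$ be a locally integrable $N$-function satisfying condition $(\mathcal M)$ (resp. $(\mathcal M_p)$). Then for every $\varphi\in V_T^{M,\infty}(\Omega)$ there exists a family $\{\varphi_\delta\}_{\delta>0}\subset L^\infty(0,T;C_c^\infty(\Omega))$ such that $\varphi_\delta\to\varphi$ strongly in $L^1(\Omega_T)$ and $\nabla\varphi_\delta\to\nabla\varphi$ modularly in $L_M(\Omega_T;\mathbb{R}^N)$ as $\delta\to0$. Moreover there is $c=c(\Omega)>0$ with $\|\varphi_\delta\|_{L^\infty}\le c\|\varphi\|_{L^\infty}$.
   Context: $\Omega_T=(0,T)\times\Omega$. An $N$-function is $M:[0,T]\times\Omega\times\mathbb{R}^N\to\mathbb{R}$ which is Carathéodory, with $M(t,x,0)=0$, $\operatorname{ess\,inf}_{(t,x)}M(t,x,\xi)>0$ for $\xi\neq0$, even and convex in $\xi$, $\lim_{|\xi|\to0}\operatorname{ess\,sup}_{(t,x)}M/|\xi|=0$, $\lim_{|\xi|\to\infty}\operatorname{ess\,inf}_{(t,x)}M/|\xi|=\infty$; locally integrable if $\int_GM(t,x,z)<\infty$ for all measurable $G\subset\Omega_T$, $z\in\mathbb{R}^N$. For $g$ on $\mathbb{R}^N$, $g^{**}$ is the greatest convex minorant. $L_M(\Omega_T;\mathbb{R}^N)$: Musielak–Orlicz space with Luxemburg norm. Modular convergence: $\xi_i\to\xi$ modularly if there is $\lambda>0$ with $\int_{\Omega_T}M(t,x,(\xi_i-\xi)/\lambda)\,dx\,dt\to0$.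 $V_T^{M,\infty}(\Omega)=\{u\in L^\infty(0,T;L^2(\Omega))\cap L^1(0,T;W^{1,1}_0(\Omega)):\nabla u\in L_M(\Omega_T;\mathbb{R}^N)\}$. Condition $(\mathcal M)$: there exist $\Theta:[0,1]\times[0,\infty)\to[0,\infty)$ nondecreasing in each variable with $\limsup_{\delta\to0^+}\Theta(\delta,\delta^{-N})<\infty$, and $\xi_0\in\mathbb{R}^N$, $\delta_0>0$, such that for every $\delta\in(0,\delta_0)$, every interval $I$ with $|I|<\delta$, every cube $Q$ with $\operatorname{diam}Q<4\delta\sqrt N$, with $M_{I,Q}(\xi)=\operatorname{ess\,inf}_{t\in I\cap[0,T],x\in Q\cap\Omega}M(t,x,\xi)$: $M(t,x,\xi)\le\Theta(\delta,|\xi|)(M_{I,Q})^{**}(\xi)$ for a.e. $t\in I\cap[0,T]$, a.e. $x\in Q\cap\Omega$, all $|\xi|>|\xi_0|$. Condition $(\mathcal M_p)$: for some $p>1$, $c_{gr}>0$, $\xi_p$, $M(t,x,\xi)\ge c_{gr}|\xi|^p$ for $|\xi|>|\xi_p|$, and the inequality of $(\mathcal M)$ holds with some $\Theta_p$ (nondecreasing in each variable) with $\limsup_{\delta\to0^+}\Theta_p(\delta,\delta^{-N/p})<\infty$. *)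

theory Defs
  imports "HOL-Analysis.Analysis" "HOL-Probability.Probability"
begin

text \<open>Lipschitz domain: open, connected, nonempty, and near every boundary point
  it is (after an orthogonal change of coordinates) the subgraph of a Lipschitz function of
  the remaining N-1 coordinates.  The function gamma is a function on R^N that does not
  depend on the k-th coordinate, i.e. a function of the other N-1 coordinates.\<close>
definition lipschitz_domain :: "(real^'n) set \<Rightarrow> bool" where
  "lipschitz_domain \<Omega> \<longleftrightarrow> open \<Omega> \<and> connected \<Omega> \<and> \<Omega> \<noteq> {} \<and>
     (\<forall>x0\<in>frontier \<Omega>. \<exists>r>0. \<exists>(R::real^'n \<Rightarrow> real^'n) (k::'n) (\<gamma>::real^'n \<Rightarrow> real) L.
        orthogonal_transformation R \<and> lipschitz_on L UNIV \<gamma> \<and>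
        (\<forall>x y. (\<forall>i. i \<noteq> k \<longrightarrow> x$i = y$i) \<longrightarrow> \<gamma> x = \<gamma> y) \<and>
        \<Omega> \<inter> ball x0 r = {x \<in> ball x0 r. (R x)$k < \<gamma> (R x)})"

definition is_cube :: "(real^'n) set \<Rightarrow> bool" where
  "is_cube Q \<longleftrightarrow> (\<exists>a h. 0 < h \<and> Q = cbox a (a + h *\<^sub>R One))"

definition ess_inf_on :: "'a::euclidean_space set \<Rightarrow> ('a \<Rightarrow> real) \<Rightarrow> ereal" where
  "ess_inf_on A g = Sup {z. AE y in lebesgue_on A. z \<le> ereal (g y)}"

definition ess_sup_on :: "'a::euclidean_space set \<Rightarrow> ('a \<Rightarrow> real) \<Rightarrow> ereal" where
  "ess_sup_on A g = esssup (lebesgue_on A) (\<lambda>y. ereal (g y))"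

definition convex_minorant :: "('a::real_vector \<Rightarrow> ereal) \<Rightarrow> 'a \<Rightarrow> ereal" where
  "convex_minorant g \<xi> = Sup {ereal (h \<xi>) | h. convex_on UNIV h \<and> (\<forall>\<eta>. ereal (h \<eta>) \<le> g \<eta>)}"

definition N_function :: "real \<Rightarrow> (real^'n) set \<Rightarrow> (real \<Rightarrow> real^'n \<Rightarrow> real^'n \<Rightarrow> real) \<Rightarrow> bool" where
  "N_function T \<Omega> M \<longleftrightarrow>
     (\<forall>\<xi>. (\<lambda>z. M (fst z) (snd z) \<xi>) \<in> borel_measurable (lebesgue_on ({0..T} \<times> \<Omega>))) \<and>
     (AE z in lebesgue_on ({0..T} \<times> \<Omega>). continuous_on UNIV (M (fst z) (snd z))) \<and>
     (\<forall>t\<in>{0..T}. \<forall>x\<in>\<Omega>. M t x 0 = 0 \<and> (\<forall>\<xi>. M t x (-\<xi>) = M t x \<xi>) \<and> convex_on UNIV (M t x)) \<and>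
     (\<forall>\<xi>. \<xi> \<noteq> 0 \<longrightarrow> ess_inf_on ({0..T} \<times> \<Omega>) (\<lambda>z. M (fst z) (snd z) \<xi>) > 0) \<and>
     ((\<lambda>\<xi>. ess_sup_on ({0..T} \<times> \<Omega>) (\<lambda>z. M (fst z) (snd z) \<xi> / norm \<xi>)) \<longlongrightarrow> 0) (at 0) \<and>
     ((\<lambda>\<xi>. ess_inf_on ({0..T} \<times> \<Omega>) (\<lambda>z. M (fst z) (snd z) \<xi> / norm \<xi>)) \<longlongrightarrow> \<infinity>) at_infinity"

definition locally_integrable_N :: "real \<Rightarrow> (real^'n) set \<Rightarrow> (real \<Rightarrow> real^'n \<Rightarrow> real^'n \<Rightarrow> real) \<Rightarrow> bool" where
  "locally_integrable_N T \<Omega> M \<longleftrightarrow>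
     (\<forall>G \<xi>. G \<subseteq> {0<..<T} \<times> \<Omega> \<and> G \<in> sets lebesgue \<longrightarrow>
        (\<integral>\<^sup>+ z\<in>G. ennreal (M (fst z) (snd z) \<xi>) \<partial>lebesgue) < \<infinity>)"

definition M_IQ :: "real \<Rightarrow> (real^'n) set \<Rightarrow> (real \<Rightarrow> real^'n \<Rightarrow> real^'n \<Rightarrow> real)
                    \<Rightarrow> real set \<Rightarrow> (real^'n) set \<Rightarrow> real^'n \<Rightarrow> ereal" where
  "M_IQ T \<Omega> M I Q \<xi> = ess_inf_on ((I \<inter> {0..T}) \<times> (Q \<inter> \<Omega>)) (\<lambda>z. M (fst z) (snd z) \<xi>)"

definition Theta_ok :: "(real \<Rightarrow> real \<Rightarrow> real) \<Rightarrow> bool" where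
  "Theta_ok \<Theta> \<longleftrightarrow>
     (\<forall>\<delta> s. 0 \<le> \<delta> \<and> \<delta> \<le> 1 \<and> 0 \<le> s \<longrightarrow> 0 \<le> \<Theta> \<delta> s) \<and>
     (\<forall>\<delta>1 \<delta>2 s. 0 \<le> \<delta>1 \<and> \<delta>1 \<le> \<delta>2 \<and> \<delta>2 \<le> 1 \<and> 0 \<le> s \<longrightarrow> \<Theta> \<delta>1 s \<le> \<Theta> \<delta>2 s) \<and>
     (\<forall>\<delta> s1 s2. 0 \<le> \<delta> \<and> \<delta> \<le> 1 \<and> 0 \<le> s1 \<and> s1 \<le> s2 \<longrightarrow> \<Theta> \<delta> s1 \<le> \<Theta> \<delta> s2)"

text \<open>The key inequality of condition (M) with given Theta, \<xi>0, \<delta>0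
  (\<delta>0 \<le> 1 since Theta is only defined for \<delta> in [0,1]).\<close>
definition M_ineq :: "real \<Rightarrow> (real^'n) set \<Rightarrow> (real \<Rightarrow> real^'n \<Rightarrow> real^'n \<Rightarrow> real)
                      \<Rightarrow> (real \<Rightarrow> real \<Rightarrow> real) \<Rightarrow> real^'n \<Rightarrow> real \<Rightarrow> bool" where
  "M_ineq T \<Omega> M \<Theta> \<xi>0 \<delta>0 \<longleftrightarrow> 0 < \<delta>0 \<and> \<delta>0 \<le> 1 \<and>
     (\<forall>\<delta> a b Q. 0 < \<delta> \<and> \<delta> < \<delta>0 \<and> a < b \<and> b - a < \<delta> \<and>
        is_cube Q \<and> diameter Q < 4 * \<delta> * sqrt (real CARD('n)) \<longrightarrow>
        (AE z in lebesgue_on (({a..b} \<inter> {0..T}) \<times> (Q \<inter> \<Omega>)).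
           \<forall>\<xi>. norm \<xi> > norm \<xi>0 \<longrightarrow>
             ereal (M (fst z) (snd z) \<xi>) \<le> ereal (\<Theta> \<delta> (norm \<xi>)) * convex_minorant (M_IQ T \<Omega> M {a..b} Q) \<xi>))"

definition cond_M :: "real \<Rightarrow> (real^'n) set \<Rightarrow> (real \<Rightarrow> real^'n \<Rightarrow> real^'n \<Rightarrow> real) \<Rightarrow> bool" where
  "cond_M T \<Omega> M \<longleftrightarrow> (\<exists>\<Theta> \<xi>0 \<delta>0. Theta_ok \<Theta> \<and>
     Limsup (at_right 0) (\<lambda>\<delta>. ereal (\<Theta> \<delta> (\<delta> powr (- real CARD('n))))) < \<infinity> \<and>
     M_ineq T \<Omega> M \<Theta> \<xi>0 \<delta>0)"

definition cond_Mp :: "real \<Rightarrow> (real^'n) set \<Rightarrow> (real \<Rightarrow> real^'n \<Rightarrow> real^'n \<Rightarrow> real) \<Rightarrow> bool" where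
  "cond_Mp T \<Omega> M \<longleftrightarrow> (\<exists>p c_gr (\<xi>p::real^'n) \<Theta>p \<xi>0 \<delta>0. 1 < p \<and> 0 < c_gr \<and>
     (\<forall>t\<in>{0..T}. \<forall>x\<in>\<Omega>. \<forall>\<xi>. norm \<xi> > norm \<xi>p \<longrightarrow> c_gr * norm \<xi> powr p \<le> M t x \<xi>) \<and>
     Theta_ok \<Theta>p \<and>
     Limsup (at_right 0) (\<lambda>\<delta>. ereal (\<Theta>p \<delta> (\<delta> powr (- real CARD('n) / p)))) < \<infinity> \<and>
     M_ineq T \<Omega> M \<Theta>p \<xi>0 \<delta>0)"

definition partial_deriv :: "'n \<Rightarrow> (real^'n \<Rightarrow> real) \<Rightarrow> real^'n \<Rightarrow> real" where
  "partial_deriv i f x = frechet_derivative f (at x) (axis i 1)"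

fun iter_pd :: "'n list \<Rightarrow> (real^'n \<Rightarrow> real) \<Rightarrow> real^'n \<Rightarrow> real" where
  "iter_pd [] f = f"
| "iter_pd (i # is) f = partial_deriv i (iter_pd is f)"

definition smooth_fun :: "(real^'n \<Rightarrow> real) \<Rightarrow> bool" where
  "smooth_fun f \<longleftrightarrow> (\<forall>is x. iter_pd is f differentiable (at x))"

definition grad :: "(real^'n \<Rightarrow> real) \<Rightarrow> real^'n \<Rightarrow> real^'n" where
  "grad f x = (\<chi> i. partial_deriv i f x)"

text \<open>C_c^\<infinity>(\<Omega>) (functions extended by zero to R^N).\<close>
definition test_fun :: "(real^'n) set \<Rightarrow> (real^'n \<Rightarrow> real) \<Rightarrow> bool" where
  "test_fun \<Omega> \<psi> \<longleftrightarrow> smooth_fun \<psi> \<and> compact (closure {x. \<psi> x \<noteq> 0}) \<and> closure {x. \<psi> x \<noteq> 0} \<subseteq> \<Omega>"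

definition W011_0 :: "(real^'n) set \<Rightarrow> (real^'n \<Rightarrow> real) \<Rightarrow> (real^'n \<Rightarrow> real^'n) \<Rightarrow> bool" where
  "W011_0 \<Omega> f g \<longleftrightarrow>
     integrable (lebesgue_on \<Omega>) f \<and> integrable (lebesgue_on \<Omega>) g \<and>
     (\<forall>\<psi> i. test_fun \<Omega> \<psi> \<longrightarrow>
        (\<integral>x. f x * partial_deriv i \<psi> x \<partial>lebesgue_on \<Omega>) = - (\<integral>x. g x $ i * \<psi> x \<partial>lebesgue_on \<Omega>)) \<and>
     (\<exists>\<psi>s. (\<forall>k. test_fun \<Omega> (\<psi>s k)) \<and>
        (\<lambda>k. \<integral>\<^sup>+x. ennreal (\<bar>\<psi>s k x - f x\<bar> + norm (grad (\<psi>s k) x - g x)) \<partial>lebesgue_on \<Omega>)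
           \<longlonglongrightarrow> 0)"

definition in_LM :: "real \<Rightarrow> (real^'n) set \<Rightarrow> (real \<Rightarrow> real^'n \<Rightarrow> real^'n \<Rightarrow> real)
                     \<Rightarrow> ((real \<times> (real^'n)) \<Rightarrow> real^'n) \<Rightarrow> bool" where
  "in_LM T \<Omega> M \<xi> \<longleftrightarrow> \<xi> \<in> borel_measurable (lebesgue_on ({0<..<T} \<times> \<Omega>)) \<and>
     (\<exists>\<kappa>>0. (\<integral>\<^sup>+z. ennreal (M (fst z) (snd z) (\<xi> z /\<^sub>R \<kappa>)) \<partial>lebesgue_on ({0<..<T} \<times> \<Omega>)) < \<infinity>)"

definition modular_conv :: "real \<Rightarrow> (real^'n) set \<Rightarrow> (real \<Rightarrow> real^'n \<Rightarrow> real^'n \<Rightarrow> real)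
     \<Rightarrow> (real \<Rightarrow> (real \<times> (real^'n)) \<Rightarrow> real^'n) \<Rightarrow> ((real \<times> (real^'n)) \<Rightarrow> real^'n) \<Rightarrow> bool" where
  "modular_conv T \<Omega> M \<Xi> \<xi> \<longleftrightarrow> (\<exists>\<kappa>>0.
     ((\<lambda>\<delta>. \<integral>\<^sup>+z. ennreal (M (fst z) (snd z) ((\<Xi> \<delta> z - \<xi> z) /\<^sub>R \<kappa>)) \<partial>lebesgue_on ({0<..<T} \<times> \<Omega>))
        \<longlongrightarrow> 0) (at_right 0))"

definition in_V :: "real \<Rightarrow> (real^'n) set \<Rightarrow> (real \<Rightarrow> real^'n \<Rightarrow> real^'n \<Rightarrow> real)
                    \<Rightarrow> (real \<Rightarrow> real^'n \<Rightarrow> real) \<Rightarrow> (real \<Rightarrow> real^'n \<Rightarrow> real^'n) \<Rightarrow> bool" where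
  "in_V T \<Omega> M \<phi> G \<longleftrightarrow>
     (\<lambda>z. \<phi> (fst z) (snd z)) \<in> borel_measurable (lebesgue_on ({0<..<T} \<times> \<Omega>)) \<and>
     (\<lambda>z. G (fst z) (snd z)) \<in> borel_measurable (lebesgue_on ({0<..<T} \<times> \<Omega>)) \<and>
     esssup (lebesgue_on {0<..<T}) (\<lambda>t. enn2ereal (\<integral>\<^sup>+x. ennreal ((\<phi> t x)\<^sup>2) \<partial>lebesgue_on \<Omega>)) < \<infinity> \<and>
     (\<integral>\<^sup>+z. ennreal (\<bar>\<phi> (fst z) (snd z)\<bar> + norm (G (fst z) (snd z))) \<partial>lebesgue_on ({0<..<T} \<times> \<Omega>)) < \<infinity> \<and>
     (AE t in lebesgue_on {0<..<T}. W011_0 \<Omega> (\<phi> t) (G t)) \<and>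
     in_LM T \<Omega> M (\<lambda>z. G (fst z) (snd z))"

definition in_Linf_Cc :: "real \<Rightarrow> (real^'n) set \<Rightarrow> (real \<Rightarrow> real^'n \<Rightarrow> real) \<Rightarrow> bool" where
  "in_Linf_Cc T \<Omega> \<phi> \<longleftrightarrow>
     (\<lambda>z. \<phi> (fst z) (snd z)) \<in> borel_measurable (lebesgue_on ({0<..<T} \<times> \<Omega>)) \<and>
     (\<exists>K. compact K \<and> K \<subseteq> \<Omega> \<and>
        (AE t in lebesgue_on {0<..<T}. smooth_fun (\<phi> t) \<and> closure {x. \<phi> t x \<noteq> 0} \<subseteq> K) \<and>
        (\<forall>is. \<exists>C. AE t in lebesgue_on {0<..<T}. \<forall>x. \<bar>iter_pd is (\<phi> t) x\<bar> \<le> C))"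

definition Linf_norm :: "real \<Rightarrow> (real^'n) set \<Rightarrow> (real \<Rightarrow> real^'n \<Rightarrow> real) \<Rightarrow> ereal" where
  "Linf_norm T \<Omega> \<phi> = ess_sup_on ({0<..<T} \<times> \<Omega>) (\<lambda>z. \<bar>\<phi> (fst z) (snd z)\<bar>)"

end

theory Submission
  imports Defs
begin

text \<open>
  Extended by zero, \<open>\<phi>(t)\<close> has a weak gradient on the whole space. On the \<open>i\<close>-th piece of a partition of
  unity it is mollified at scale \<open>e\<close> after a shift by \<open>e a\<^sub>i\<close>, with \<open>a\<^sub>i\<close> transversal to the boundary, which
  makes the product with the partition function compactly supported in \<open>\<Omega>\<close>; a shift, unlike a dilation or a
  flow, commutes with the gradient, and \<open>M\<close> is anisotropic. The terms \<open>\<phi> \<nabla>\<theta>\<^sub>i\<close> need a bounded function: the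
  mollified function, rather than \<open>\<phi>\<close>, is composed with \<open>l sin (s / l)\<close>, so that only the classical chain
  rule is used, and since the derivative of that function is at most 1 in modulus, \<open>M\<close> does not increase.

  Jensen's inequality for the convex minorants of the infimum of \<open>M\<close> over a small cylinder, together with
  condition (M), bounds the modular of a mollified field by an integrable function plus a constant times the
  mollification of the modular. These majorants converge in the mean, so dominated convergence applies.
  The gradient has to be at most a power of the scale after mollification; to get this its part below a level
  \<open>n\<close> is split off, and \<open>\<phi>\<close> is set to zero at those times at which the part above level \<open>n\<close> is not small.
  Letting \<open>n\<close> and \<open>l\<close> tend to infinity gives the claim, with \<open>c = 1\<close>.
\<close>

subsection \<open>Families of smooth functions with uniformly bounded derivatives\<close>

text \<open>The shape is dictated by how little condition (M) gives. \<open>\<Theta>\<close> is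
  controlled only along the exact curve of second argument \<open>\<delta> powr (- N / q)\<close>,
  with q = 1 for (M) and q = p for (Mp), and without any doubling in that argument; so a mollified
  field must be bounded by this power with constant exactly 1. A kernel at scale
  \<open>\<delta> / (A + 1)\<close> has height of order \<open>\<delta> powr (- N)\<close>, hence
  the q-th power of the field must have small mass at each single time. Above a high level this
  holds for almost every t, but not uniformly in t, which is why times are discarded.
  \<open>M\<close> satisfies no doubling condition either, so sums are split by convexity at
  midpoints, and each split doubles the scale: finiteness of the modular of the gradient at
  \<open>\<kappa>\<close> ends in convergence at \<open>16 * \<kappa>\<close>. Finally,
  \<open>M\<close> is integrable only at constant vectors. This yields integrable majorants for
  bounded fields only; therefore the products with gradients of partition functions have to be
  bounded, although they cancel in the limit.\<close>

text \<open>The index of a family is the time variable; the bounds are uniform in it.\<close>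

primrec bdd_derivs_upto :: "nat \<Rightarrow> ('a \<Rightarrow> real^'n \<Rightarrow> real) \<Rightarrow> bool" where
  "bdd_derivs_upto 0 u \<longleftrightarrow> (\<exists>C. \<forall>t x. \<bar>u t x\<bar> \<le> C)"
| "bdd_derivs_upto (Suc k) u \<longleftrightarrow> (\<exists>C. \<forall>t x. \<bar>u t x\<bar> \<le> C) \<and> (\<forall>t x. u t differentiable (at x)) \<and>
     (\<forall>i. bdd_derivs_upto k (\<lambda>t. partial_deriv i (u t)))"

text \<open>The index type is free: \<open>unit\<close> serves for a single function such as a
  kernel or a partition function, \<open>real\<close> for a function of time and space whose spatial
  derivatives are to be bounded uniformly in time.\<close>

definition cb_smooth :: "('a \<Rightarrow> real^'n \<Rightarrow> real) \<Rightarrow> bool" where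
  "cb_smooth u \<longleftrightarrow> (\<forall>k. bdd_derivs_upto k u)"

lemma has_derivative_partial_deriv:
  assumes "(f has_derivative f') (at x)"
  shows "partial_deriv i f x = f' (axis i 1)"
  unfolding partial_deriv_def using frechet_derivative_at[OF assms] by simp

lemma partial_deriv_const [simp]: "partial_deriv i (\<lambda>_. c) = (\<lambda>_. 0)"
  by (rule ext) (simp add: has_derivative_partial_deriv[OF has_derivative_const])

lemma partial_deriv_add:
  assumes "f differentiable (at x)" "g differentiable (at x)"
  shows "partial_deriv i (\<lambda>x. f x + g x) x = partial_deriv i f x + partial_deriv i g x"
  using has_derivative_partial_deriv[OF has_derivative_add[OF assms[unfolded frechet_derivative_works]]]
  by (simp add: partial_deriv_def)

lemma partial_deriv_mult:
  assumes "f differentiable (at x)" "g differentiable (at x)"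
  shows "partial_deriv i (\<lambda>x. f x * g x) x = f x * partial_deriv i g x + partial_deriv i f x * g x"
  using has_derivative_partial_deriv[OF has_derivative_mult[OF assms[unfolded frechet_derivative_works]]]
  by (simp add: partial_deriv_def)

lemma partial_deriv_compose:
  assumes "(g has_real_derivative d) (at (f x))" "f differentiable (at x)"
  shows "partial_deriv i (\<lambda>x. g (f x)) x = d * partial_deriv i f x"
proof -
  have "(f has_derivative frechet_derivative f (at x)) (at x)"
    using assms(2) frechet_derivative_works by blast
  from has_derivative_compose[OF this assms(1)[unfolded has_field_derivative_def]]
  have "((\<lambda>x. g (f x)) has_derivative (\<lambda>h. d * frechet_derivative f (at x) h)) (at x)" by simp
  from has_derivative_partial_deriv[OF this] show ?thesis by (simp add: partial_deriv_def)
qed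

lemma differentiable_compose_real:
  fixes f :: "'a::real_normed_vector \<Rightarrow> real"
  assumes "(g has_real_derivative d) (at (f x))" "f differentiable (at x)"
  shows "(\<lambda>x. g (f x)) differentiable (at x)"
proof -
  have "(f has_derivative frechet_derivative f (at x)) (at x)"
    using assms(2) frechet_derivative_works by blast
  from has_derivative_compose[OF this assms(1)[unfolded has_field_derivative_def]]
  show ?thesis unfolding differentiable_def by blast
qed

lemma partial_deriv_sum:
  assumes "finite S" "\<And>j. j \<in> S \<Longrightarrow> f j differentiable (at x)"
  shows "partial_deriv i (\<lambda>x. \<Sum>j\<in>S. f j x) x = (\<Sum>j\<in>S. partial_deriv i (f j) x)"
proof -
  have "((\<lambda>x. \<Sum>j\<in>S. f j x) has_derivative (\<lambda>h. \<Sum>j\<in>S. frechet_derivative (f j) (at x) h)) (at x)"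
    by (rule has_derivative_sum) (use assms frechet_derivative_works in blast)
  from has_derivative_partial_deriv[OF this] show ?thesis by (simp add: partial_deriv_def)
qed

lemma frechet_derivative_eq_partial_derivs:
  fixes f :: "real^'n \<Rightarrow> real"
  assumes "f differentiable (at x)"
  shows "frechet_derivative f (at x) h = (\<Sum>i\<in>UNIV. h $ i * partial_deriv i f x)"
proof -
  let ?D = "frechet_derivative f (at x)"
  have l: "linear ?D" using assms linear_frechet_derivative by blast
  have "?D h = ?D (\<Sum>i\<in>UNIV. (h $ i) *\<^sub>R axis i 1)"
    using basis_expansion[of h] by (simp add: scalar_mult_eq_scaleR)
  also have "\<dots> = (\<Sum>i\<in>UNIV. h $ i * ?D (axis i 1))"
    by (simp add: linear_sum[OF l] linear_scale[OF l] o_def)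
  finally show ?thesis by (simp add: partial_deriv_def)
qed

lemma bdd_derivs_upto_Suc_imp: "bdd_derivs_upto (Suc k) u \<Longrightarrow> bdd_derivs_upto k u"
proof (induction k arbitrary: u)
  case (Suc k)
  then show ?case using bdd_derivs_upto.simps(2)[of k u] bdd_derivs_upto.simps(2)[of "Suc k" u] by blast
qed simp

lemma bdd_derivs_upto_const: "bdd_derivs_upto k (\<lambda>t x. c)"
  by (induction k arbitrary: c) auto

lemma bdd_derivs_upto_add:
  assumes "bdd_derivs_upto k u" "bdd_derivs_upto k v" shows "bdd_derivs_upto k (\<lambda>t x. u t x + v t x)"
  using assms
proof (induction k arbitrary: u v)
  case 0
  then obtain C D where "\<And>t x. \<bar>u t x\<bar> \<le> C" "\<And>t x. \<bar>v t x\<bar> \<le> D" by auto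
  then have "\<forall>t x. \<bar>u t x + v t x\<bar> \<le> C + D" by (meson abs_triangle_ineq add_mono order_trans)
  then show ?case by auto
next
  case (Suc k)
  obtain C D where "\<And>t x. \<bar>u t x\<bar> \<le> C" "\<And>t x. \<bar>v t x\<bar> \<le> D" using Suc.prems by auto
  then have b: "\<forall>t x. \<bar>u t x + v t x\<bar> \<le> C + D" by (meson abs_triangle_ineq add_mono order_trans)
  have d: "u t differentiable (at x)" "v t differentiable (at x)" for t x using Suc.prems by auto
  have e: "(\<lambda>t. partial_deriv i (\<lambda>x. u t x + v t x)) = (\<lambda>t x. partial_deriv i (u t) x + partial_deriv i (v t) x)" for i
    by (intro ext partial_deriv_add d)
  have "bdd_derivs_upto k (\<lambda>t x. partial_deriv i (u t) x + partial_deriv i (v t) x)" for i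
    using Suc.prems by (intro Suc.IH) auto
  then show ?case unfolding bdd_derivs_upto.simps e using b d by (intro conjI allI differentiable_add) blast+
qed

lemma bdd_derivs_upto_mult:
  assumes "bdd_derivs_upto k u" "bdd_derivs_upto k v" shows "bdd_derivs_upto k (\<lambda>t x. u t x * v t x)"
  using assms
proof (induction k arbitrary: u v)
  case 0
  then obtain C D where "\<And>t x. \<bar>u t x\<bar> \<le> C" "\<And>t x. \<bar>v t x\<bar> \<le> D" by auto
  then have "\<forall>t x. \<bar>u t x * v t x\<bar> \<le> C * D"
    unfolding abs_mult by (intro allI mult_mono) (auto intro: order_trans[OF abs_ge_zero])
  then show ?case by auto
next
  case (Suc k)
  obtain C D where "\<And>t x. \<bar>u t x\<bar> \<le> C" "\<And>t x. \<bar>v t x\<bar> \<le> D" using Suc.prems by auto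
  then have b: "\<forall>t x. \<bar>u t x * v t x\<bar> \<le> C * D"
    unfolding abs_mult by (intro allI mult_mono) (auto intro: order_trans[OF abs_ge_zero])
  have d: "u t differentiable (at x)" "v t differentiable (at x)" for t x using Suc.prems by auto
  have e: "(\<lambda>t. partial_deriv i (\<lambda>x. u t x * v t x)) = (\<lambda>t x. u t x * partial_deriv i (v t) x + partial_deriv i (u t) x * v t x)" for i
    by (intro ext partial_deriv_mult d)
  have "bdd_derivs_upto k (\<lambda>t x. u t x * partial_deriv i (v t) x + partial_deriv i (u t) x * v t x)" for i
    using Suc.prems bdd_derivs_upto_Suc_imp[of k u] bdd_derivs_upto_Suc_imp[of k v] by (intro bdd_derivs_upto_add Suc.IH) auto
  then show ?case unfolding bdd_derivs_upto.simps e using b d by (intro conjI allI differentiable_mult) blast+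
qed

text \<open>Two features close the induction and widen its use. The outer function comes with its
  whole sequence of derivatives \<open>g j\<close>, so the chain rule stays in the same family. And
  only the derivatives of \<open>u\<close> are assumed bounded, not \<open>u\<close> itself, which
  admits affine functions of a coordinate.\<close>

lemma bdd_derivs_upto_compose:
  assumes g: "\<And>j s. (g j has_real_derivative g (Suc j) s) (at s)"
    and gb: "\<And>j. \<exists>C. \<forall>s. \<bar>g j s\<bar> \<le> C"
    and u: "\<And>t x. u t differentiable (at x)" "\<And>i. cb_smooth (\<lambda>t. partial_deriv i (u t))"
  shows "bdd_derivs_upto k (\<lambda>t x. g j (u t x))"
proof (induction k arbitrary: j)
  case 0
  then show ?case using gb[of j] by auto
next
  case (Suc k)
  have e: "(\<lambda>t. partial_deriv i (\<lambda>x. g j (u t x))) = (\<lambda>t x. g (Suc j) (u t x) * partial_deriv i (u t) x)" for i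
    by (intro ext partial_deriv_compose g u)
  have "bdd_derivs_upto k (\<lambda>t x. g (Suc j) (u t x) * partial_deriv i (u t) x)" for i
    using u(2) by (intro bdd_derivs_upto_mult Suc.IH) (auto simp: cb_smooth_def)
  then show ?case using gb[of j] differentiable_compose_real[OF g u(1)] by (auto simp: e)
qed

lemma cb_smoothD:
  assumes "cb_smooth u"
  shows "\<exists>C. \<forall>t x. \<bar>u t x\<bar> \<le> C" "u t differentiable (at x)" "cb_smooth (\<lambda>t. partial_deriv i (u t))"
proof -
  have c: "bdd_derivs_upto k u" for k using assms by (simp add: cb_smooth_def)
  show "\<exists>C. \<forall>t x. \<bar>u t x\<bar> \<le> C" using c[of 0] by simp
  show "u t differentiable (at x)" using c[of 1] by simp
  show "cb_smooth (\<lambda>t. partial_deriv i (u t))"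
    unfolding cb_smooth_def using c[of "Suc k" for k] by simp
qed

lemma cb_smooth_const [simp]: "cb_smooth (\<lambda>t x. c)"
  and cb_smooth_add: "cb_smooth u \<Longrightarrow> cb_smooth v \<Longrightarrow> cb_smooth (\<lambda>t x. u t x + v t x)"
  and cb_smooth_mult: "cb_smooth u \<Longrightarrow> cb_smooth v \<Longrightarrow> cb_smooth (\<lambda>t x. u t x * v t x)"
  by (simp_all add: cb_smooth_def bdd_derivs_upto_const bdd_derivs_upto_add bdd_derivs_upto_mult)

lemma cb_smooth_compose:
  assumes "\<And>j s. (g j has_real_derivative g (Suc j) s) (at s)" "\<And>j. \<exists>C. \<forall>s. \<bar>g j s\<bar> \<le> C"
    and "\<And>t x. u t differentiable (at x)" "\<And>i. cb_smooth (\<lambda>t. partial_deriv i (u t))"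
  shows "cb_smooth (\<lambda>t x. g j (u t x))"
  unfolding cb_smooth_def by (intro allI bdd_derivs_upto_compose assms)

lemma cb_smooth_sum:
  assumes "finite S" "\<And>j. j \<in> S \<Longrightarrow> cb_smooth (u j)"
  shows "cb_smooth (\<lambda>t x. \<Sum>j\<in>S. u j t x)"
  using assms by (induction S) (simp_all add: cb_smooth_add)

lemma cb_smooth_prod:
  assumes "finite S" "\<And>j. j \<in> S \<Longrightarrow> cb_smooth (u j)"
  shows "cb_smooth (\<lambda>t x. \<Prod>j\<in>S. u j t x)"
  using assms by (induction S) (simp_all add: cb_smooth_mult)

lemma cb_smooth_reindex: "cb_smooth u \<Longrightarrow> cb_smooth (\<lambda>s. u (r s))"
proof -
  have "bdd_derivs_upto k u \<Longrightarrow> bdd_derivs_upto k (\<lambda>s. u (r s))" for k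
  proof (induction k arbitrary: u)
    case (Suc k)
    then have "bdd_derivs_upto k (\<lambda>s. partial_deriv i (u (r s)))" for i
      using Suc.IH[of "\<lambda>t. partial_deriv i (u t)"] by simp
    then show ?case using Suc.prems by auto
  qed auto
  then show "cb_smooth u \<Longrightarrow> ?thesis" by (auto simp: cb_smooth_def)
qed

lemma cb_smooth_iter_pd: "cb_smooth u \<Longrightarrow> cb_smooth (\<lambda>t. iter_pd is (u t))"
  by (induction "is") (simp_all add: cb_smoothD(3))

lemma cb_smooth_imp_smooth_fun: "cb_smooth u \<Longrightarrow> smooth_fun (u t)"
  unfolding smooth_fun_def using cb_smoothD(2)[OF cb_smooth_iter_pd, of u] by simp

lemma cb_smooth_sin:
  assumes "cb_smooth u" shows "cb_smooth (\<lambda>t x. sin (u t x))"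
proof -
  \<comment> \<open>Differentiating the sine is a shift by a quarter period, so one formula covers
    every order.\<close>
  define g where "g = (\<lambda>j s. sin (s + real j * (pi/2)))"
  have "(g j has_real_derivative g (Suc j) s) (at s)" for j s
  proof -
    have "g (Suc j) s = cos (s + real j * (pi/2))"
      using sin_add[of "s + real j * (pi/2)" "pi/2"] by (simp add: g_def field_simps)
    then show ?thesis unfolding g_def by (auto intro!: derivative_eq_intros)
  qed
  moreover have "\<exists>C. \<forall>s. \<bar>g j s\<bar> \<le> C" for j by (auto simp: g_def intro!: exI[of _ 1])
  ultimately have "cb_smooth (\<lambda>t x. g 0 (u t x))"
    using cb_smoothD(2,3)[OF assms] by (rule cb_smooth_compose)
  then show ?thesis by (simp add: g_def)
qed

subsection \<open>Convolution\<close>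

definition conv :: "(real^'n \<Rightarrow> real) \<Rightarrow> (real^'n \<Rightarrow> 'b::{banach,second_countable_topology}) \<Rightarrow> real^'n \<Rightarrow> 'b" where
  "conv K f x = (\<integral>y. K (x - y) *\<^sub>R f y \<partial>lborel)"

section \<open>Invariance of Lebesgue measure under translation and reflection\<close>

lemma lborel_distr_diff: "distr lborel borel (\<lambda>y. x - y) = (lborel :: 'a::euclidean_space measure)"
proof -
  have "(lborel :: 'a measure) = density (distr lborel borel (\<lambda>y. x + (-1) *\<^sub>R y)) (\<lambda>_. ennreal (\<bar>-1\<bar> ^ DIM('a)))"
    by (rule lborel_affine) simp
  also have "\<dots> = distr lborel borel (\<lambda>y. x - y)"
    by (simp add: density_1)
  finally show ?thesis by simp
qed

lemma lborel_distr_add: "distr lborel borel (\<lambda>y. x + y) = (lborel :: 'a::euclidean_space measure)"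
proof -
  have "(lborel :: 'a measure) = density (distr lborel borel (\<lambda>y. x + 1 *\<^sub>R y)) (\<lambda>_. ennreal (\<bar>1\<bar> ^ DIM('a)))"
    by (rule lborel_affine) simp
  also have "\<dots> = distr lborel borel (\<lambda>y. x + y)"
    by (simp add: density_1)
  finally show ?thesis by simp
qed

lemma nn_integral_lborel_add:
  fixes x :: "'a::euclidean_space"
  assumes "f \<in> borel_measurable borel"
  shows "(\<integral>\<^sup>+y. f (x + y) \<partial>lborel) = (\<integral>\<^sup>+y. f y \<partial>lborel)"
proof -
  have "(\<integral>\<^sup>+y. f y \<partial>lborel) = (\<integral>\<^sup>+y. f y \<partial>distr lborel borel (\<lambda>y. x + y))"
    by (simp only: lborel_distr_add)
  then show ?thesis using assms by (simp add: nn_integral_distr)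
qed

lemma integral_lborel_diff:
  fixes x :: "'a::euclidean_space" and f :: "'a \<Rightarrow> 'b::{banach,second_countable_topology}"
  assumes "f \<in> borel_measurable borel"
  shows "(\<integral>y. f (x - y) \<partial>lborel) = (\<integral>y. f y \<partial>lborel)"
proof -
  have "(\<integral>y. f y \<partial>lborel) = (\<integral>y. f y \<partial>distr lborel borel (\<lambda>y. x - y))"
    by (simp only: lborel_distr_diff)
  then show ?thesis using assms by (simp add: integral_distr)
qed

lemma integrable_lborel_diff:
  fixes x :: "'a::euclidean_space" and f :: "'a \<Rightarrow> 'b::{banach,second_countable_topology}"
  assumes "integrable lborel f"
  shows "integrable lborel (\<lambda>y. f (x - y))"
proof -
  have "integrable (distr lborel borel (\<lambda>y. x - y)) f"
    using assms by (simp only: lborel_distr_diff)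
  then show ?thesis using borel_measurable_integrable[OF assms] by (simp add: integrable_distr_eq)
qed

lemma conv_flip:
  assumes [measurable]: "K \<in> borel_measurable borel" "f \<in> borel_measurable borel"
  shows "conv K f x = (\<integral>y. K y *\<^sub>R f (x - y) \<partial>lborel)"
proof -
  have "(\<integral>y. (\<lambda>y. K (x - y) *\<^sub>R f y) (x - y) \<partial>lborel) = conv K f x"
    unfolding conv_def by (rule integral_lborel_diff) measurable
  then show ?thesis by simp
qed

lemma conv_commute:
  fixes K f :: "real^'n \<Rightarrow> real"
  assumes "K \<in> borel_measurable borel" "f \<in> borel_measurable borel"
  shows "conv K f x = conv f K x"
  using conv_flip[OF assms, of x] by (simp add: conv_def mult.commute)

section \<open>Bounds for a convolution and differentiation through its kernel\<close>

lemma integrable_bounded_mult: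
  fixes f :: "real^'n \<Rightarrow> 'b::{banach,second_countable_topology}"
  assumes K[measurable]: "K \<in> borel_measurable borel" and B: "\<And>x. \<bar>K x\<bar> \<le> B" and f: "integrable lborel f"
  shows "integrable lborel (\<lambda>y. K (x - y) *\<^sub>R f y)"
proof (rule Bochner_Integration.integrable_bound)
  show "integrable lborel (\<lambda>y. B *\<^sub>R norm (f y))" using f by simp
  have [measurable]: "f \<in> borel_measurable borel" using f by auto
  show "(\<lambda>y. K (x - y) *\<^sub>R f y) \<in> borel_measurable lborel" by measurable
  have "\<bar>K (x - y)\<bar> * norm (f y) \<le> \<bar>B\<bar> * norm (f y)" for y
    using B[of "x - y"] by (intro mult_right_mono) auto
  then show "AE y in lborel. norm (K (x - y) *\<^sub>R f y) \<le> norm (B *\<^sub>R norm (f y))" by (simp add: abs_mult)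
qed

lemma norm_conv_le:
  fixes f :: "real^'n \<Rightarrow> 'b::{banach,second_countable_topology}"
  assumes K: "K \<in> borel_measurable borel" and B: "\<And>x. \<bar>K x\<bar> \<le> B" and f: "integrable lborel f"
  shows "norm (conv K f x) \<le> B * (\<integral>y. norm (f y) \<partial>lborel)"
proof -
  have "norm (conv K f x) \<le> (\<integral>y. norm (K (x - y) *\<^sub>R f y) \<partial>lborel)"
    unfolding conv_def by (rule integral_norm_bound)
  also have "\<dots> \<le> (\<integral>y. B * norm (f y) \<partial>lborel)"
    using integrable_norm[OF integrable_bounded_mult[OF K B f]] f
    by (intro integral_mono) (auto intro!: mult_right_mono B)
  finally show ?thesis by simp
qed

text \<open>The mean value inequality; the factor \<open>CARD('n)\<close> comes from summing the
  partial derivatives. The second bound is the same estimate for the linear part, so that the two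
  together bound a first-order remainder.\<close>

lemma lipschitz_of_bounded_partial_derivs:
  fixes K :: "real^'n \<Rightarrow> real"
  assumes d: "\<And>x. K differentiable (at x)" and B: "\<And>i x. \<bar>partial_deriv i K x\<bar> \<le> B"
  shows "\<bar>K x - K y\<bar> \<le> real CARD('n) * B * norm (x - y)"
    and "\<bar>\<Sum>i\<in>UNIV. h $ i * partial_deriv i K x\<bar> \<le> real CARD('n) * B * norm h"
proof -
  have B0: "0 \<le> B" using B by (meson abs_ge_zero order_trans)
  have *: "\<bar>\<Sum>i\<in>UNIV. h $ i * partial_deriv i K x\<bar> \<le> real CARD('n) * B * norm h" for h x
  proof -
    have "\<bar>\<Sum>i\<in>UNIV. h $ i * partial_deriv i K x\<bar> \<le> (\<Sum>i\<in>(UNIV::'n set). norm h * B)"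
      by (rule order_trans[OF sum_abs], unfold abs_mult)
         (intro sum_mono mult_mono component_le_norm_cart B; simp)
    then show ?thesis by (simp add: mult_ac)
  qed
  show "\<bar>\<Sum>i\<in>UNIV. h $ i * partial_deriv i K x\<bar> \<le> real CARD('n) * B * norm h" by (rule *)
  have "norm (K x - K y) \<le> real CARD('n) * B * norm (x - y)"
  proof (rule differentiable_bound[of UNIV])
    fix x assume "x \<in> (UNIV::(real^'n) set)"
    show "(K has_derivative frechet_derivative K (at x)) (at x within UNIV)"
      using d frechet_derivative_works by auto
    show "onorm (frechet_derivative K (at x)) \<le> real CARD('n) * B"
      using * B0 by (intro onorm_bound) (auto simp: frechet_derivative_eq_partial_derivs[OF d])
  qed auto
  then show "\<bar>K x - K y\<bar> \<le> real CARD('n) * B * norm (x - y)" by simp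
qed

lemma borel_measurable_differentiable:
  fixes K :: "real^'n \<Rightarrow> real"
  shows "(\<And>x. K differentiable (at x)) \<Longrightarrow> K \<in> borel_measurable borel"
  by (intro borel_measurable_continuous_onI continuous_at_imp_continuous_on)
     (auto intro: differentiable_imp_continuous_within)

text \<open>The derivative is put on the kernel, so integrability of \<open>f\<close> suffices. The
  first-order remainder of \<open>K\<close>, divided by the norm of the increment, is bounded by a
  constant and tends to 0 pointwise; dominated convergence against a multiple of the modulus of
  \<open>f\<close> does the rest.\<close>

lemma has_derivative_conv:
  fixes K f :: "real^'n \<Rightarrow> real"
  assumes d: "\<And>x. K differentiable (at x)" and B0: "\<And>x. \<bar>K x\<bar> \<le> B0"
    and B: "\<And>i x. \<bar>partial_deriv i K x\<bar> \<le> B"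
    and pm[measurable]: "\<And>i. partial_deriv i K \<in> borel_measurable borel"
    and f: "integrable lborel f"
  shows "(conv K f has_derivative (\<lambda>h. \<Sum>i\<in>UNIV. h $ i * conv (partial_deriv i K) f x)) (at x)"
proof -
  have [measurable]: "K \<in> borel_measurable borel" "f \<in> borel_measurable borel"
    using borel_measurable_differentiable[OF d] f by auto
  define D where "D h = (\<Sum>i\<in>UNIV. h $ i * conv (partial_deriv i K) f x)" for h
  define r where "r h y = K (x + h - y) - K (x - y) - (\<Sum>i\<in>UNIV. h $ i * partial_deriv i K (x - y))" for h y
  have bl: "bounded_linear D"
    unfolding D_def by (intro bounded_linear_sum bounded_linear_mult_const bounded_linear_vec_nth)
  have int: "integrable lborel (\<lambda>y. K (z - y) * f y)" "integrable lborel (\<lambda>y. partial_deriv i K (z - y) * f y)" for z i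
    using integrable_bounded_mult[of K B0 f z] integrable_bounded_mult[of "partial_deriv i K" B f z] B0 B f by auto
  have split: "r h y * f y = K (x + h - y) * f y - K (x - y) * f y - (\<Sum>i\<in>UNIV. h $ i * (partial_deriv i K (x - y) * f y))" for h y
    by (simp add: r_def left_diff_distrib sum_distrib_right mult.assoc)
  have eq: "conv K f (x + h) - conv K f x - D h = (\<integral>y. r h y * f y \<partial>lborel)" for h
    unfolding split using int by (simp add: D_def conv_def)
  have rb: "\<bar>r h y\<bar> \<le> 2 * real CARD('n) * B * norm h" for h y
    using lipschitz_of_bounded_partial_derivs(1)[OF d B, of "x + h - y" "x - y"]
      lipschitz_of_bounded_partial_derivs(2)[OF d B, of h "x - y"]
    by (simp add: r_def algebra_simps)
  have B': "0 \<le> B" using B by (meson abs_ge_zero order_trans)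
  have "((\<lambda>h. norm (conv K f (x + h) - conv K f x - D h) / norm h) \<longlongrightarrow> 0) (at 0)"
    unfolding tendsto_at_iff_sequentially comp_def
  proof (intro allI impI)
    fix X :: "nat \<Rightarrow> real^'n" assume X: "\<forall>i. X i \<in> UNIV - {0}" "X \<longlonglongrightarrow> 0"
    have "(\<lambda>j. \<integral>y. r (X j) y * f y / norm (X j) \<partial>lborel) \<longlonglongrightarrow> (\<integral>y. 0 \<partial>(lborel :: (real^'n) measure))"
    proof (rule integral_dominated_convergence[where w="\<lambda>y. 2 * real CARD('n) * B * \<bar>f y\<bar>"])
      show "(\<lambda>y. r (X j) y * f y / norm (X j)) \<in> borel_measurable lborel" for j
        unfolding r_def by measurable
      show "integrable lborel (\<lambda>y. 2 * real CARD('n) * B * \<bar>f y\<bar>)" using f by simp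
      show "AE y in lborel. norm (r (X j) y * f y / norm (X j)) \<le> 2 * real CARD('n) * B * \<bar>f y\<bar>" for j
      proof (intro AE_I2)
        fix y
        have "\<bar>r (X j) y\<bar> / norm (X j) \<le> 2 * real CARD('n) * B"
          using X(1) rb[of "X j" y] by (simp add: divide_le_eq)
        from mult_right_mono[OF this, of "\<bar>f y\<bar>"]
        show "norm (r (X j) y * f y / norm (X j)) \<le> 2 * real CARD('n) * B * \<bar>f y\<bar>"
          by (simp add: abs_mult)
      qed
      show "AE y in lborel. (\<lambda>j. r (X j) y * f y / norm (X j)) \<longlonglongrightarrow> 0"
      proof (intro AE_I2)
        fix y
        have "(K has_derivative (\<lambda>h. \<Sum>i\<in>UNIV. h $ i * partial_deriv i K (x - y))) (at (x - y))"
          using d[of "x-y"] frechet_derivative_works frechet_derivative_eq_partial_derivs[OF d[of "x-y"]]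
          by (metis (no_types, lifting) ext)
        then have "((\<lambda>h. norm (r h y) / norm h) \<longlongrightarrow> 0) (at 0)"
          by (simp add: has_derivative_at r_def algebra_simps)
        then have "(\<lambda>j. norm (r (X j) y) / norm (X j)) \<longlonglongrightarrow> 0"
          using X unfolding tendsto_at_iff_sequentially comp_def by blast
        then have "(\<lambda>j. \<bar>r (X j) y / norm (X j)\<bar>) \<longlonglongrightarrow> 0" by simp
        then have "(\<lambda>j. r (X j) y / norm (X j)) \<longlonglongrightarrow> 0" by (rule tendsto_rabs_zero_cancel)
        from tendsto_mult_left_zero[OF this, of "f y"]
        show "(\<lambda>j. r (X j) y * f y / norm (X j)) \<longlonglongrightarrow> 0" by simp
      qed
    qed simp
    then have "(\<lambda>j. \<bar>(\<integral>y. r (X j) y * f y \<partial>lborel) / norm (X j)\<bar>) \<longlonglongrightarrow> 0"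
      by (intro tendsto_rabs_zero) simp
    then show "(\<lambda>j. norm (conv K f (x + X j) - conv K f x - D (X j)) / norm (X j)) \<longlonglongrightarrow> 0"
      by (simp add: eq)
  qed
  then show ?thesis using bl unfolding has_derivative_at D_def by blast
qed

lemma cb_smooth_facts:
  fixes K :: "real^'n \<Rightarrow> real"
  assumes "cb_smooth (\<lambda>_::unit. K)"
  shows "K differentiable (at x)" "K \<in> borel_measurable borel"
    "partial_deriv i K \<in> borel_measurable borel" "\<exists>B. \<forall>x. \<bar>K x\<bar> \<le> B" "\<exists>B. \<forall>i x. \<bar>partial_deriv i K x\<bar> \<le> B"
proof -
  show d: "K differentiable (at x)" for x using cb_smoothD(2)[OF assms] .
  then show "K \<in> borel_measurable borel" by (rule borel_measurable_differentiable)
  have "partial_deriv i K differentiable (at x)" for x i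
    using cb_smoothD(2)[OF cb_smoothD(3)[OF assms]] .
  then show "partial_deriv i K \<in> borel_measurable borel" by (rule borel_measurable_differentiable)
  show "\<exists>B. \<forall>x. \<bar>K x\<bar> \<le> B" using cb_smoothD(1)[OF assms] by simp
  have "\<forall>i. \<exists>B. \<forall>x. \<bar>partial_deriv i K x\<bar> \<le> B" using cb_smoothD(1)[OF cb_smoothD(3)[OF assms]] by simp
  then obtain B where B: "\<And>i x. \<bar>partial_deriv i K x\<bar> \<le> B i" by metis
  have "\<bar>partial_deriv i K x\<bar> \<le> (\<Sum>i\<in>UNIV. \<bar>B i\<bar>)" for i x
    using B[of i x] member_le_sum[of i UNIV "\<lambda>i. \<bar>B i\<bar>"] abs_ge_self[of "B i"] by fastforce
  then show "\<exists>B. \<forall>i x. \<bar>partial_deriv i K x\<bar> \<le> B" by blast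
qed

lemma conv_differentiable:
  fixes K f :: "real^'n \<Rightarrow> real"
  assumes K: "cb_smooth (\<lambda>_::unit. K)" and f: "integrable lborel f"
  shows "(\<lambda>x. conv K f (x + c)) differentiable (at x)"
    and "partial_deriv i (\<lambda>x. conv K f (x + c)) x = conv (partial_deriv i K) f (x + c)"
proof -
  note [measurable] = cb_smooth_facts(2,3)[OF K]
  obtain B0 B where "\<And>x. \<bar>K x\<bar> \<le> B0" "\<And>i x. \<bar>partial_deriv i K x\<bar> \<le> B"
    using cb_smooth_facts(4,5)[OF K] by blast
  then have D: "(conv K f has_derivative (\<lambda>h. \<Sum>i\<in>UNIV. h $ i * conv (partial_deriv i K) f (x+c))) (at (x+c))"
    using cb_smooth_facts(1)[OF K] f cb_smooth_facts(3)[OF K] by (intro has_derivative_conv)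
  have "((\<lambda>x. x + c) has_derivative (\<lambda>h. h)) (at x)" by (auto intro!: derivative_eq_intros)
  from has_derivative_compose[OF this D]
  have *: "((\<lambda>x. conv K f (x + c)) has_derivative (\<lambda>h. \<Sum>i\<in>UNIV. h $ i * conv (partial_deriv i K) f (x+c))) (at x)" .
  then show "(\<lambda>x. conv K f (x + c)) differentiable (at x)" unfolding differentiable_def by blast
  show "partial_deriv i (\<lambda>x. conv K f (x + c)) x = conv (partial_deriv i K) f (x + c)"
    unfolding has_derivative_partial_deriv[OF *]
    by (simp add: axis_def if_distrib[of "\<lambda>b. b * _"] cong: if_cong)
qed

text \<open>Every derivative falls on \<open>K\<close>, so each one is bounded by the supremum of a
  derivative of the kernel times \<open>C\<close>: a bound on the L1 norms uniform in t becomes a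
  bound on all spatial derivatives uniform in t. The induction varies the kernel, since derivatives
  of kernels are again admissible.\<close>

lemma cb_smooth_conv:
  fixes K :: "real^'n \<Rightarrow> real" and f :: "'a \<Rightarrow> real^'n \<Rightarrow> real"
  assumes K: "cb_smooth (\<lambda>_::unit. K)" and f: "\<And>t. integrable lborel (f t)"
    and C: "\<And>t. (\<integral>x. \<bar>f t x\<bar> \<partial>lborel) \<le> C"
  shows "cb_smooth (\<lambda>t x. conv K (f t) (x + c))"
proof -
  have bd: "\<exists>D. \<forall>t x. \<bar>conv K (f t) (x + c)\<bar> \<le> D" if K: "cb_smooth (\<lambda>_::unit. K)" for K :: "real^'n \<Rightarrow> real"
  proof -
    obtain B where B: "\<And>x. \<bar>K x\<bar> \<le> B" using cb_smooth_facts(4)[OF K] by blast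
    then have B': "0 \<le> B" by (meson abs_ge_zero order_trans)
    have "\<bar>conv K (f t) (x + c)\<bar> \<le> B * C" for t x
      using norm_conv_le[OF cb_smooth_facts(2)[OF K] B f[of t], of "x + c"] mult_left_mono[OF C B', of t]
      by simp
    then show ?thesis by blast
  qed
  have "bdd_derivs_upto k (\<lambda>t x. conv K (f t) (x + c))" for k
    using K
  proof (induction k arbitrary: K)
    case 0
    then show ?case using bd by simp
  next
    case (Suc k)
    have "(\<lambda>t. partial_deriv i (\<lambda>x. conv K (f t) (x + c))) = (\<lambda>t x. conv (partial_deriv i K) (f t) (x + c))" for i
      by (intro ext conv_differentiable(2)[OF Suc.prems f])
    then show ?case using bd[OF Suc.prems] Suc.IH[OF cb_smoothD(3)[OF Suc.prems]]
        conv_differentiable(1)[OF Suc.prems f] by simp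
  qed
  then show ?thesis by (simp add: cb_smooth_def)
qed

subsection \<open>Mollifiers\<close>

text \<open>The classical smooth function that is flat at 0, \<open>exp (-1/s)\<close> for positive
  s, with a polynomial factor in \<open>1/s\<close>; thanks to this factor the class is closed under
  differentiation.\<close>

definition flat_exp :: "real poly \<Rightarrow> real \<Rightarrow> real" where
  "flat_exp p s = (if 0 < s then poly p (1/s) * exp (-1/s) else 0)"

text \<open>Each power satisfies \<open>r ^ i \<le> fact i * exp r\<close>, being one term of the
  exponential series.\<close>

lemma poly_exp_bounded: "\<exists>C. \<forall>r\<ge>0. \<bar>poly p r\<bar> * exp (-r) \<le> (C::real)"
proof (intro exI allI impI)
  fix r :: real assume r: "0 \<le> r"
  have "\<bar>poly p r\<bar> \<le> (\<Sum>i\<le>degree p. \<bar>coeff p i\<bar> * r ^ i)"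
    unfolding poly_altdef by (rule order_trans[OF sum_abs]) (simp add: abs_mult r)
  also have "\<dots> \<le> (\<Sum>i\<le>degree p. \<bar>coeff p i\<bar> * (fact i * exp r))"
  proof (intro sum_mono mult_left_mono)
    fix i
    have "r ^ i / fact i \<le> exp r"
      using sum_le_suminf[OF summable_exp_generic[of r], of "{i}"] r
      by (simp add: exp_def divide_inverse mult.commute)
    then show "r ^ i \<le> fact i * exp r" by (simp add: divide_le_eq mult.commute)
  qed simp
  finally have "\<bar>poly p r\<bar> * exp (-r) \<le> (\<Sum>i\<le>degree p. \<bar>coeff p i\<bar> * (fact i * exp r)) * exp (-r)"
    by (rule mult_right_mono) simp
  also have "\<dots> = (\<Sum>i\<le>degree p. \<bar>coeff p i\<bar> * fact i)"
    by (simp add: sum_distrib_right mult.assoc exp_minus)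
  finally show "\<bar>poly p r\<bar> * exp (-r) \<le> (\<Sum>i\<le>degree p. \<bar>coeff p i\<bar> * fact i)" .
qed

lemma flat_exp_bounded: "\<exists>C. \<forall>s. \<bar>flat_exp p s\<bar> \<le> C"
proof -
  obtain C where C: "\<And>r. r \<ge> 0 \<Longrightarrow> \<bar>poly p r\<bar> * exp (-r) \<le> C" using poly_exp_bounded[of p] by blast
  have "\<bar>flat_exp p s\<bar> \<le> C" for s
    using C[of "1/s"] order_trans[OF _ C[of 0]] by (auto simp: flat_exp_def abs_mult)
  then show ?thesis by blast
qed

text \<open>Boundedness for the polynomial multiplied by the square of its variable is a quadratic
  bound for the original one; it yields derivative 0 at the origin.\<close>

lemma flat_exp_le: "\<exists>C. \<forall>s. \<bar>flat_exp p s\<bar> \<le> C * s\<^sup>2"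
proof -
  obtain C where C: "\<And>s. \<bar>flat_exp (monom 1 2 * p) s\<bar> \<le> C" using flat_exp_bounded by blast
  have "\<bar>flat_exp p s\<bar> \<le> C * s\<^sup>2" for s
  proof (cases "0 < s")
    case True
    then have "flat_exp (monom 1 2 * p) s = flat_exp p s / s\<^sup>2"
      by (simp add: flat_exp_def poly_monom power_divide)
    then have "\<bar>flat_exp p s\<bar> / s\<^sup>2 \<le> C" using C[of s] by simp
    then show ?thesis using True by (simp add: divide_le_eq)
  next
    case False
    have "0 \<le> C" using C[of 0] by simp
    then show ?thesis using False by (simp add: flat_exp_def)
  qed
  then show ?thesis by blast
qed

text \<open>For positive s the chain rule turns \<open>poly p (1/s) * exp (-1/s)\<close> into
  \<open>poly (p - pderiv p) (1/s) * exp (-1/s)\<close> divided by the square of s. At 0 the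
  difference quotient is at most a multiple of \<open>\<bar>h\<bar>\<close>.\<close>

lemma flat_exp_has_derivative:
  "(flat_exp p has_real_derivative flat_exp (monom 1 2 * (p - pderiv p)) s) (at s)"
proof -
  consider "0 < s" | "s < 0" | "s = 0" by linarith
  then show ?thesis
  proof cases
    case 1
    have d: "((\<lambda>s. 1 / s) has_real_derivative - (1 / s\<^sup>2)) (at s)"
      using 1 by (auto intro!: derivative_eq_intros simp: power2_eq_square)
    note d1 = DERIV_chain2[OF poly_DERIV d, of p]
    have d2: "((\<lambda>s. exp (-1/s)) has_real_derivative exp (-1/s) * (1 / s\<^sup>2)) (at s)"
      using DERIV_fun_exp[OF DERIV_minus[OF d]] by simp
    have "((\<lambda>s. poly p (1/s) * exp (-1/s)) has_real_derivative flat_exp (monom 1 2 * (p - pderiv p)) s) (at s)"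
      by (rule DERIV_cong[OF DERIV_mult[OF d1 d2]]) (use 1 in \<open>simp add: flat_exp_def poly_monom power_divide algebra_simps\<close>)
    moreover have "eventually (\<lambda>s. flat_exp p s = poly p (1/s) * exp (-1/s)) (nhds s)"
      using eventually_nhds_in_open[of "{0<..}" s] 1 by (auto simp: flat_exp_def elim!: eventually_mono)
    ultimately show ?thesis by (subst DERIV_cong_ev[OF refl _ refl])
  next
    case 2
    have "((\<lambda>s. 0) has_real_derivative flat_exp (monom 1 2 * (p - pderiv p)) s) (at s)"
      using 2 by (auto simp: flat_exp_def)
    moreover have "eventually (\<lambda>s. flat_exp p s = 0) (nhds s)"
      using eventually_nhds_in_open[of "{..<0}" s] 2 by (auto simp: flat_exp_def elim!: eventually_mono)
    ultimately show ?thesis by (subst DERIV_cong_ev[OF refl _ refl])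
  next
    case 3
    obtain C where C: "\<And>s. \<bar>flat_exp p s\<bar> \<le> C * s\<^sup>2" using flat_exp_le by blast
    have "((\<lambda>h. flat_exp p h / h) \<longlongrightarrow> 0) (at 0)"
    proof (rule Lim_null_comparison)
      show "\<forall>\<^sub>F h in at 0. norm (flat_exp p h / h) \<le> C * \<bar>h\<bar>"
      proof (rule eventually_at_filter[THEN iffD2], rule eventuallyI, intro impI)
        fix h :: real assume "h \<noteq> 0"
        then show "norm (flat_exp p h / h) \<le> C * \<bar>h\<bar>"
          using C[of h] by (simp add: divide_le_eq power2_eq_square mult.assoc flip: abs_mult)
      qed
      show "((\<lambda>h. C * \<bar>h\<bar>) \<longlongrightarrow> 0) (at 0)" by (auto intro!: tendsto_eq_intros)
    qed
    then show ?thesis using 3 by (simp add: DERIV_def flat_exp_def)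
  qed
qed

lemma flat_exp_1_facts: "0 \<le> flat_exp 1 s" "flat_exp 1 s \<le> 1" "s \<le> 0 \<Longrightarrow> flat_exp 1 s = 0"
  "1/2 \<le> s \<Longrightarrow> exp (-2) \<le> flat_exp 1 s"
  by (auto simp: flat_exp_def field_simps)

lemma cb_smooth_flat_compose:
  assumes "\<And>t x. u t differentiable (at x)" "\<And>i. cb_smooth (\<lambda>t. partial_deriv i (u t))"
  shows "cb_smooth (\<lambda>t x. flat_exp 1 (u t x))"
proof -
  define g where "g = (\<lambda>j. flat_exp (((\<lambda>p. monom 1 2 * (p - pderiv p)) ^^ j) 1))"
  have a: "(g j has_real_derivative g (Suc j) s) (at s)" for j s
    using flat_exp_has_derivative by (simp add: g_def)
  have b: "\<exists>C. \<forall>s. \<bar>g j s\<bar> \<le> C" for j using flat_exp_bounded by (simp add: g_def)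
  have "cb_smooth (\<lambda>t x. g 0 (u t x))" using a b assms by (rule cb_smooth_compose)
  then show ?thesis by (simp add: g_def)
qed

section \<open>Bump functions and normalised kernels\<close>

definition bump :: "real \<Rightarrow> real^'n \<Rightarrow> real" where
  "bump e x = (\<Prod>i\<in>UNIV. flat_exp 1 (1 + x $ i / e) * flat_exp 1 (1 - x $ i / e))"

lemma has_derivative_affine_component:
  "((\<lambda>x::real^'n. a + b * x $ i) has_derivative (\<lambda>h. b * h $ i)) (at x)"
  using has_derivative_add[OF has_derivative_const has_derivative_mult_right[OF bounded_linear_imp_has_derivative[OF bounded_linear_vec_nth]]]
  by simp

lemma cb_smooth_bump: "cb_smooth (\<lambda>_. bump e :: real^'n \<Rightarrow> real)"
proof -
  have *: "cb_smooth (\<lambda>t x. flat_exp 1 (a + b * x $ i))" for a b and i :: 'n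
  proof (rule cb_smooth_flat_compose)
    show "(\<lambda>x. a + b * x $ i) differentiable (at x)" for x
      using has_derivative_affine_component unfolding differentiable_def by blast
    have "partial_deriv j (\<lambda>x. a + b * x $ i) = (\<lambda>x. b * axis j 1 $ i)" for j
      by (intro ext has_derivative_partial_deriv has_derivative_affine_component)
    then show "cb_smooth (\<lambda>t. partial_deriv j (\<lambda>x. a + b * x $ i))" for j by simp
  qed
  show ?thesis unfolding bump_def[abs_def]
    using *[of 1 "1/e"] *[of 1 "-(1/e)"] by (intro cb_smooth_prod cb_smooth_mult) simp_all
qed

text \<open>The bump is a product of functions of single coordinates, supported in the cube of
  half-side \<open>e\<close>; comparing the norm with the sum of the coordinates gives the factor
  \<open>CARD('n)\<close>. On the concentric cube of half the size all \<open>2 * CARD('n)\<close>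
  factors have argument at least 1/2, hence are at least \<open>exp (-2)\<close>.\<close>

lemma bump_facts:
  fixes x :: "real^'n"
  assumes e: "0 < e"
  shows "0 \<le> bump e x" "bump e x \<le> 1" "norm x > real CARD('n) * e \<Longrightarrow> bump e x = 0"
    "(\<And>i. \<bar>x $ i\<bar> \<le> e/2) \<Longrightarrow> exp (-2) ^ (2 * CARD('n)) \<le> bump e x"
proof -
  show "0 \<le> bump e x" unfolding bump_def by (intro prod_nonneg ballI mult_nonneg_nonneg flat_exp_1_facts)
  show "bump e x \<le> 1" unfolding bump_def
    by (intro prod_le_1 ballI conjI mult_nonneg_nonneg mult_le_one flat_exp_1_facts)
  show "bump e x = 0" if n: "norm x > real CARD('n) * e"
  proof -
    have "\<exists>i. \<bar>x $ i\<bar> > e"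
    proof (rule ccontr)
      assume "\<nexists>i. \<bar>x $ i\<bar> > e"
      then have "(\<Sum>i\<in>UNIV. \<bar>x $ i\<bar>) \<le> (\<Sum>i\<in>(UNIV::'n set). e)" by (intro sum_mono) (simp add: not_less)
      then show False using norm_le_l1_cart[of x] n by simp
    qed
    then obtain i where "\<bar>x $ i\<bar> > e" by blast
    then have "1 + x $ i / e \<le> 0 \<or> 1 - x $ i / e \<le> 0" using e by (auto simp: field_simps abs_if split: if_splits)
    then have "flat_exp 1 (1 + x $ i / e) * flat_exp 1 (1 - x $ i / e) = 0" using flat_exp_1_facts(3) by auto
    then show ?thesis unfolding bump_def by (intro prod_zero) auto
  qed
  show "exp (-2) ^ (2 * CARD('n)) \<le> bump e x" if "\<And>i. \<bar>x $ i\<bar> \<le> e/2"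
  proof -
    have "exp (-2) \<le> flat_exp 1 (1 + x $ i / e)" "exp (-2) \<le> flat_exp 1 (1 - x $ i / e)" for i
      using that[of i] e by (auto intro!: flat_exp_1_facts(4) simp: field_simps abs_le_iff)
    then have "(\<Prod>i\<in>(UNIV::'n set). exp (-2) * exp (-2)) \<le> bump e x"
      unfolding bump_def by (intro prod_mono conjI mult_mono) (auto simp: flat_exp_1_facts)
    then show ?thesis by (simp add: power_mult power2_eq_square)
  qed
qed

lemma sum_Basis_nth [simp]: "(\<Sum>b\<in>Basis. (b :: real^'n) $ i) = 1"
proof -
  have "(\<Sum>b\<in>Basis. (b :: real^'n) $ i) = (\<Sum>b\<in>Basis. if b = (axis i 1 :: real^'n) then 1 else 0)"
    by (rule sum.cong) (auto simp: Basis_vec_def axis_def)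
  also have "\<dots> = 1" by (auto simp: Basis_vec_def)
  finally show ?thesis .
qed

text \<open>\<open>B\<close> is meant to be independent of the scale \<open>e\<close>: the bound
  \<open>B / e ^ CARD('n)\<close> is the only trace of scaling that is kept, and kernels at
  different scales need not be dilations of one another.\<close>

definition mollifier :: "real \<Rightarrow> real \<Rightarrow> (real^'n \<Rightarrow> real) \<Rightarrow> bool" where
  "mollifier B e K \<longleftrightarrow> cb_smooth (\<lambda>_::unit. K) \<and> (\<forall>x. 0 \<le> K x) \<and> (\<forall>x. e < norm x \<longrightarrow> K x = 0) \<and>
     (\<forall>x. K x \<le> B / e ^ CARD('n)) \<and> integrable lborel K \<and> (\<integral>x. K x \<partial>lborel) = 1"

text \<open>A bump of size \<open>d = e / N\<close> has supremum at most 1 and mass at least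
  \<open>c * d ^ N\<close>, contributed by the inner cube of side \<open>d\<close>. After
  normalisation the supremum is at most \<open>N ^ N / c / e ^ N\<close>, so no change of variables
  is involved.\<close>

lemma mollifier_exists: "\<exists>B>0. \<forall>e>0. \<exists>K::real^'n \<Rightarrow> real. mollifier B e K"
proof -
  let ?N = "CARD('n)"
  define c :: real where "c = exp (-2) ^ (2 * ?N)"
  have c0: "0 < c" by (simp add: c_def)
  have "\<exists>K::real^'n \<Rightarrow> real. mollifier (real ?N ^ ?N / c) e K" if e: "0 < e" for e :: real
  proof -
    define d where "d = e / real ?N"
    have d: "0 < d" using e by (simp add: d_def)
    let ?b = "bump d :: real^'n \<Rightarrow> real"
    have sm: "cb_smooth (\<lambda>_::unit. ?b)" by (rule cb_smooth_bump)
    note [measurable] = cb_smooth_facts(2)[OF sm]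
    have int: "integrable lborel ?b"
    proof (rule Bochner_Integration.integrable_bound)
      show "integrable lborel (indicat_real (cball (0::real^'n) e))"
        by (intro integrable_real_indicator emeasure_bounded_finite bounded_cball) simp
      show "AE x in lborel. norm (?b x) \<le> norm (indicat_real (cball 0 e) x)"
      proof (intro AE_I2)
        fix x :: "real^'n"
        show "norm (?b x) \<le> norm (indicat_real (cball 0 e) x)"
          using bump_facts(1,2)[OF d, of x] bump_facts(3)[OF d, of x] e by (auto simp: indicator_def d_def)
      qed
    qed simp
    let ?Q = "cbox (- ((d/2) *\<^sub>R One)) ((d/2) *\<^sub>R One) :: (real^'n) set"
    have mQ: "measure lborel ?Q = d ^ ?N"
    proof -
      have "0 \<in> ?Q" using d by (simp add: mem_box_cart)
      then show ?thesis by (subst content_cbox_cart) auto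
    qed
    have "c * d ^ ?N = (\<integral>x. c * indicat_real ?Q x \<partial>lborel)" by (simp add: mQ)
    also have "\<dots> \<le> (\<integral>x. ?b x \<partial>lborel)"
    proof (rule integral_mono)
      show "integrable lborel (\<lambda>x. c * indicat_real ?Q x)"
        by (intro integrable_mult_right integrable_real_indicator emeasure_bounded_finite bounded_cbox) simp
      fix x :: "real^'n"
      show "c * indicat_real ?Q x \<le> ?b x"
      proof (cases "x \<in> ?Q")
        case True
        then have "- (d/2) \<le> x $ i \<and> x $ i \<le> d/2" for i by (simp add: mem_box_cart)
        then have "\<bar>x $ i\<bar> \<le> d/2" for i by (metis abs_le_iff minus_le_iff)
        from bump_facts(4)[OF d this] True show ?thesis by (simp add: c_def)
      qed (simp add: bump_facts(1)[OF d])
    qed (rule int)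
    finally have lower: "c * d ^ ?N \<le> (\<integral>x. ?b x \<partial>lborel)" .
    define I where "I = (\<integral>x. ?b x \<partial>lborel)"
    have cd: "0 < c * d ^ ?N" using c0 d by simp
    have I0: "0 < I" using lower cd by (simp add: I_def)
    have bd: "1 / I \<le> real ?N ^ ?N / c / e ^ ?N"
    proof -
      have "1 / I \<le> 1 / (c * d ^ ?N)" using lower cd I0 by (intro divide_left_mono) (auto simp: I_def)
      then show ?thesis by (simp add: d_def power_divide mult.commute)
    qed
    show ?thesis
    proof (intro exI[of _ "\<lambda>x. ?b x * (1 / I)"], unfold mollifier_def, intro conjI allI impI)
      show "cb_smooth (\<lambda>_::unit. \<lambda>x. ?b x * (1 / I))" by (intro cb_smooth_mult sm cb_smooth_const)
      fix x :: "real^'n"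
      show "0 \<le> ?b x * (1 / I)" using bump_facts(1)[OF d, of x] I0 by simp
      show "?b x * (1 / I) \<le> real ?N ^ ?N / c / e ^ ?N"
        using mult_right_mono[OF bump_facts(2)[OF d, of x], of "1/I"] bd I0 by simp
      show "?b x * (1 / I) = 0" if "e < norm x" using bump_facts(3)[OF d, of x] that by (simp add: d_def)
    next
      show "integrable lborel (\<lambda>x. ?b x * (1 / I))" using int by simp
      show "(\<integral>x. ?b x * (1 / I) \<partial>lborel) = 1" using I0 by (simp flip: I_def)
    qed
  qed
  moreover have "0 < real ?N ^ ?N / c" using c0 by simp
  ultimately show ?thesis by blast
qed

subsection \<open>Continuity of translations in the mean\<close>

text \<open>\<open>A\<close> is enclosed between a compact \<open>C'\<close> and an open
  \<open>U\<close> with small gaps. If the translation is so short that it keeps \<open>C'\<close>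
  inside \<open>U\<close>, the indicator can differ at x and h + x only if one of these two points
  lies in \<open>A - C'\<close> or in \<open>U - A\<close>.\<close>

lemma L1_translation_indicator:
  fixes A :: "'a::euclidean_space set" and c :: "'b::{banach,second_countable_topology}"
  assumes A[measurable]: "A \<in> sets borel" and fin: "emeasure lborel A < \<infinity>" and e: "0 < (e::real)"
  shows "\<exists>d>0. \<forall>h. norm h < d \<longrightarrow>
    (\<integral>\<^sup>+x. norm (indicat_real A (h + x) *\<^sub>R c - indicat_real A x *\<^sub>R c) \<partial>lborel) \<le> ennreal e"
proof -
  \<comment> \<open>Two points and two gaps give four errors of at most \<open>e'\<close> each,
    weighted by \<open>norm c\<close>; adding 1 avoids a division by 0.\<close>
  define e' where "e' = e / (4 * (norm c + 1))"
  have nc: "0 < norm c + 1" by (simp add: add_nonneg_pos)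
  have e': "0 < e'" using e nc by (simp add: e'_def)
  have AL: "A \<in> sets lebesgue" by simp
  obtain U where U: "open U" "A \<subseteq> U" "U - A \<in> lmeasurable" "emeasure lebesgue (U - A) < ennreal e'"
    using sets_lebesgue_outer_open[OF AL e'] .
  obtain C where C: "closed C" "C \<subseteq> A" "A - C \<in> lmeasurable" "emeasure lebesgue (A - C) < ennreal e'"
    using sets_lebesgue_inner_closed[OF AL e'] .
  have [measurable]: "U \<in> sets borel" "C \<in> sets borel" using U C by auto
  \<comment> \<open>Cutting the inner closed set with large balls makes it compact; finiteness of
    the measure of \<open>A\<close> allows continuity from above.\<close>
  define D where "D n = A - (C \<inter> cball 0 (real n))" for n
  have "(\<lambda>n. emeasure lborel (D n)) \<longlonglongrightarrow> emeasure lborel (\<Inter>n. D n)"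
  proof (rule Lim_emeasure_decseq)
    show "range D \<subseteq> sets lborel" by (auto simp: D_def)
    show "decseq D" by (auto simp: D_def decseq_def)
    show "emeasure lborel (D n) \<noteq> \<infinity>" for n
      using emeasure_mono[of "D n" A lborel] fin by (auto simp: D_def top_unique)
  qed
  moreover have "(\<Inter>n. D n) = A - C"
    by (auto simp: D_def) (meson real_arch_simple)
  ultimately have "(\<lambda>n. emeasure lborel (D n)) \<longlonglongrightarrow> emeasure lborel (A - C)" by simp
  moreover have "emeasure lborel (A - C) < ennreal e'" using C(4) by simp
  ultimately have "eventually (\<lambda>n. emeasure lborel (D n) < ennreal e') sequentially"
    by (rule order_tendstoD(2))
  then obtain n where n: "emeasure lborel (D n) < ennreal e'" by (auto simp: eventually_sequentially)
  define C' where "C' = C \<inter> cball 0 (real n)"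
  have C': "compact C'" "C' \<subseteq> A" using C by (auto simp: C'_def closed_Int_compact)
  have [measurable]: "C' \<in> sets borel" using C' by (simp add: borel_compact)
  have m1: "emeasure lborel (A - C') \<le> ennreal e'" using n by (simp add: D_def C'_def)
  have m2: "emeasure lborel (U - A) \<le> ennreal e'" using U(4) by simp
  obtain d where d: "d > 0" "(\<Union>x\<in>C'. ball x d) \<subseteq> U"
    using compact_subset_open_imp_ball_epsilon_subset[OF C'(1) U(1)] C'(2) U(2) by blast
  have "(\<integral>\<^sup>+x. norm (indicat_real A (h + x) *\<^sub>R c - indicat_real A x *\<^sub>R c) \<partial>lborel) \<le> ennreal e" if h: "norm h < d" for h
  proof -
    let ?i = "\<lambda>x. indicator (A - C') x + indicator (U - A) x :: ennreal"
    have pt: "ennreal (norm (indicat_real A (h + x) *\<^sub>R c - indicat_real A x *\<^sub>R c)) \<le> ennreal (norm c) * (?i (h + x) + ?i x)" for x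
    proof (cases "(h + x \<in> A) = (x \<in> A)")
      case True then show ?thesis by (auto simp: indicator_def)
    next
      case False
      have "1 \<le> ?i (h + x) + ?i x"
      proof (cases "x \<in> A")
        case True
        show ?thesis
        proof (cases "x \<in> C'")
          case T: True
          then have "h + x \<in> U" using d(2) h by (force simp: dist_norm)
          then show ?thesis using False True by (auto simp: indicator_def)
        qed (use True in \<open>auto simp: indicator_def\<close>)
      next
        case F: False
        show ?thesis
        proof (cases "h + x \<in> C'")
          case T: True
          then have "x \<in> U" using d(2) h by (force simp: dist_norm)
          then show ?thesis using False F by (auto simp: indicator_def)
        qed (use False F in \<open>auto simp: indicator_def\<close>)
      qed
      moreover have "norm (indicat_real A (h + x) *\<^sub>R c - indicat_real A x *\<^sub>R c) = norm c"
        using False by (auto simp: indicator_def)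
      ultimately show ?thesis using mult_left_mono[of 1 "?i (h + x) + ?i x" "ennreal (norm c)"] by simp
    qed
    have I: "(\<integral>\<^sup>+x. ?i x \<partial>lborel) \<le> ennreal e' + ennreal e'"
      using m1 m2 by (subst nn_integral_add) (auto intro!: add_mono)
    have I': "(\<integral>\<^sup>+x. ?i (h + x) \<partial>lborel) \<le> ennreal e' + ennreal e'"
      using I nn_integral_lborel_add[of ?i h] by simp
    have "(\<integral>\<^sup>+x. norm (indicat_real A (h + x) *\<^sub>R c - indicat_real A x *\<^sub>R c) \<partial>lborel)
      \<le> (\<integral>\<^sup>+x. ennreal (norm c) * (?i (h + x) + ?i x) \<partial>lborel)"
      by (rule nn_integral_mono) (rule pt)
    also have "\<dots> = ennreal (norm c) * ((\<integral>\<^sup>+x. ?i (h + x) \<partial>lborel) + (\<integral>\<^sup>+x. ?i x \<partial>lborel))"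
      by (subst nn_integral_cmult, measurable) (subst nn_integral_add, measurable)
    also have "\<dots> \<le> ennreal (norm c) * ((ennreal e' + ennreal e') + (ennreal e' + ennreal e'))"
      by (intro mult_left_mono add_mono I I') simp
    also have "\<dots> = ennreal (norm c * (4 * e'))"
    proof -
      have "(ennreal e' + ennreal e') + (ennreal e' + ennreal e') = ennreal (4 * e')"
        using e' by (simp flip: ennreal_plus)
      then show ?thesis using e' ennreal_mult[of "norm c" "4 * e'"] by simp
    qed
    also have "\<dots> \<le> ennreal e"
    proof (rule ennreal_leI)
      have "norm c * (4 * e') = e * (norm c / (norm c + 1))" using nc by (simp add: e'_def divide_simps)
      also have "\<dots> \<le> e * 1" using e nc by (intro mult_left_mono) (auto simp: divide_le_eq)
      finally show "norm c * (4 * e') \<le> e" by simp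
    qed
    finally show ?thesis .
  qed
  then show ?thesis using d(1) by blast
qed

lemma nn_integral_norm_triangle3:
  fixes f g h :: "'a \<Rightarrow> 'b::{banach,second_countable_topology}"
  assumes [measurable]: "f \<in> borel_measurable M" "g \<in> borel_measurable M" "h \<in> borel_measurable M"
  assumes le: "\<And>x. norm (k x) \<le> norm (f x) + norm (g x) + norm (h x)"
  shows "(\<integral>\<^sup>+x. norm (k x) \<partial>M) \<le> (\<integral>\<^sup>+x. norm (f x) \<partial>M) + (\<integral>\<^sup>+x. norm (g x) \<partial>M) + (\<integral>\<^sup>+x. norm (h x) \<partial>M)"
proof -
  have "(\<integral>\<^sup>+x. norm (k x) \<partial>M) \<le> (\<integral>\<^sup>+x. ennreal (norm (f x)) + ennreal (norm (g x)) + ennreal (norm (h x)) \<partial>M)"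
    by (rule nn_integral_mono) (simp add: le flip: ennreal_plus)
  also have "\<dots> = (\<integral>\<^sup>+x. norm (f x) \<partial>M) + (\<integral>\<^sup>+x. norm (g x) \<partial>M) + (\<integral>\<^sup>+x. norm (h x) \<partial>M)"
    by (subst nn_integral_add, measurable, subst nn_integral_add, measurable)
  finally show ?thesis .
qed

text \<open>Induction over integrable functions starting from indicators. In the limit case the
  approximation errors of \<open>f\<close> and of its translate are equal by invariance of the
  measure, hence the three thirds.\<close>

lemma L1_translation_continuous:
  fixes f :: "'a::euclidean_space \<Rightarrow> 'b::{banach,second_countable_topology}"
  assumes "integrable lborel f" and e: "0 < (e::real)"
  shows "\<exists>d>0. \<forall>h. norm h < d \<longrightarrow> (\<integral>\<^sup>+x. norm (f (h + x) - f x) \<partial>lborel) \<le> ennreal e"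
  using assms
proof (induction f arbitrary: e rule: integrable_induct)
  case (base A c)
  then show ?case using L1_translation_indicator[of A e c] by simp
next
  case (add f g)
  have [measurable]: "f \<in> borel_measurable borel" "g \<in> borel_measurable borel" using add by auto
  have e2: "0 < e/2" using add by simp
  obtain d1 where d1: "d1 > 0" "\<And>h. norm h < d1 \<Longrightarrow> (\<integral>\<^sup>+x. norm (f (h + x) - f x) \<partial>lborel) \<le> ennreal (e/2)"
    using add.IH(1)[OF e2] by blast
  obtain d2 where d2: "d2 > 0" "\<And>h. norm h < d2 \<Longrightarrow> (\<integral>\<^sup>+x. norm (g (h + x) - g x) \<partial>lborel) \<le> ennreal (e/2)"
    using add.IH(2)[OF e2] by blast
  have "(\<integral>\<^sup>+x. norm (f (h + x) + g (h + x) - (f x + g x)) \<partial>lborel) \<le> ennreal e" if "norm h < min d1 d2" for h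
  proof -
    have "(\<integral>\<^sup>+x. norm (f (h + x) + g (h + x) - (f x + g x)) \<partial>lborel)
      \<le> (\<integral>\<^sup>+x. norm (f (h + x) - f x) \<partial>lborel) + (\<integral>\<^sup>+x. norm (g (h + x) - g x) \<partial>lborel) + (\<integral>\<^sup>+x. norm (0::'b) \<partial>(lborel::'a measure))"
      by (rule nn_integral_norm_triangle3) (measurable, simp add: add_diff_add norm_triangle_ineq)
    also have "\<dots> \<le> ennreal (e/2) + ennreal (e/2)" using d1(2)[of h] d2(2)[of h] that by (simp add: add_mono)
    also have "\<dots> = ennreal e" using e2 by (simp flip: ennreal_plus)
    finally show ?thesis .
  qed
  then show ?case using d1(1) d2(1) by (intro exI[of _ "min d1 d2"]) auto
next
  case (lim f s)
  have [measurable]: "f \<in> borel_measurable borel" "\<And>i. s i \<in> borel_measurable borel" using lim by auto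
  have e3: "0 < e/3" using lim by simp
  have "(\<lambda>i. \<integral>\<^sup>+x. norm (s i x - f x) \<partial>lborel) \<longlonglongrightarrow> (\<integral>\<^sup>+x. 0 \<partial>(lborel::'a measure))"
  proof (rule nn_integral_dominated_convergence[where w="\<lambda>x. ennreal (3 * norm (f x))"])
    show "AE x in lborel. ennreal (norm (s i x - f x)) \<le> ennreal (3 * norm (f x))" for i
      using lim.hyps(3)[of _ i] by (intro AE_I2 ennreal_leI) (smt (verit) norm_triangle_ineq4 space_lborel UNIV_I)
    show "(\<integral>\<^sup>+x. ennreal (3 * norm (f x)) \<partial>lborel) < \<infinity>"
      using lim.hyps(4) by (simp add: ennreal_mult nn_integral_cmult integrable_iff_bounded ennreal_mult_less_top)
    show "AE x in lborel. (\<lambda>i. ennreal (norm (s i x - f x))) \<longlonglongrightarrow> 0"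
    proof (intro AE_I2)
      fix x
      have "(\<lambda>i. norm (s i x - f x)) \<longlonglongrightarrow> 0" using lim.hyps(2)[of x] by (simp add: tendsto_norm_zero LIM_zero)
      from tendsto_ennrealI[OF this] show "(\<lambda>i. ennreal (norm (s i x - f x))) \<longlonglongrightarrow> 0" by simp
    qed
  qed measurable
  then have "eventually (\<lambda>i. (\<integral>\<^sup>+x. norm (s i x - f x) \<partial>lborel) < ennreal (e/3)) sequentially"
    using e3 by (intro order_tendstoD(2)[of _ 0]) auto
  then obtain i where i: "(\<integral>\<^sup>+x. norm (s i x - f x) \<partial>lborel) < ennreal (e/3)" by (auto simp: eventually_sequentially)
  obtain d where d: "d > 0" "\<And>h. norm h < d \<Longrightarrow> (\<integral>\<^sup>+x. norm (s i (h + x) - s i x) \<partial>lborel) \<le> ennreal (e/3)"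
    using lim.IH[OF e3] by blast
  have "(\<integral>\<^sup>+x. norm (f (h + x) - f x) \<partial>lborel) \<le> ennreal e" if h: "norm h < d" for h
  proof -
    have eq: "f (h + x) - f x = (s i (h + x) - s i x) + (s i x - f x) - (s i (h + x) - f (h + x))" for x by simp
    have tri: "norm (f (h + x) - f x) \<le> norm (s i (h + x) - s i x) + norm (s i x - f x) + norm (s i (h + x) - f (h + x))" for x
      unfolding eq[of x] by (rule order_trans[OF norm_triangle_ineq4 add_right_mono[OF norm_triangle_ineq]])
    have "(\<integral>\<^sup>+x. norm (f (h + x) - f x) \<partial>lborel)
      \<le> (\<integral>\<^sup>+x. norm (s i (h + x) - s i x) \<partial>lborel) + (\<integral>\<^sup>+x. norm (s i x - f x) \<partial>lborel) + (\<integral>\<^sup>+x. norm (s i (h + x) - f (h + x)) \<partial>lborel)"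
      using tri by (intro nn_integral_norm_triangle3) measurable
    also have "(\<integral>\<^sup>+x. norm (s i (h + x) - f (h + x)) \<partial>lborel) = (\<integral>\<^sup>+x. norm (s i x - f x) \<partial>lborel)"
      by (rule nn_integral_lborel_add[of "\<lambda>x. ennreal (norm (s i x - f x))"]) measurable
    also have "(\<integral>\<^sup>+x. norm (s i (h + x) - s i x) \<partial>lborel) + (\<integral>\<^sup>+x. norm (s i x - f x) \<partial>lborel) + (\<integral>\<^sup>+x. norm (s i x - f x) \<partial>lborel)
       \<le> ennreal (e/3) + ennreal (e/3) + ennreal (e/3)"
      using d(2)[OF h] i by (intro add_mono) auto
    also have "\<dots> = ennreal e" using e3 by (simp flip: ennreal_plus)
    finally show ?thesis .
  qed
  then show ?case using d(1) by blast
qed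

subsection \<open>Jensen's inequality and mollification in the space variable\<close>

lemma mollifierD:
  fixes K :: "real^'n \<Rightarrow> real"
  assumes "mollifier B e K"
  shows "cb_smooth (\<lambda>_::unit. K)" "\<And>x. 0 \<le> K x" "\<And>x. e < norm x \<Longrightarrow> K x = 0" "\<And>x. K x \<le> B / e ^ CARD('n)"
    "integrable lborel K" "(\<integral>x. K x \<partial>lborel) = 1" "K \<in> borel_measurable borel" "\<And>x. \<bar>K x\<bar> \<le> B / e ^ CARD('n)"
    "(\<integral>\<^sup>+x. ennreal (K x) \<partial>lborel) = 1"
proof -
  show 1: "cb_smooth (\<lambda>_::unit. K)" "\<And>x. 0 \<le> K x" "\<And>x. e < norm x \<Longrightarrow> K x = 0" "\<And>x. K x \<le> B / e ^ CARD('n)"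
    "integrable lborel K" "(\<integral>x. K x \<partial>lborel) = 1" using assms by (auto simp: mollifier_def)
  show "K \<in> borel_measurable borel" "\<And>x. \<bar>K x\<bar> \<le> B / e ^ CARD('n)" using 1 by auto
  show "(\<integral>\<^sup>+x. ennreal (K x) \<partial>lborel) = 1"
    using nn_integral_eq_integral[OF 1(5)] 1 by simp
qed

lemma integrable_mollifier_mult:
  fixes f :: "real^'n \<Rightarrow> 'b::{banach,second_countable_topology}"
  assumes "mollifier B e K" "integrable lborel f"
  shows "integrable lborel (\<lambda>y. K (x - y) *\<^sub>R f y)"
  using integrable_bounded_mult[OF mollifierD(7,8)[OF assms(1)] assms(2)] .

lemma integrable_mollifier_shift:
  fixes K :: "real^'n \<Rightarrow> real"
  assumes "mollifier B e K"
  shows "integrable lborel (\<lambda>y. K (x - y))" "(\<integral>y. K (x - y) \<partial>lborel) = 1"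
  using integrable_lborel_diff[OF mollifierD(5)[OF assms]] integral_lborel_diff[OF mollifierD(7)[OF assms]]
    mollifierD(6)[OF assms] by auto

text \<open>Separate the point \<open>(x0, h x0)\<close> from the strict epigraph. A vertical
  hyperplane is impossible because \<open>h\<close> is finite on the whole space, so the last
  component of the normal is positive and can be divided out.\<close>

lemma convex_on_subgradient:
  fixes h :: "'a::euclidean_space \<Rightarrow> real"
  assumes h: "convex_on UNIV h"
  shows "\<exists>v. \<forall>y. h x0 + v \<bullet> (y - x0) \<le> h y"
proof -
  let ?T = "{z. h (fst z) < snd z}"
  have cT: "convex ?T"
  proof (rule convexI)
    fix z w :: "'a \<times> real" and u v :: real
    assume zw: "z \<in> ?T" "w \<in> ?T" and uv: "0 \<le> u" "0 \<le> v" "u + v = 1"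
    have "h (u *\<^sub>R fst z + v *\<^sub>R fst w) \<le> u * h (fst z) + v * h (fst w)"
      using h uv unfolding convex_on_def by auto
    also have "\<dots> < u * snd z + v * snd w"
    proof (cases "u = 0")
      case True then show ?thesis using zw uv by simp
    next
      case False
      then show ?thesis using zw uv by (intro add_less_le_mono mult_strict_left_mono mult_left_mono) auto
    qed
    finally show "u *\<^sub>R z + v *\<^sub>R w \<in> ?T" by simp
  qed
  have ne: "?T \<noteq> {}" using gt_ex[of "h x0"] by auto
  have "\<exists>a b. a \<noteq> 0 \<and> (\<forall>z\<in>{(x0, h x0)}. a \<bullet> z \<le> b) \<and> (\<forall>z\<in>?T. b \<le> a \<bullet> z)"
    by (rule separating_hyperplane_sets) (use cT ne in auto)
  then obtain a b where ab: "a \<noteq> 0" "a \<bullet> (x0, h x0) \<le> b" "\<And>z. z \<in> ?T \<Longrightarrow> b \<le> a \<bullet> z"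
    by blast
  obtain p q where a: "a = (p, q)" by (cases a)
  have gt: "p \<bullet> x0 + q * h x0 \<le> p \<bullet> x + q * y" if "h x < y" for x y
    using ab(2) ab(3)[of "(x, y)"] that by (simp add: a)
  have ge: "p \<bullet> x0 + q * h x0 \<le> p \<bullet> x + q * h x" for x
  proof (rule tendsto_lowerbound)
    show "((\<lambda>y. p \<bullet> x + q * y) \<longlongrightarrow> p \<bullet> x + q * h x) (at_right (h x))" by (intro tendsto_intros)
    show "\<forall>\<^sub>F y in at_right (h x). p \<bullet> x0 + q * h x0 \<le> p \<bullet> x + q * y"
      using eventually_at_right_less[of "h x"] by eventually_elim (rule gt)
  qed simp
  have "0 \<le> q" using gt[of x0 "h x0 + 1"] by (simp add: algebra_simps)
  moreover have "q \<noteq> 0"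
  proof
    assume "q = 0"
    then have "p \<bullet> p \<le> 0" using ge[of "x0 - p"] by (simp add: inner_diff_right)
    then have "p = 0" by (metis inner_gt_zero_iff linorder_not_less)
    then show False using ab(1) a \<open>q = 0\<close> by (simp add: zero_prod_def)
  qed
  ultimately have q: "0 < q" by simp
  have "h x0 + (- (1/q) *\<^sub>R p) \<bullet> (y - x0) \<le> h y" for y
  proof -
    have "q * (h x0 - (p \<bullet> (y - x0)) / q) = q * h x0 - (p \<bullet> y - p \<bullet> x0)"
      using q by (simp add: field_simps inner_diff_right)
    then have "q * (h x0 - (p \<bullet> (y - x0)) / q) \<le> q * h y" using ge[of y] by linarith
    then show ?thesis using q by (simp add: inner_scaleR_left)
  qed
  then show ?thesis by blast
qed

text \<open>The kernel is a probability density, and integrating the affine support of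
  \<open>h\<close> at the point \<open>conv K F x\<close> gives the claim. A majorant
  \<open>m\<close> of the composition, required only within the radius of the kernel, avoids any
  integrability question for \<open>h\<close> composed with \<open>F\<close>.\<close>

lemma jensen_conv:
  fixes F :: "real^'n \<Rightarrow> 'b::euclidean_space"
  assumes K: "mollifier B e K" and h: "convex_on UNIV h" and F: "integrable lborel F" and m: "integrable lborel m"
    and le: "AE y in lborel. norm (x - y) \<le> e \<longrightarrow> h (F y) \<le> m y"
  shows "h (conv K F x) \<le> conv K m x"
proof -
  let ?\<xi> = "conv K F x"
  obtain v where v: "\<And>w. h ?\<xi> + v \<bullet> (w - ?\<xi>) \<le> h w" using convex_on_subgradient[OF h] by blast
  have i: "integrable lborel (\<lambda>y. v \<bullet> (K (x - y) *\<^sub>R F y))" "integrable lborel (\<lambda>y. K (x - y) * (h ?\<xi> - v \<bullet> ?\<xi>))"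
    by (rule integrable_inner_right[OF integrable_mollifier_mult[OF K F]])
       (rule integrable_mult_left[OF integrable_mollifier_shift(1)[OF K]])
  have "(\<integral>y. v \<bullet> (K (x - y) *\<^sub>R F y) + K (x - y) * (h ?\<xi> - v \<bullet> ?\<xi>) \<partial>lborel) = v \<bullet> ?\<xi> + (h ?\<xi> - v \<bullet> ?\<xi>)"
    using i integrable_mollifier_mult[OF K F, of x] integrable_mollifier_shift[OF K, of x]
    by (simp add: conv_def del: inner_scaleR_right)
  moreover have "(\<integral>y. v \<bullet> (K (x - y) *\<^sub>R F y) + K (x - y) * (h ?\<xi> - v \<bullet> ?\<xi>) \<partial>lborel) \<le> (\<integral>y. K (x - y) *\<^sub>R m y \<partial>lborel)"
  proof (rule integral_mono_AE)
    show "AE y in lborel. v \<bullet> (K (x - y) *\<^sub>R F y) + K (x - y) * (h ?\<xi> - v \<bullet> ?\<xi>) \<le> K (x - y) *\<^sub>R m y"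
      using le
    proof eventually_elim
      case (elim y)
      show ?case
      proof (cases "norm (x - y) \<le> e")
        case True
        have "K (x - y) * (h ?\<xi> + v \<bullet> (F y - ?\<xi>)) \<le> K (x - y) * m y"
          using elim True v[of "F y"] mollifierD(2)[OF K] by (intro mult_left_mono) auto
        then show ?thesis by (simp add: algebra_simps inner_diff_right)
      next
        case False
        then show ?thesis using mollifierD(3)[OF K, of "x - y"] by simp
      qed
    qed
  qed (use i integrable_mollifier_mult[OF K m, of x] in auto)
  ultimately show ?thesis by (simp add: conv_def)
qed

lemma conv_mono_bound:
  fixes K :: "real^'n \<Rightarrow> real"
  assumes K: "mollifier B e K" and m: "integrable lborel m" "\<And>y. 0 \<le> m y"
  shows "0 \<le> conv K m x" "conv K m x \<le> B / e ^ CARD('n) * (\<integral>y. m y \<partial>lborel)"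
proof -
  show "0 \<le> conv K m x" unfolding conv_def
    by (intro integral_nonneg_AE AE_I2) (simp add: mollifierD(2)[OF K] m)
  show "conv K m x \<le> B / e ^ CARD('n) * (\<integral>y. m y \<partial>lborel)"
    using norm_conv_le[OF mollifierD(7,8)[OF K] m(1), of x] m(2) by simp
qed

section \<open>Convexity of powers of the norm\<close>

lemma powr_convex_combination:
  fixes a b u v q :: real
  assumes "0 \<le> a" "0 \<le> b" "0 \<le> u" "0 \<le> v" "u + v = 1" "1 \<le> q"
  shows "(u * a + v * b) powr q \<le> u * a powr q + v * b powr q"
proof -
  \<comment> \<open>The endpoint 0 is separate: there the inequality reduces to
    \<open>v powr q \<le> v\<close> on the unit interval.\<close>
  have s: "(v * b) powr q \<le> v * b powr q" if "0 \<le> v" "v \<le> 1" "0 \<le> b" for v b :: real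
  proof -
    have "v powr q \<le> v"
    proof (cases "v = 0")
      case False
      then have "v powr q \<le> v powr 1" using that assms by (intro powr_mono') auto
      then show ?thesis using that by simp
    qed simp
    then show ?thesis using that by (simp add: powr_mult mult_right_mono)
  qed
  show ?thesis
  proof (cases "a = 0 \<or> b = 0")
    case True
    then show ?thesis using s[of v b] s[of u a] assms by auto
  next
    case False
    then show ?thesis using powr_convex[OF \<open>1 \<le> q\<close>] assms unfolding convex_on_def by auto
  qed
qed

lemma convex_on_norm_powr:
  assumes "1 \<le> q" shows "convex_on UNIV (\<lambda>x::'b::euclidean_space. norm x powr q)"
  unfolding convex_on_def
proof (intro conjI allI impI ballI)
  fix x y :: 'b and u v :: real assume uv: "0 \<le> u" "0 \<le> v" "u + v = 1"
  have "norm (u *\<^sub>R x + v *\<^sub>R y) \<le> u * norm x + v * norm y"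
    using norm_triangle_ineq[of "u *\<^sub>R x" "v *\<^sub>R y"] uv by simp
  then have "norm (u *\<^sub>R x + v *\<^sub>R y) powr q \<le> (u * norm x + v * norm y) powr q"
    using assms by (intro powr_mono2) auto
  also have "\<dots> \<le> u * norm x powr q + v * norm y powr q"
    using uv assms by (intro powr_convex_combination) auto
  finally show "norm (u *\<^sub>R x + v *\<^sub>R y) powr q \<le> u * norm x powr q + v * norm y powr q" .
qed simp

text \<open>Time is a mere parameter. The value at x is an average of \<open>f\<close> over a ball
  around the shifted point \<open>x + v\<close>; with \<open>v\<close> directed out of the domain,
  this ball lies where \<open>f\<close> vanishes once x is close to the boundary.\<close>

definition shift_mollify :: "(real^'n \<Rightarrow> real) \<Rightarrow> real^'n \<Rightarrow> (real \<times> (real^'n) \<Rightarrow> 'b::{banach,second_countable_topology}) \<Rightarrow> real \<times> (real^'n) \<Rightarrow> 'b" where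
  "shift_mollify K v f z = conv K (\<lambda>y. f (fst z, y)) (snd z + v)"

lemma borel_measurable_fst_snd [measurable]:
  "(fst :: 'a::second_countable_topology \<times> 'b::second_countable_topology \<Rightarrow> 'a) \<in> borel \<rightarrow>\<^sub>M borel"
  "(snd :: 'a \<times> 'b \<Rightarrow> 'b) \<in> borel \<rightarrow>\<^sub>M borel"
  unfolding borel_prod[symmetric] by (rule measurable_fst, rule measurable_snd)

lemma measurable_shift_mollify [measurable]:
  fixes f :: "real \<times> (real^'n) \<Rightarrow> 'b::{banach,second_countable_topology}"
  assumes [measurable]: "K \<in> borel_measurable borel" "f \<in> borel_measurable borel"
  shows "shift_mollify K v f \<in> borel_measurable borel"
  unfolding shift_mollify_def[abs_def] conv_def
  by (rule lborel.borel_measurable_lebesgue_integral) measurable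

text \<open>The mollified function is an average of translates of \<open>f\<close> with total weight
  1, so after Fubini the error is an average of translation errors. The kernel enters only through
  its radius, added to the length of the shift.\<close>

lemma shift_mollify_L1:
  fixes f :: "real \<times> (real^'n) \<Rightarrow> 'b::{banach,second_countable_topology}"
  assumes f: "integrable lborel f" and ft: "\<And>t. integrable lborel (\<lambda>y. f (t, y))" and e: "0 < (e::real)"
  shows "\<exists>d>0. \<forall>K v B r. mollifier B r K \<longrightarrow> r + norm v < d \<longrightarrow>
     (\<integral>\<^sup>+z. norm (shift_mollify K v f z - f z) \<partial>lborel) \<le> ennreal e"
proof -
  have [measurable]: "f \<in> borel_measurable borel" using f by auto
  obtain d where d: "d > 0" "\<And>h. norm h < d \<Longrightarrow> (\<integral>\<^sup>+z. norm (f (h + z) - f z) \<partial>lborel) \<le> ennreal e"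
    using L1_translation_continuous[OF f e] by blast
  have "(\<integral>\<^sup>+z. norm (shift_mollify K v f z - f z) \<partial>lborel) \<le> ennreal e"
    if K: "mollifier B r K" and rv: "r + norm v < d" for K :: "real^'n \<Rightarrow> real" and v B r
  proof -
    note [measurable] = mollifierD(7)[OF K]
    have pt: "ennreal (norm (shift_mollify K v f z - f z)) \<le> (\<integral>\<^sup>+y. ennreal (K y) * ennreal (norm (f ((0, v - y) + z) - f z)) \<partial>lborel)" for z
    proof -
      obtain t x where z: "z = (t, x)" by (cases z)
      have ii: "integrable lborel (\<lambda>y. K y *\<^sub>R f (t, x + v - y))"
        using integrable_lborel_diff[OF integrable_mollifier_mult[OF K ft[of t], of "x + v"], of "x + v"] by simp
      have "shift_mollify K v f z = (\<integral>y. K y *\<^sub>R f (t, x + v - y) \<partial>lborel)"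
        by (simp add: shift_mollify_def z conv_flip)
      moreover have "f z = (\<integral>y. K y *\<^sub>R f z \<partial>lborel)"
        using mollifierD(5,6)[OF K] by simp
      ultimately have "shift_mollify K v f z - f z = (\<integral>y. K y *\<^sub>R f (t, x + v - y) - K y *\<^sub>R f z \<partial>lborel)"
        by (subst Bochner_Integration.integral_diff[OF ii integrable_scaleR_left[OF mollifierD(5)[OF K]]]) simp
      also have "\<dots> = (\<integral>y. K y *\<^sub>R (f ((0, v - y) + z) - f z) \<partial>lborel)"
        by (simp add: z scaleR_diff_right algebra_simps)
      finally have eq: "shift_mollify K v f z - f z = (\<integral>y. K y *\<^sub>R (f ((0, v - y) + z) - f z) \<partial>lborel)" .
      have "ennreal (norm (\<integral>y. K y *\<^sub>R (f ((0, v - y) + z) - f z) \<partial>lborel)) \<le> (\<integral>\<^sup>+y. ennreal (norm (K y *\<^sub>R (f ((0, v - y) + z) - f z))) \<partial>lborel)"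
      proof (rule integral_norm_bound_ennreal)
        show "integrable lborel (\<lambda>y. K y *\<^sub>R (f ((0, v - y) + z) - f z))"
          using Bochner_Integration.integrable_diff[OF ii integrable_scaleR_left[OF mollifierD(5)[OF K], of "f z"]]
          by (simp add: z scaleR_diff_right algebra_simps)
      qed
      then show ?thesis unfolding eq by (simp add: mollifierD(2)[OF K] ennreal_mult)
    qed
    have "(\<integral>\<^sup>+z. norm (shift_mollify K v f z - f z) \<partial>lborel) \<le>
       (\<integral>\<^sup>+z. (\<integral>\<^sup>+y. ennreal (K y) * ennreal (norm (f ((0, v - y) + z) - f z)) \<partial>lborel) \<partial>lborel)"
      by (rule nn_integral_mono) (rule pt)
    also have "\<dots> = (\<integral>\<^sup>+y. (\<integral>\<^sup>+z. ennreal (K y) * ennreal (norm (f ((0, v - y) + z) - f z)) \<partial>lborel) \<partial>lborel)"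
      by (rule lborel_pair.Fubini') measurable
    also have "\<dots> = (\<integral>\<^sup>+y. ennreal (K y) * (\<integral>\<^sup>+z. ennreal (norm (f ((0, v - y) + z) - f z)) \<partial>lborel) \<partial>lborel)"
      by (intro nn_integral_cong nn_integral_cmult) measurable
    also have "\<dots> \<le> (\<integral>\<^sup>+y. ennreal (K y) * ennreal e \<partial>lborel)"
    proof (intro nn_integral_mono)
      fix y :: "real^'n"
      show "ennreal (K y) * (\<integral>\<^sup>+z. ennreal (norm (f ((0, v - y) + z) - f z)) \<partial>lborel) \<le> ennreal (K y) * ennreal e"
      proof (cases "norm y \<le> r")
        case True
        have "norm (0::real, v - y) < d" using norm_triangle_ineq4[of v y] True rv by (simp add: norm_Pair)
        then show ?thesis by (intro mult_left_mono d) auto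
      qed (use mollifierD(3)[OF K, of y] in simp)
    qed
    also have "\<dots> = ennreal e" using mollifierD(9)[OF K] by (simp add: nn_integral_multc)
    finally show ?thesis .
  qed
  then show ?thesis using d(1) by blast
qed

subsection \<open>Lipschitz domains and a partition of unity\<close>

text \<open>At a boundary point \<open>a\<close> is a long multiple of the direction along which the
  domain lies below a graph, so translation by it lifts points of the complement further above the
  graph. At an interior point the claim is vacuous on a ball inside \<open>\<Omega>\<close>. The
  room \<open>2 * e\<close> is for the radius of a kernel plus the distance to the complement in
  \<open>approximant_in_Linf_Cc\<close>.\<close>

lemma lipschitz_domain_transversal:
  fixes \<Omega> :: "(real^'n) set"
  assumes "lipschitz_domain \<Omega>" and x0: "x0 \<in> closure \<Omega>"
  shows "\<exists>r>0. \<exists>a. \<forall>w e z. w \<in> ball x0 r \<and> w \<notin> \<Omega> \<and> 0 < e \<and> e < r \<and> norm z \<le> 2 * e \<longrightarrow> w + e *\<^sub>R a + z \<notin> \<Omega>"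
proof (cases "x0 \<in> \<Omega>")
  case True
  have "open \<Omega>" using assms(1) by (simp add: lipschitz_domain_def)
  then obtain r where "r > 0" "ball x0 r \<subseteq> \<Omega>" using True by (rule openE)
  then show ?thesis by (intro exI[of _ r] conjI exI[of _ 0]) auto
next
  case False
  have "open \<Omega>" using assms(1) by (simp add: lipschitz_domain_def)
  then have "x0 \<in> frontier \<Omega>" using False x0 by (simp add: frontier_def interior_open)
  moreover define P where "P r R k \<gamma> L \<longleftrightarrow> orthogonal_transformation R \<and> lipschitz_on L UNIV \<gamma> \<and>
        (\<forall>x y. (\<forall>i. i \<noteq> k \<longrightarrow> x$i = y$i) \<longrightarrow> \<gamma> x = \<gamma> y) \<and>
        \<Omega> \<inter> ball x0 r = {x \<in> ball x0 r. (R x)$k < \<gamma> (R x)}"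
    for r and R :: "real^'n \<Rightarrow> real^'n" and k and \<gamma> :: "real^'n \<Rightarrow> real" and L
  ultimately have "\<exists>r>0. \<exists>R k \<gamma> L. P r R k \<gamma> L"
    using assms(1) unfolding lipschitz_domain_def by simp
  then obtain r R k \<gamma> L where r: "r > 0" and all: "P r R k \<gamma> L" by blast
  have R: "orthogonal_transformation R" and L: "lipschitz_on L UNIV \<gamma>"
    and \<Omega>: "\<Omega> \<inter> ball x0 r = {x \<in> ball x0 r. (R x)$k < \<gamma> (R x)}" using all unfolding P_def by simp_all
  have \<gamma>: "\<gamma> x = \<gamma> y" if "\<And>i. i \<noteq> k \<Longrightarrow> x$i = y$i" for x y using all that unfolding P_def by blast
  have L0: "0 \<le> L" using L by (rule lipschitz_on_nonneg)
  have lin: "linear R" using R by (rule orthogonal_transformation_linear)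
  obtain u where u: "R u = axis k 1" using orthogonal_transformation_surj[OF R] by (metis surjD)
  have nR: "norm (R x) = norm x" for x using R by (rule orthogonal_transformation_norm)
  have nu: "norm u = 1" using nR[of u] u by simp
  \<comment> \<open>The perturbation \<open>z\<close> costs at most \<open>2 * e\<close> in the k-th
    coordinate and raises the graph by at most \<open>L * (2 * e)\<close>; a step of length
    \<open>e * K\<close> compensates both exactly.\<close>
  define K where "K = 2 * L + 2"
  have K0: "0 < K" using L0 by (simp add: K_def)
  \<comment> \<open>The point \<open>w\<close> is within \<open>r'\<close> of the centre, the step
    is at most \<open>r' * K\<close> and the perturbation at most \<open>2 * r'\<close>: in total
    \<open>r\<close>, so the graph description still applies.\<close>
  define r' where "r' = r / (K + 3)"
  have r': "0 < r'" using r K0 by (simp add: r'_def)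
  have r'r: "r' * (K + 3) = r" using K0 by (simp add: r'_def)
  have "w + e *\<^sub>R (K *\<^sub>R u) + z \<notin> \<Omega>" if w: "w \<in> ball x0 r'" "w \<notin> \<Omega>" and e: "0 < e" "e < r'" and z: "norm z \<le> 2 * e" for w e z
  proof
    let ?y = "w + e *\<^sub>R (K *\<^sub>R u) + z"
    assume y: "?y \<in> \<Omega>"
    have "norm (?y - x0) \<le> norm (w - x0) + e * K + 2 * e"
    proof -
      have "?y - x0 = (w - x0) + e *\<^sub>R (K *\<^sub>R u) + z" by simp
      also have "norm \<dots> \<le> norm (w - x0) + norm (e *\<^sub>R (K *\<^sub>R u)) + norm z"
        by (rule order_trans[OF norm_triangle_ineq add_right_mono[OF norm_triangle_ineq]])
      finally show ?thesis using z e K0 nu by simp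
    qed
    also have "\<dots> < r' + r' * K + 2 * r'"
    proof -
      have "norm (w - x0) < r'" using w by (simp add: dist_norm norm_minus_commute)
      moreover have "e * K \<le> r' * K" using e K0 by (intro mult_right_mono) auto
      ultimately show ?thesis using e by linarith
    qed
    also have "\<dots> = r" using r'r by (simp add: algebra_simps)
    finally have yb: "?y \<in> ball x0 r" by (simp add: dist_norm norm_minus_commute)
    then have "(R ?y)$k < \<gamma> (R ?y)" using y \<Omega> by blast
    moreover have "R ?y = R w + (e * K) *\<^sub>R axis k 1 + R z"
      using lin u by (simp add: linear_add linear_scale)
    ultimately have lt: "(R w + (e * K) *\<^sub>R axis k 1 + R z)$k < \<gamma> (R w + (e * K) *\<^sub>R axis k 1 + R z)" by simp
    have "\<gamma> (R w + (e * K) *\<^sub>R axis k 1 + R z) = \<gamma> (R w + R z)"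
      by (rule \<gamma>) (simp add: axis_def)
    also have "\<dots> \<le> \<gamma> (R w) + L * (2 * e)"
    proof -
      have "dist (\<gamma> (R w + R z)) (\<gamma> (R w)) \<le> L * dist (R w + R z) (R w)"
        by (rule lipschitz_onD[OF L]) auto
      also have "\<dots> = L * norm z" by (simp add: dist_norm nR)
      also have "\<dots> \<le> L * (2 * e)" using z L0 by (rule mult_left_mono)
      finally show ?thesis by (simp add: dist_real_def)
    qed
    finally have g: "\<gamma> (R w + (e * K) *\<^sub>R axis k 1 + R z) \<le> \<gamma> (R w) + L * (2 * e)" .
    have "\<bar>(R z)$k\<bar> \<le> 2 * e" using component_le_norm_cart[of "R z" k] nR[of z] z by simp
    then have "(R w)$k + e * K - 2 * e < \<gamma> (R w) + L * (2 * e)" using lt g by simp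
    moreover have "\<gamma> (R w) \<le> (R w)$k"
    proof -
      have "r' * 1 \<le> r' * (K + 3)" using r' K0 by (intro mult_left_mono) auto
      then have wb: "w \<in> ball x0 r" using w(1) r'r by simp
      have "w \<notin> {x \<in> ball x0 r. (R x)$k < \<gamma> (R x)}" unfolding \<Omega>[symmetric] using w(2) by simp
      then show ?thesis using wb by (simp add: not_less)
    qed
    ultimately have "e * K < e * (2 * L + 2)" by (simp add: algebra_simps)
    then show False by (simp add: K_def)
  qed
  then show ?thesis using r' by (intro exI[of _ r'] conjI exI[of _ "K *\<^sub>R u"] allI impI) simp_all
qed

text \<open>Mollified indicators of a finite Borel partition already sum to 1, so nothing has to be normalised.\<close>

lemma finite_smooth_partition:
  fixes \<Omega> :: "(real^'n) set" and \<rho> :: "real^'n \<Rightarrow> real"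
  assumes "bounded \<Omega>" and \<rho>: "\<And>x. x \<in> closure \<Omega> \<Longrightarrow> 0 < \<rho> x"
  shows "\<exists>(k::nat) c \<theta>. (\<forall>i<k. c i \<in> closure \<Omega> \<and> cb_smooth (\<lambda>_::unit. \<theta> i) \<and> (\<forall>x. 0 \<le> \<theta> i x) \<and>
      (\<forall>x. \<theta> i x \<noteq> 0 \<longrightarrow> dist (c i) x < \<rho> (c i))) \<and> (\<forall>x\<in>\<Omega>. (\<Sum>i<k. \<theta> i x) = 1)"
proof -
  let ?b = "\<lambda>c. ball c (\<rho> c / 2)"
  have cp: "compact (closure \<Omega>)" using assms(1) by simp
  have "\<exists>C. finite C \<and> C \<subseteq> closure \<Omega> \<and> closure \<Omega> \<subseteq> (\<Union>c\<in>C. ?b c)"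
  proof -
    have "closure \<Omega> \<subseteq> (\<Union>c\<in>closure \<Omega>. ?b c)" using \<rho> by force
    from compactE_image[OF cp _ this] show ?thesis by (metis open_ball)
  qed
  then obtain C where C: "finite C" "C \<subseteq> closure \<Omega>" "closure \<Omega> \<subseteq> (\<Union>c\<in>C. ?b c)" by blast
  obtain c k where ck: "C = c ` {i::nat. i < k}" "inj_on c {i. i < k}"
    using finite_imp_nat_seg_image_inj_on[OF C(1)] by blast
  have ci: "c i \<in> closure \<Omega>" if "i < k" for i using that ck C by auto
  define U where "U = (\<Union>i<k. ?b (c i))"
  have U: "closure \<Omega> \<subseteq> U" using C(3) by (auto simp: U_def ck)
  obtain \<eta> where \<eta>: "\<eta> > 0" "(\<Union>x\<in>closure \<Omega>. ball x \<eta>) \<subseteq> U"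
    using compact_subset_open_imp_ball_epsilon_subset[OF cp _ U] unfolding U_def by blast
  \<comment> \<open>With \<open>\<eta>/2\<close> a kernel centred in \<open>\<Omega>\<close> stays
    inside the union of the small balls, so the mollified indicators sum to 1 there;
    \<open>\<rho> (c i) / 2\<close> is the gap between the small ball and the allowed
    support.\<close>
  define e where "e = Min (insert (\<eta>/2) ((\<lambda>i. \<rho> (c i) / 2) ` {..<k}))"
  have e0: "0 < e" using \<eta>(1) \<rho> ci by (simp add: e_def)
  have e: "0 < e" "e \<le> \<eta>/2" "\<And>i. i < k \<Longrightarrow> e \<le> \<rho> (c i) / 2"
    unfolding e_def by (rule e0[unfolded e_def]) (rule Min_le; simp)+
  obtain B K where K: "mollifier B e (K::real^'n \<Rightarrow> real)" using mollifier_exists e(1) by blast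
  note [measurable] = mollifierD(7)[OF K]
  \<comment> \<open>Removing the earlier balls makes the pieces disjoint without changing their
    union.\<close>
  define E where "E i = ?b (c i) - (\<Union>j<i. ?b (c j))" for i
  have E[measurable]: "E i \<in> sets borel" for i unfolding E_def by measurable
  have Eint: "integrable lborel (indicat_real (E i))" for i
  proof (rule integrable_real_indicator)
    show "emeasure lborel (E i) < \<infinity>"
      by (rule emeasure_bounded_finite) (auto intro: bounded_subset[OF bounded_ball] simp: E_def)
  qed simp
  have Esum: "(\<Sum>i<k. indicat_real (E i) y) = indicat_real U y" for y
  proof (cases "y \<in> U")
    case True
    define i where "i = (LEAST i. y \<in> ?b (c i))"
    obtain i' where i': "i' < k" "y \<in> ?b (c i')" using True by (auto simp: U_def)
    have i: "y \<in> ?b (c i)" unfolding i_def using i'(2) by (rule LeastI)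
    have il: "i \<le> i'" unfolding i_def using i'(2) by (rule Least_le)
    have nl: "y \<notin> ?b (c j)" if "j < i" for j using not_less_Least that unfolding i_def by blast
    have "y \<in> E j \<longleftrightarrow> j = i" for j
    proof
      assume "y \<in> E j"
      then have "y \<in> ?b (c j)" "\<And>l. l < j \<Longrightarrow> y \<notin> ?b (c l)" by (auto simp: E_def)
      then show "j = i" using i nl by (metis linorder_neqE_nat)
    qed (use i nl in \<open>auto simp: E_def\<close>)
    then have "(\<Sum>j<k. indicat_real (E j) y) = (\<Sum>j<k. if j = i then 1 else 0)" by (simp add: indicator_def)
    then show ?thesis using True il i' by (simp add: indicator_def)
  next
    case False
    then have "\<And>i. i < k \<Longrightarrow> y \<notin> E i" by (auto simp: U_def E_def)
    then show ?thesis using False by (simp add: indicator_def)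
  qed
  \<comment> \<open>The summand 0 matches the shift parameter of
    \<open>cb_smooth_conv\<close>.\<close>
  define \<theta> where "\<theta> i x = conv K (indicat_real (E i)) (x + 0)" for i x
  have sm: "cb_smooth (\<lambda>_::unit. \<theta> i)" for i
    unfolding \<theta>_def[abs_def] by (rule cb_smooth_conv[OF mollifierD(1)[OF K]]) (auto simp: Eint)
  have nn: "0 \<le> \<theta> i x" for i x using conv_mono_bound(1)[OF K Eint, of i "x + 0"] by (simp add: \<theta>_def)
  have sup: "dist (c i) x < \<rho> (c i)" if i: "i < k" and n: "\<theta> i x \<noteq> 0" for i x
  proof (rule ccontr)
    assume far: "\<not> dist (c i) x < \<rho> (c i)"
    have "K (x - y) *\<^sub>R indicat_real (E i) y = 0" for y
    proof (cases "y \<in> E i")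
      case True
      then have "dist (c i) y < \<rho> (c i) / 2" by (simp add: E_def)
      then have "e < dist x y" using far e(3)[OF i] dist_triangle[of "c i" x y] by (simp add: dist_commute)
      then show ?thesis using mollifierD(3)[OF K, of "x - y"] by (simp add: dist_norm)
    qed simp
    then have "(\<lambda>y. K (x - y) *\<^sub>R indicat_real (E i) y) = (\<lambda>y. 0)" by blast
    then show False using n by (simp add: \<theta>_def conv_def del: real_scaleR_def)
  qed
  have sum1: "(\<Sum>i<k. \<theta> i x) = 1" if x: "x \<in> \<Omega>" for x
  proof -
    have "(\<Sum>i<k. \<theta> i x) = (\<integral>y. (\<Sum>i<k. K (x - y) *\<^sub>R indicat_real (E i) y) \<partial>lborel)"
      unfolding \<theta>_def conv_def using integrable_mollifier_mult[OF K Eint, of x]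
      by (subst Bochner_Integration.integral_sum) auto
    also have "\<dots> = (\<integral>y. K (x - y) \<partial>lborel)"
    proof (rule Bochner_Integration.integral_cong[OF refl])
      fix y
      have "(\<Sum>i<k. K (x - y) *\<^sub>R indicat_real (E i) y) = K (x - y) * indicat_real U y"
        by (simp add: Esum sum_distrib_left[symmetric])
      also have "\<dots> = K (x - y)"
      proof (cases "y \<in> U")
        case False
        have "x \<in> closure \<Omega>" using x closure_subset by blast
        then have "\<not> dist x y < \<eta>" using \<eta>(2) False by (meson UN_I mem_ball subsetD)
        then have "e < norm (x - y)" using e \<eta>(1) by (simp add: dist_norm)
        then show ?thesis using mollifierD(3)[OF K, of "x - y"] by simp
      qed simp
      finally show "(\<Sum>i<k. K (x - y) *\<^sub>R indicat_real (E i) y) = K (x - y)" .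
    qed
    finally show ?thesis using integrable_mollifier_shift(2)[OF K] by simp
  qed
  show ?thesis
    using ci sm nn sup sum1 by (intro exI[of _ k] exI[of _ c] exI[of _ \<theta>]) simp
qed

text \<open>Each partition function is supported within half the radius on which transversality at
  its centre holds, and \<open>r0\<close> is at most that half; so every \<open>w\<close> within
  \<open>r0\<close> of the support is in reach of the direction attached to the centre.\<close>

lemma lipschitz_domain_partition:
  fixes \<Omega> :: "(real^'n) set"
  assumes "bounded \<Omega>" "lipschitz_domain \<Omega>"
  obtains k :: nat and a \<theta> r0 where "0 < r0"
    "\<And>i. i < k \<Longrightarrow> cb_smooth (\<lambda>_::unit. \<theta> i)" "\<And>i x. i < k \<Longrightarrow> 0 \<le> \<theta> i x"
    "\<And>x. x \<in> \<Omega> \<Longrightarrow> (\<Sum>i<k. \<theta> i x) = 1"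
    "\<And>i x w e z. i < k \<Longrightarrow> \<theta> i x \<noteq> 0 \<Longrightarrow> w \<notin> \<Omega> \<Longrightarrow> dist x w < r0 \<Longrightarrow> 0 < e \<Longrightarrow> e < r0 \<Longrightarrow> norm z \<le> 2 * e \<Longrightarrow>
       w + e *\<^sub>R a i + z \<notin> \<Omega>"
proof -
  let ?P = "\<lambda>x0 r a. \<forall>w e z. w \<in> ball x0 r \<and> w \<notin> \<Omega> \<and> 0 < e \<and> e < r \<and> norm z \<le> 2 * e \<longrightarrow> w + e *\<^sub>R a + z \<notin> \<Omega>"
  have "\<forall>x0\<in>closure \<Omega>. \<exists>r. \<exists>a. r > 0 \<and> ?P x0 r a"
    using lipschitz_domain_transversal[OF assms(2)] by blast
  then obtain r a where ra: "\<And>x0. x0 \<in> closure \<Omega> \<Longrightarrow> r x0 > 0 \<and> ?P x0 (r x0) (a x0)" by metis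
  have "\<exists>(k::nat) c \<theta>. (\<forall>i<k. c i \<in> closure \<Omega> \<and> cb_smooth (\<lambda>_::unit. \<theta> i) \<and> (\<forall>x. 0 \<le> \<theta> i x) \<and>
      (\<forall>x. \<theta> i x \<noteq> 0 \<longrightarrow> dist (c i) x < r (c i) / 2)) \<and> (\<forall>x\<in>\<Omega>. (\<Sum>i<k. \<theta> i x) = 1)"
    using finite_smooth_partition[OF assms(1), of "\<lambda>x. r x / 2"] ra by simp
  then obtain k :: nat and c \<theta> where \<theta>: "\<And>i. i < k \<Longrightarrow> c i \<in> closure \<Omega>" "\<And>i. i < k \<Longrightarrow> cb_smooth (\<lambda>_::unit. \<theta> i)"
    "\<And>i x. i < k \<Longrightarrow> 0 \<le> \<theta> i x" "\<And>i x. i < k \<Longrightarrow> \<theta> i x \<noteq> 0 \<Longrightarrow> dist (c i) x < r (c i) / 2"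
    "\<And>x. x \<in> \<Omega> \<Longrightarrow> (\<Sum>i<k. \<theta> i x) = 1"
    by blast
  \<comment> \<open>The inserted 1 covers the case \<open>k = 0\<close>.\<close>
  define r0 where "r0 = Min (insert 1 ((\<lambda>i. r (c i) / 2) ` {..<k}))"
  have r00: "0 < r0" using ra \<theta>(1) by (simp add: r0_def)
  have r0: "0 < r0" "\<And>i. i < k \<Longrightarrow> r0 \<le> r (c i) / 2"
    unfolding r0_def by (rule r00[unfolded r0_def]) (rule Min_le; simp)
  show ?thesis
  proof (rule that[of r0 k \<theta> "\<lambda>i. a (c i)"])
    fix i and x w z :: "real^'n" and e
    assume *: "i < k" "\<theta> i x \<noteq> 0" "w \<notin> \<Omega>" "dist x w < r0" "0 < e" "e < r0" "norm z \<le> 2 * e"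
    have rp: "0 < r (c i)" using ra \<theta>(1) * by blast
    have "dist (c i) w < r (c i)" using \<theta>(4)[OF *(1,2)] r0(2)[OF *(1)] *(4) dist_triangle[of "c i" w x] by linarith
    moreover have "e < r (c i)" using r0(2)[OF *(1)] *(6) rp by linarith
    ultimately show "w + e *\<^sub>R a (c i) + z \<notin> \<Omega>" using ra[OF \<theta>(1)[OF *(1)]] * by simp
  qed (use r0 \<theta> in auto)
qed

subsection \<open>Mollification of functions with a weak gradient\<close>

text \<open>The complement of the support is open, so the derivatives vanish there as well;
  boundedness and integrability then come from continuity on a compact set.\<close>

lemma test_fun_facts:
  fixes \<psi> :: "real^'n \<Rightarrow> real"
  assumes "test_fun \<Omega> \<psi>"
  shows "\<psi> differentiable (at x)" "\<psi> \<in> borel_measurable borel" "partial_deriv i \<psi> \<in> borel_measurable borel"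
    "\<exists>B. \<forall>x. \<bar>\<psi> x\<bar> \<le> B" "\<exists>B. \<forall>i x. \<bar>partial_deriv i \<psi> x\<bar> \<le> B"
    "integrable lborel \<psi>" "integrable lborel (partial_deriv i \<psi>)"
    "x \<notin> \<Omega> \<Longrightarrow> \<psi> x = 0" "x \<notin> \<Omega> \<Longrightarrow> partial_deriv i \<psi> x = 0"
proof -
  define S where "S = closure {x. \<psi> x \<noteq> 0}"
  have S: "compact S" "S \<subseteq> \<Omega>" using assms by (auto simp: test_fun_def S_def)
  have sm: "iter_pd is \<psi> differentiable (at x)" for "is" x using assms by (auto simp: test_fun_def smooth_fun_def)
  show d: "\<psi> differentiable (at x)" for x using sm[of "[]"] by simp
  have pd: "partial_deriv i \<psi> differentiable (at x)" for i x using sm[of "[i]"] by simp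
  show m: "\<psi> \<in> borel_measurable borel" "partial_deriv i \<psi> \<in> borel_measurable borel" for i
    by (rule borel_measurable_differentiable, rule d, rule borel_measurable_differentiable, rule pd)
  have z: "\<psi> x = 0" if "x \<notin> S" for x using that closure_subset[of "{x. \<psi> x \<noteq> 0}"] by (auto simp: S_def)
  have zp: "partial_deriv i \<psi> x = 0" if x: "x \<notin> S" for i x
  proof -
    have o: "open (- S)" using S(1) by (simp add: compact_imp_closed open_Compl)
    have "(\<psi> has_derivative (\<lambda>_. 0)) (at x)"
      by (rule has_derivative_transform_within_open[OF has_derivative_const[of 0] o]) (use x z in auto)
    then show ?thesis by (rule has_derivative_partial_deriv)
  qed
  show "x \<notin> \<Omega> \<Longrightarrow> \<psi> x = 0" "x \<notin> \<Omega> \<Longrightarrow> partial_deriv i \<psi> x = 0" using z zp S(2) by blast+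
  have bd: "\<exists>B. \<forall>x. \<bar>f x\<bar> \<le> B" if f: "\<And>x. f differentiable (at x)" "\<And>x. x \<notin> S \<Longrightarrow> f x = 0" for f :: "real^'n \<Rightarrow> real"
  proof -
    have "compact (f ` S)"
      using f(1) by (intro compact_continuous_image S(1) continuous_at_imp_continuous_on ballI differentiable_imp_continuous_within)
    then obtain B where "\<forall>y\<in>f ` S. norm y \<le> B" using compact_imp_bounded bounded_iff by blast
    then have "\<bar>f x\<bar> \<le> \<bar>B\<bar>" for x using f(2)[of x] by (cases "x \<in> S") (auto intro: order_trans)
    then show ?thesis by blast
  qed
  show b0: "\<exists>B. \<forall>x. \<bar>\<psi> x\<bar> \<le> B" using bd[OF d z] .
  have bi: "\<exists>B. \<forall>x. \<bar>partial_deriv i \<psi> x\<bar> \<le> B" for i using bd[OF pd zp] .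
  then obtain B where B: "\<And>i x. \<bar>partial_deriv i \<psi> x\<bar> \<le> B i" by metis
  have "\<bar>partial_deriv i \<psi> x\<bar> \<le> (\<Sum>i\<in>UNIV. \<bar>B i\<bar>)" for i x
    using B[of i x] member_le_sum[of i UNIV "\<lambda>i. \<bar>B i\<bar>"] abs_ge_self[of "B i"] by fastforce
  then show "\<exists>B. \<forall>i x. \<bar>partial_deriv i \<psi> x\<bar> \<le> B" by blast
  have int: "integrable lborel f" if b: "\<exists>B. \<forall>x. \<bar>f x\<bar> \<le> B" and zf: "\<And>x. x \<notin> S \<Longrightarrow> f x = 0" and [measurable]: "f \<in> borel_measurable borel"
    for f :: "real^'n \<Rightarrow> real"
  proof -
    obtain B where B: "\<And>x. \<bar>f x\<bar> \<le> B" using b by blast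
    have mS: "S \<in> sets borel" using S(1) by (simp add: borel_compact)
    show ?thesis
    proof (rule Bochner_Integration.integrable_bound)
      show "integrable lborel (\<lambda>x. B * indicat_real S x)"
        using mS by (intro integrable_mult_right integrable_real_indicator emeasure_bounded_finite compact_imp_bounded S(1)) simp
      show "AE x in lborel. norm (f x) \<le> norm (B * indicat_real S x)"
      proof (intro AE_I2)
        fix x show "norm (f x) \<le> norm (B * indicat_real S x)"
          using zf[of x] B[of x] by (cases "x \<in> S") (auto simp: abs_mult)
      qed
    qed simp
  qed
  show "integrable lborel \<psi>" by (rule int[OF b0 z m(1)])
  show "integrable lborel (partial_deriv i \<psi>)" by (rule int[OF bi zp m(2)])
qed

lemma conv_diff_le:
  fixes K f g :: "real^'n \<Rightarrow> real"
  assumes K: "K \<in> borel_measurable borel" and B: "\<And>x. \<bar>K x\<bar> \<le> B" and f: "integrable lborel f" and g: "integrable lborel g"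
  shows "\<bar>conv K f x - conv K g x\<bar> \<le> B * (\<integral>y. \<bar>f y - g y\<bar> \<partial>lborel)"
proof -
  have "conv K f x - conv K g x = conv K (\<lambda>y. f y - g y) x"
    using integrable_bounded_mult[OF K B f, of x] integrable_bounded_mult[OF K B g, of x]
    by (simp add: conv_def right_diff_distrib)
  then show ?thesis using norm_conv_le[OF K B Bochner_Integration.integrable_diff[OF f g], of x] by simp
qed

text \<open>For a test function \<open>\<psi>\<close> the derivative of \<open>conv K \<psi>\<close> may be put on either factor;
  this replaces integration by parts, and the approximating test functions carry it over.\<close>

lemma conv_W011_0:
  fixes \<Omega> :: "(real^'n) set"
  assumes K: "mollifier B e K" and W: "W011_0 \<Omega> u v" and \<Omega>: "open \<Omega>"
    and f: "integrable lborel f" and g: "integrable lborel g"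
    and fu: "AE x in lborel. f x = (if x \<in> \<Omega> then u x else 0)"
    and gv: "AE x in lborel. g x = (if x \<in> \<Omega> then v x else 0)"
  shows "conv (partial_deriv i K) f x = conv K g x $ i"
proof -
  note Ks = cb_smooth_facts[OF mollifierD(1)[OF K]]
  note [measurable] = Ks(2,3)
  obtain B0 B1 where B0: "\<And>x. \<bar>K x\<bar> \<le> B0" and B1: "\<And>i x. \<bar>partial_deriv i K x\<bar> \<le> B1" using Ks(4,5) by blast
  have pos: "0 \<le> B0" "0 \<le> B1" using B0[of 0] B1[of i 0] by linarith+
  have gi: "integrable lborel (\<lambda>y. g y $ i)"
    using integrable_bounded_linear[OF bounded_linear_vec_nth g] .
  have cgi: "conv K g x $ i = conv K (\<lambda>y. g y $ i) x"
    using integral_bounded_linear[OF bounded_linear_vec_nth integrable_mollifier_mult[OF K g, of x], of i]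
    by (simp add: conv_def)
  obtain \<psi>s where \<psi>s: "\<And>k. test_fun \<Omega> (\<psi>s k)"
    "(\<lambda>k. \<integral>\<^sup>+x. ennreal (\<bar>\<psi>s k x - u x\<bar> + norm (grad (\<psi>s k) x - v x)) \<partial>lebesgue_on \<Omega>) \<longlonglongrightarrow> 0"
    using W unfolding W011_0_def by blast
  have small: "\<bar>conv (partial_deriv i K) f x - conv K (\<lambda>y. g y $ i) x\<bar> \<le> (B0 + B1) * \<eta>" if \<eta>: "0 < \<eta>" for \<eta>
  proof -
    have "eventually (\<lambda>k. (\<integral>\<^sup>+x. ennreal (\<bar>\<psi>s k x - u x\<bar> + norm (grad (\<psi>s k) x - v x)) \<partial>lebesgue_on \<Omega>) < ennreal \<eta>) sequentially"
      using \<psi>s(2) \<eta> by (intro order_tendstoD(2)) auto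
    then obtain k where k: "(\<integral>\<^sup>+x. ennreal (\<bar>\<psi>s k x - u x\<bar> + norm (grad (\<psi>s k) x - v x)) \<partial>lebesgue_on \<Omega>) < ennreal \<eta>"
      by (auto simp: eventually_sequentially)
    define \<psi> where "\<psi> = \<psi>s k"
    note t = test_fun_facts[OF \<psi>s(1)[of k], folded \<psi>_def]
    \<comment> \<open>The approximating integral controls function and gradient together, so one
      estimate serves both error terms below.\<close>
    have key: "(\<integral>y. \<bar>p y\<bar> \<partial>lborel) \<le> \<eta>" if p: "integrable lborel p"
      and le: "AE y in lborel. \<bar>p y\<bar> \<le> (if y \<in> \<Omega> then \<bar>\<psi> y - u y\<bar> + norm (grad \<psi> y - v y) else 0)" for p :: "real^'n \<Rightarrow> real"
    proof -
      have \<Omega>L: "\<Omega> \<in> sets lebesgue" using \<Omega> by auto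
      have "(\<integral>\<^sup>+y. ennreal \<bar>p y\<bar> \<partial>lborel) = (\<integral>\<^sup>+y. ennreal \<bar>p y\<bar> \<partial>lebesgue)"
        by (simp add: nn_integral_completion)
      also have "\<dots> \<le> (\<integral>\<^sup>+y. ennreal (\<bar>\<psi> y - u y\<bar> + norm (grad \<psi> y - v y)) * indicator \<Omega> y \<partial>lebesgue)"
      proof (rule nn_integral_mono_AE)
        show "AE y in lebesgue. ennreal \<bar>p y\<bar> \<le> ennreal (\<bar>\<psi> y - u y\<bar> + norm (grad \<psi> y - v y)) * indicator \<Omega> y"
          using AE_completion[OF le] by eventually_elim (auto simp: indicator_def simp flip: ennreal_plus)
      qed
      also have "\<dots> = (\<integral>\<^sup>+y. ennreal (\<bar>\<psi> y - u y\<bar> + norm (grad \<psi> y - v y)) \<partial>lebesgue_on \<Omega>)"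
        using \<Omega>L by (simp add: nn_integral_restrict_space)
      also have "\<dots> \<le> ennreal \<eta>" using k by (simp add: \<psi>_def)
      finally have "(\<integral>\<^sup>+y. ennreal \<bar>p y\<bar> \<partial>lborel) \<le> ennreal \<eta>" .
      moreover have "(\<integral>\<^sup>+y. ennreal \<bar>p y\<bar> \<partial>lborel) = ennreal (\<integral>y. \<bar>p y\<bar> \<partial>lborel)"
        using p by (intro nn_integral_eq_integral) auto
      ultimately show ?thesis using \<eta> by simp
    qed
    have k1: "(\<integral>y. \<bar>f y - \<psi> y\<bar> \<partial>lborel) \<le> \<eta>"
    proof (rule key)
      show "AE y in lborel. \<bar>f y - \<psi> y\<bar> \<le> (if y \<in> \<Omega> then \<bar>\<psi> y - u y\<bar> + norm (grad \<psi> y - v y) else 0)"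
        using fu by eventually_elim (auto simp: t(8) abs_minus_commute)
    qed (use f t(6) in simp)
    have k2: "(\<integral>y. \<bar>partial_deriv i \<psi> y - g y $ i\<bar> \<partial>lborel) \<le> \<eta>"
    proof (rule key)
      show "AE y in lborel. \<bar>partial_deriv i \<psi> y - g y $ i\<bar> \<le> (if y \<in> \<Omega> then \<bar>\<psi> y - u y\<bar> + norm (grad \<psi> y - v y) else 0)"
        using gv
      proof eventually_elim
        case (elim y)
        have "\<bar>partial_deriv i \<psi> y - v y $ i\<bar> \<le> norm (grad \<psi> y - v y)"
          using component_le_norm_cart[of "grad \<psi> y - v y" i] by (simp add: grad_def)
        then show ?case using elim t(9) by auto
      qed
    qed (use gi t(7) in simp)
    obtain C0 C1 where C: "\<And>x. \<bar>\<psi> x\<bar> \<le> C0" "\<And>i x. \<bar>partial_deriv i \<psi> x\<bar> \<le> C1" using t(4,5) by blast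
    have D1: "(conv \<psi> K has_derivative (\<lambda>h. \<Sum>i\<in>UNIV. h $ i * conv (partial_deriv i \<psi>) K x)) (at x)"
      by (rule has_derivative_conv[OF t(1) C(1) C(2) t(3) mollifierD(5)[OF K]])
    have c: "conv \<psi> K = conv K \<psi>" by (rule ext) (rule conv_commute[OF t(2) Ks(2)])
    have D2: "(conv K \<psi> has_derivative (\<lambda>h. \<Sum>i\<in>UNIV. h $ i * conv (partial_deriv i K) \<psi> x)) (at x)"
      by (rule has_derivative_conv[OF Ks(1) B0 B1 Ks(3) t(6)])
    have "(\<lambda>h. \<Sum>i\<in>UNIV. h $ i * conv (partial_deriv i \<psi>) K x) = (\<lambda>h. \<Sum>i\<in>UNIV. h $ i * conv (partial_deriv i K) \<psi> x)"
      by (rule has_derivative_unique[OF D1[unfolded c] D2])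
    from fun_cong[OF this, of "axis i 1"]
    have "conv (partial_deriv i \<psi>) K x = conv (partial_deriv i K) \<psi> x"
      by (simp add: axis_def if_distrib[of "\<lambda>b. b * _"] cong: if_cong)
    then have eq: "conv (partial_deriv i K) \<psi> x = conv K (partial_deriv i \<psi>) x"
      using conv_commute[OF t(3) Ks(2)] by simp
    have "\<bar>conv (partial_deriv i K) f x - conv (partial_deriv i K) \<psi> x\<bar> \<le> B1 * \<eta>"
      using conv_diff_le[OF Ks(3)[of i] B1 f t(6), of x] mult_left_mono[OF k1 pos(2)] by linarith
    moreover have "\<bar>conv K (partial_deriv i \<psi>) x - conv K (\<lambda>y. g y $ i) x\<bar> \<le> B0 * \<eta>"
      using conv_diff_le[OF Ks(2) B0 t(7)[of i] gi, of x] mult_left_mono[OF k2 pos(1)] by linarith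
    ultimately show ?thesis unfolding eq distrib_right by linarith
  qed
  have "\<bar>conv (partial_deriv i K) f x - conv K (\<lambda>y. g y $ i) x\<bar> \<le> 0"
  proof (rule field_le_epsilon)
    fix e' :: real assume e': "0 < e'"
    have "(B0 + B1) * (e' / (B0 + B1 + 1)) \<le> e'"
      using pos e' by (simp add: divide_le_eq mult.commute[of e'] mult_right_mono)
    then show "\<bar>conv (partial_deriv i K) f x - conv K (\<lambda>y. g y $ i) x\<bar> \<le> 0 + e'"
      using small[of "e' / (B0 + B1 + 1)"] e' pos by simp
  qed
  then show ?thesis using cgi by simp
qed

subsection \<open>The modular of a mollified field\<close>

text \<open>The last two facts stand in for the triangle inequality and for local boundedness. The
  midpoint inequality is what doubles the scale whenever a sum is split. For the final bound, a
  vector is the average of its coordinate vectors stretched by \<open>CARD('n)\<close>, so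
  \<open>F\<close> on a ball is controlled by its values at finitely many fixed vectors, where
  integrability of \<open>M\<close> is available.\<close>

lemma even_convex_facts:
  fixes F :: "real^'n \<Rightarrow> real"
  assumes F: "convex_on UNIV F" "\<And>\<xi>. F (-\<xi>) = F \<xi>" "F 0 = 0"
  shows "0 \<le> F \<xi>" "\<bar>c\<bar> \<le> 1 \<Longrightarrow> F (c *\<^sub>R \<xi>) \<le> F \<xi>" "continuous_on UNIV F"
    "F ((1/2) *\<^sub>R (\<xi> + \<eta>)) \<le> F \<xi> + F \<eta>"
    "norm \<xi> \<le> r \<Longrightarrow> F \<xi> \<le> (\<Sum>i\<in>UNIV. F ((real CARD('n) * r) *\<^sub>R axis i 1))"
proof -
  have conv: "F (u *\<^sub>R x + v *\<^sub>R y) \<le> u * F x + v * F y" if "0 \<le> u" "0 \<le> v" "u + v = 1" for u v x y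
    using F(1) that unfolding convex_on_def by auto
  show nn: "0 \<le> F \<xi>" for \<xi> using conv[of "1/2" "1/2" \<xi> "-\<xi>"] F(2)[of \<xi>] F(3) by simp
  have sc1: "F (c *\<^sub>R \<xi>) \<le> F \<xi>" if "0 \<le> c" "c \<le> 1" for c \<xi>
    using conv[of c "1 - c" \<xi> 0] that F(3) nn[of \<xi>] mult_right_mono[of c 1 "F \<xi>"] by simp
  show sc: "F (c *\<^sub>R \<xi>) \<le> F \<xi>" if "\<bar>c\<bar> \<le> 1" for c \<xi>
  proof (cases "0 \<le> c")
    case True then show ?thesis using sc1 that by simp
  next
    case False
    then have "F ((-c) *\<^sub>R \<xi>) \<le> F \<xi>" using sc1[of "-c" \<xi>] that by simp
    then show ?thesis using F(2)[of "c *\<^sub>R \<xi>"] by simp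
  qed
  show "continuous_on UNIV F" by (rule convex_on_continuous[OF open_UNIV F(1)])
  show "F ((1/2) *\<^sub>R (\<xi> + \<eta>)) \<le> F \<xi> + F \<eta>"
    using conv[of "1/2" "1/2" \<xi> \<eta>] nn[of \<xi>] nn[of \<eta>] by (simp add: scaleR_add_right)
  show "F \<xi> \<le> (\<Sum>i\<in>UNIV. F ((real CARD('n) * r) *\<^sub>R axis i 1))" if "norm \<xi> \<le> r"
  proof -
    let ?N = "real CARD('n)"
    have "\<xi> = (\<Sum>i\<in>UNIV. (1/?N) *\<^sub>R ((?N * \<xi> $ i) *\<^sub>R axis i 1))"
      using basis_expansion[of \<xi>] by (simp add: scalar_mult_eq_scaleR)
    then have "F \<xi> = F (\<Sum>i\<in>UNIV. (1/?N) *\<^sub>R ((?N * \<xi> $ i) *\<^sub>R axis i 1))" by simp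
    also have "\<dots> \<le> (\<Sum>i\<in>UNIV. (1/?N) * F ((?N * \<xi> $ i) *\<^sub>R axis i 1))"
      by (rule convex_on_sum[OF _ _ F(1)]) auto
    also have "\<dots> \<le> (\<Sum>i\<in>UNIV. F ((?N * r) *\<^sub>R axis i 1))"
    proof (rule sum_mono)
      fix i :: 'n
      have "F ((?N * \<xi> $ i) *\<^sub>R axis i 1) \<le> F ((?N * r) *\<^sub>R axis i 1)"
      proof (cases "r = 0")
        case True
        then show ?thesis using that by simp
      next
        case False
        then have r: "0 < r" using that norm_ge_zero[of \<xi>] by linarith
        have "F ((\<xi> $ i / r) *\<^sub>R ((?N * r) *\<^sub>R axis i 1)) \<le> F ((?N * r) *\<^sub>R axis i 1)"
          using component_le_norm_cart[of \<xi> i] that r by (intro sc) (simp add: divide_le_eq)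
        then show ?thesis using r by (simp add: mult.commute)
      qed
      moreover have "(1/?N) * F ((?N * \<xi> $ i) *\<^sub>R axis i 1) \<le> 1 * F ((?N * \<xi> $ i) *\<^sub>R axis i 1)"
        by (intro mult_right_mono nn) simp
      ultimately show "(1/?N) * F ((?N * \<xi> $ i) *\<^sub>R axis i 1) \<le> F ((?N * r) *\<^sub>R axis i 1)" by simp
    qed
    finally show ?thesis .
  qed
qed

text \<open>Along simple functions the composition is a finite sum of measurable terms, one for each
  value; continuity in the second argument passes to the limit.\<close>

lemma borel_measurable_caratheodory:
  fixes F :: "'a \<Rightarrow> 'b::{metric_space,second_countable_topology} \<Rightarrow> real"
  assumes F: "\<And>\<xi>. (\<lambda>z. F z \<xi>) \<in> borel_measurable L" and c: "\<And>z. z \<in> space L \<Longrightarrow> continuous_on UNIV (F z)"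
    and g: "g \<in> borel_measurable L"
  shows "(\<lambda>z. F z (g z)) \<in> borel_measurable L"
proof -
  obtain s where s: "\<And>i. simple_function L (s i)" "\<And>z. z \<in> space L \<Longrightarrow> (\<lambda>i. s i z) \<longlonglongrightarrow> g z"
    using borel_measurable_implies_sequence_metric[OF g, of undefined] by blast
  have m: "(\<lambda>z. F z (s i z)) \<in> borel_measurable L" for i
  proof -
    have fin: "finite (s i ` space L)" using s(1) by (rule simple_functionD)
    have "(\<lambda>z. \<Sum>y\<in>s i ` space L. indicat_real (s i -` {y} \<inter> space L) z * F z y) \<in> borel_measurable L"
      by (intro borel_measurable_sum borel_measurable_times F borel_measurable_indicator simple_functionD(2) s(1))
    moreover have "(\<Sum>y\<in>s i ` space L. indicat_real (s i -` {y} \<inter> space L) z * F z y) = F z (s i z)" if "z \<in> space L" for z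
    proof -
      have "(\<Sum>y\<in>s i ` space L. indicat_real (s i -` {y} \<inter> space L) z * F z y) = (\<Sum>y\<in>s i ` space L. if y = s i z then F z y else 0)"
        using that by (intro sum.cong) (auto simp: indicator_def)
      then show ?thesis using fin that by simp
    qed
    ultimately show ?thesis by (simp cong: measurable_cong)
  qed
  show ?thesis
  proof (rule borel_measurable_LIMSEQ_metric[OF m])
    fix z assume z: "z \<in> space L"
    then have "isCont (F z) (g z)" using c by (simp add: continuous_on_eq_continuous_at)
    then show "(\<lambda>i. F z (s i z)) \<longlonglongrightarrow> F z (g z)" using s(2)[OF z] by (rule isCont_tendsto_compose)
  qed
qed

section \<open>Null sets, sections and essential infima\<close>

lemma AE_lebesgue_on_iff:
  assumes "A \<in> sets borel"
  shows "(AE x in lebesgue_on A. P x) \<longleftrightarrow> (AE x in lborel. x \<in> A \<longrightarrow> P x)"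
  using assms by (simp add: AE_restrict_space_iff AE_completion_iff)

lemma AE_lborel_sections:
  fixes P :: "real \<times> (real^'n) \<Rightarrow> bool"
  assumes "AE z in lborel. P z"
  shows "AE t in lborel. AE y in lborel. P (t, y)"
proof (rule lborel_pair.AE_pair)
  show "AE z in lborel \<Otimes>\<^sub>M lborel. P z" using assms by (simp only: lborel_prod)
qed

lemma AE_lborel_fst:
  assumes "AE t in lborel. P t"
  shows "AE z in (lborel :: (real \<times> (real^'n)) measure). P (fst z)"
proof -
  obtain N where N: "{t \<in> space lborel. \<not> P t} \<subseteq> N" "N \<in> sets lborel" "emeasure lborel N = 0"
    using assms by (rule AE_E)
  have [measurable]: "N \<in> sets borel" using N by simp
  have "AE t in lborel. t \<notin> N" using N by (intro AE_not_in) auto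
  then have "AE t in lborel. AE y in (lborel :: (real^'n) measure). fst (t, y) \<notin> N"
    by eventually_elim simp
  then have "AE z in (lborel \<Otimes>\<^sub>M (lborel :: (real^'n) measure)). fst z \<notin> N"
    by (intro lborel_pair.AE_pair_measure) measurable
  then have "AE z in (lborel :: (real \<times> (real^'n)) measure). fst z \<notin> N" by (simp only: lborel_prod)
  then show ?thesis by eventually_elim (use N(1) in auto)
qed

text \<open>The supremum in the definition is the supremum of a sequence, so only countably many
  null sets are collected.\<close>

lemma ess_inf_on_le_AE: "AE y in lebesgue_on A. ess_inf_on A g \<le> ereal (g y)"
proof -
  let ?S = "{z. AE y in lebesgue_on A. z \<le> ereal (g y)}"
  have "- \<infinity> \<in> ?S" by simp
  then have "?S \<noteq> {}" by blast
  from Sup_countable_SUP[OF this] obtain f :: "nat \<Rightarrow> ereal" where f: "range f \<subseteq> ?S" "Sup ?S = (SUP i. f i)"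
    by (metis (no_types, lifting))
  have "AE y in lebesgue_on A. \<forall>i. f i \<le> ereal (g y)"
    using f(1) by (subst AE_all_countable) auto
  then show ?thesis unfolding ess_inf_on_def f(2) by eventually_elim (auto intro: SUP_least)
qed

text \<open>This turns an inequality valid for each vector almost everywhere into one valid almost
  everywhere for all vectors: it is checked on a countable dense set and extended by
  continuity.\<close>

lemma countable_dense_le:
  fixes f g :: "'a::topological_space \<Rightarrow> real"
  assumes D: "\<And>U. open U \<Longrightarrow> U \<noteq> {} \<Longrightarrow> \<exists>d\<in>D. d \<in> U" and c: "continuous_on UNIV f" "continuous_on UNIV g" and U: "open U"
    and le: "\<And>d. d \<in> D \<Longrightarrow> d \<in> U \<Longrightarrow> f d \<le> g d" and x: "x \<in> U"
  shows "f x \<le> g x"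
proof (rule ccontr)
  assume "\<not> f x \<le> g x"
  then have "x \<in> U \<inter> {x. g x < f x}" using x by simp
  moreover have "open (U \<inter> {x. g x < f x})" using U c by (intro open_Int open_Collect_less)
  ultimately obtain d where "d \<in> D" "d \<in> U" "g d < f d" using D[of "U \<inter> {x. g x < f x}"] by blast
  then show False using le[of d] by simp
qed

text \<open>Those clauses of \<open>N_function\<close> that hold at every point rather than almost
  everywhere, so that using them costs no null set.\<close>

definition convex_family :: "(real \<Rightarrow> (real^'n) set \<Rightarrow> (real \<Rightarrow> real^'n \<Rightarrow> real^'n \<Rightarrow> real) \<Rightarrow> bool)" where
  "convex_family T \<Omega> M \<longleftrightarrow> (\<forall>t\<in>{0..T}. \<forall>x\<in>\<Omega>. M t x 0 = 0 \<and> (\<forall>\<xi>. M t x (-\<xi>) = M t x \<xi>) \<and> convex_on UNIV (M t x))"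

lemma convex_familyD:
  assumes "convex_family T \<Omega> M" "t \<in> {0..T}" "x \<in> \<Omega>"
  shows "convex_on UNIV (M t x)" "\<And>\<xi>. M t x (-\<xi>) = M t x \<xi>" "M t x 0 = 0"
  using assms by (auto simp: convex_family_def)

text \<open>The order of quantifiers is the point: one null set serves all minorants
  \<open>h\<close>, of which there are uncountably many. It suffices to have \<open>M_IQ\<close>
  below \<open>M\<close> on a countable dense set of vectors, because \<open>h\<close> and
  \<open>M t x\<close> are finite convex functions and hence continuous.\<close>

lemma M_IQ_convex_minorants_AE:
  fixes \<Omega> :: "(real^'n) set"
  assumes M: "convex_family T \<Omega> M" and \<Omega>: "open \<Omega>" and I: "I \<in> sets borel" and Q: "Q \<in> sets borel"
  shows "AE z in lborel. z \<in> (I \<inter> {0..T}) \<times> (Q \<inter> \<Omega>) \<longrightarrow>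
    (\<forall>h. convex_on UNIV h \<and> (\<forall>\<eta>. ereal (h \<eta>) \<le> M_IQ T \<Omega> M I Q \<eta>) \<longrightarrow> (\<forall>\<xi>. h \<xi> \<le> M (fst z) (snd z) \<xi>))"
proof -
  let ?A = "(I \<inter> {0..T}) \<times> (Q \<inter> \<Omega>)"
  have A: "?A \<in> sets borel" using I Q \<Omega> by (intro borel_Times) auto
  obtain D :: "(real^'n) set" where D: "countable D" "\<And>U. open U \<Longrightarrow> U \<noteq> {} \<Longrightarrow> \<exists>d\<in>D. d \<in> U"
    using countable_dense_setE by blast
  have "AE z in lebesgue_on ?A. M_IQ T \<Omega> M I Q \<xi> \<le> ereal (M (fst z) (snd z) \<xi>)" for \<xi>
    unfolding M_IQ_def by (rule ess_inf_on_le_AE)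
  then have "AE z in lebesgue_on ?A. \<forall>\<xi>\<in>D. M_IQ T \<Omega> M I Q \<xi> \<le> ereal (M (fst z) (snd z) \<xi>)"
    by (simp add: AE_ball_countable[OF D(1)])
  then have "AE z in lborel. z \<in> ?A \<longrightarrow> (\<forall>\<xi>\<in>D. M_IQ T \<Omega> M I Q \<xi> \<le> ereal (M (fst z) (snd z) \<xi>))"
    using AE_lebesgue_on_iff[OF A] by simp
  then show ?thesis
  proof eventually_elim
    case (elim z)
    show ?case
    proof (intro impI allI)
      fix h \<xi> assume z: "z \<in> ?A" and h: "convex_on UNIV h \<and> (\<forall>\<eta>. ereal (h \<eta>) \<le> M_IQ T \<Omega> M I Q \<eta>)"
      have cM: "continuous_on UNIV (M (fst z) (snd z))"
        using convex_familyD[OF M, of "fst z" "snd z"] z by (intro convex_on_continuous) auto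
      have ch: "continuous_on UNIV h" using h by (intro convex_on_continuous) auto
      show "h \<xi> \<le> M (fst z) (snd z) \<xi>"
      proof (rule countable_dense_le[OF D(2) ch cM open_UNIV])
        fix d assume "d \<in> D"
        then have "ereal (h d) \<le> ereal (M (fst z) (snd z) d)" using elim z h by (meson order_trans)
        then show "h d \<le> M (fst z) (snd z) d" by simp
      qed auto
    qed
  qed
qed

text \<open>The inequality is applied on countably many intervals and cubes of size comparable to \<open>\<delta>\<close>, so that a
  single null set serves all convex minorants and all arguments at once.\<close>

lemma mollified_modular_bound:
  fixes \<Omega> :: "(real^'n) set" and F :: "real \<times> (real^'n) \<Rightarrow> real^'n"
  assumes M: "convex_family T \<Omega> M" and \<Omega>: "open \<Omega>" and ineq: "M_ineq T \<Omega> M \<Theta> \<xi>0 \<delta>0" and \<Theta>: "Theta_ok \<Theta>"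
    and \<delta>: "0 < \<delta>" "\<delta> < \<delta>0" and K: "mollifier B r K" and r: "r + norm v \<le> \<delta>" and C: "\<Theta> \<delta> s \<le> C"
    and F: "\<And>t. integrable lborel (\<lambda>y. F (t, y))" and m: "\<And>t. integrable lborel (\<lambda>y. m (t, y))" "\<And>z. 0 \<le> m z"
    and Fm: "AE z in lborel. z \<in> {0<..<T} \<times> \<Omega> \<longrightarrow> M (fst z) (snd z) (F z) \<le> m z"
    and F0: "\<And>z. z \<notin> {0<..<T} \<times> \<Omega> \<Longrightarrow> F z = 0"
    and s: "\<And>z. norm (shift_mollify K v F z) \<le> s"
  shows "AE z in lborel. z \<in> {0<..<T} \<times> \<Omega> \<longrightarrow> norm \<xi>0 < norm (shift_mollify K v F z) \<longrightarrow>
     M (fst z) (snd z) (shift_mollify K v F z) \<le> C * shift_mollify K v m z"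
proof -
  let ?N = "real CARD('n)"
  obtain D :: "(real \<times> (real^'n)) set" where D: "countable D" "\<And>U. open U \<Longrightarrow> U \<noteq> {} \<Longrightarrow> \<exists>d\<in>D. d \<in> U"
    using countable_dense_setE by blast
  \<comment> \<open>Intervals of length \<open>2 * \<delta> / 3\<close> and cubes of side
    \<open>3 * \<delta>\<close> satisfy the strict inequalities of the condition. If the centre is
    within \<open>\<delta>/4\<close> of \<open>z\<close>, the cylinder contains \<open>z\<close>
    and, at the time of \<open>z\<close>, the support of the shifted kernel, since
    \<open>\<delta> + \<delta>/4 \<le> 3 * \<delta> / 2\<close>.\<close>
  define I where "I c = {fst c - \<delta>/3 .. fst c + \<delta>/3}" for c :: "real \<times> (real^'n)"
  define Q where "Q c = cbox (snd c - (3*\<delta>/2) *\<^sub>R One) (snd c - (3*\<delta>/2) *\<^sub>R One + (3*\<delta>) *\<^sub>R One)" for c :: "real \<times> (real^'n)"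
  have Qmem: "y \<in> Q c \<longleftrightarrow> (\<forall>i. \<bar>y $ i - snd c $ i\<bar> \<le> 3*\<delta>/2)" for y c
  proof -
    have "snd c $ i - 3*\<delta>/2 \<le> y $ i \<and> y $ i \<le> snd c $ i - 3*\<delta>/2 + 3*\<delta> \<longleftrightarrow> \<bar>y $ i - snd c $ i\<bar> \<le> 3*\<delta>/2" for i
      by linarith
    then show ?thesis unfolding Q_def mem_box_cart by simp
  qed
  have nOne: "norm (One :: real^'n) = sqrt ?N"
    by (simp add: norm_vec_def L2_set_def)
  have diam: "diameter (Q c) < 4 * \<delta> * sqrt ?N" for c
  proof -
    let ?a = "snd c - (3*\<delta>/2) *\<^sub>R One"
    have "diameter (Q c) \<le> 3 * \<delta> * sqrt ?N"
      unfolding Q_def using \<delta>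
      by (subst diameter_cbox) (auto simp: dist_norm inner_add_left nOne mult_nonneg_nonneg inner_sum_left inner_Basis)
    moreover have "3 * \<delta> * sqrt ?N < 4 * \<delta> * sqrt ?N" using \<delta> by (intro mult_strict_right_mono) auto
    ultimately show ?thesis by linarith
  qed
  have Ib: "I c \<in> sets borel" "Q c \<in> sets borel" for c by (auto simp: I_def Q_def)
  have Ab: "(I c \<inter> {0..T}) \<times> (Q c \<inter> \<Omega>) \<in> sets borel" for c using \<Omega> Ib[of c] by (intro borel_Times) auto
  have A1: "AE z in lborel. z \<in> (I c \<inter> {0..T}) \<times> (Q c \<inter> \<Omega>) \<longrightarrow>
     (\<forall>\<xi>. norm \<xi> > norm \<xi>0 \<longrightarrow> ereal (M (fst z) (snd z) \<xi>) \<le> ereal (\<Theta> \<delta> (norm \<xi>)) * convex_minorant (M_IQ T \<Omega> M (I c) (Q c)) \<xi>)" for c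
  proof -
    have "is_cube (Q c)" unfolding is_cube_def Q_def using \<delta> by (intro exI[of _ "snd c - (3*\<delta>/2) *\<^sub>R One"] exI[of _ "3*\<delta>"]) auto
    then have "AE z in lebesgue_on ((I c \<inter> {0..T}) \<times> (Q c \<inter> \<Omega>)).
           \<forall>\<xi>. norm \<xi> > norm \<xi>0 \<longrightarrow>
             ereal (M (fst z) (snd z) \<xi>) \<le> ereal (\<Theta> \<delta> (norm \<xi>)) * convex_minorant (M_IQ T \<Omega> M (I c) (Q c)) \<xi>"
      using ineq diam[of c] \<delta> unfolding M_ineq_def I_def by simp
    then show ?thesis using AE_lebesgue_on_iff[OF Ab] by simp
  qed
  have A1': "AE z in lborel. \<forall>c\<in>D. z \<in> (I c \<inter> {0..T}) \<times> (Q c \<inter> \<Omega>) \<longrightarrow>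
     (\<forall>\<xi>. norm \<xi> > norm \<xi>0 \<longrightarrow> ereal (M (fst z) (snd z) \<xi>) \<le> ereal (\<Theta> \<delta> (norm \<xi>)) * convex_minorant (M_IQ T \<Omega> M (I c) (Q c)) \<xi>)"
    unfolding AE_ball_countable[OF D(1)] by (intro ballI A1)
  define G where "G c z \<longleftrightarrow> (z \<in> (I c \<inter> {0..T}) \<times> (Q c \<inter> \<Omega>) \<longrightarrow>
    (\<forall>h. convex_on UNIV h \<and> (\<forall>\<eta>. ereal (h \<eta>) \<le> M_IQ T \<Omega> M (I c) (Q c) \<eta>) \<longrightarrow> (\<forall>\<xi>. h \<xi> \<le> M (fst z) (snd z) \<xi>)))" for c z
  have "AE z in lborel. \<forall>c\<in>D. G c z"
    unfolding AE_ball_countable[OF D(1)] G_def by (intro ballI M_IQ_convex_minorants_AE[OF M \<Omega> Ib])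
  then have "AE z in lborel. (\<forall>c\<in>D. G c z) \<and> (z \<in> {0<..<T} \<times> \<Omega> \<longrightarrow> M (fst z) (snd z) (F z) \<le> m z)"
    using Fm by eventually_elim blast
  \<comment> \<open>Jensen's inequality at \<open>z\<close> involves the points y at the same time;
    hence the passage to almost every time section, read again as a property of almost every
    \<open>z\<close>.\<close>
  from AE_lborel_fst[OF AE_lborel_sections[OF this]]
  have A2: "AE z in (lborel :: (real \<times> (real^'n)) measure). AE y in lborel. (\<forall>c\<in>D. G c (fst z, y)) \<and> ((fst z, y) \<in> {0<..<T} \<times> \<Omega> \<longrightarrow> M (fst z) y (F (fst z, y)) \<le> m (fst z, y))"
    by simp
  show ?thesis
    using A1' A2
  proof eventually_elim
    case (elim z)
    show ?case
    proof (intro impI)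
      assume z: "z \<in> {0<..<T} \<times> \<Omega>" and big: "norm \<xi>0 < norm (shift_mollify K v F z)"
      obtain t x where tx: "z = (t, x)" by (cases z)
      let ?\<xi> = "shift_mollify K v F z"
      have x: "x \<in> \<Omega>" and t: "t \<in> {0<..<T}" using z tx by auto
      obtain c where c: "c \<in> D" "dist z c < \<delta>/4"
        using D(2)[of "ball z (\<delta>/4)"] \<delta> by (auto simp: ball_eq_empty)
      have ct: "\<bar>t - fst c\<bar> < \<delta>/4" using c(2) dist_fst_le[of z c] by (simp add: tx dist_real_def)
      have cx: "norm (x - snd c) < \<delta>/4" using c(2) dist_snd_le[of z c] by (simp add: tx dist_norm)
      have "fst c - \<delta>/3 \<le> t" "t \<le> fst c + \<delta>/3" using ct \<delta> by linarith+
      then have tI: "t \<in> I c \<inter> {0..T}" using t by (simp add: I_def)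
      have nearQ: "y \<in> Q c" if "norm (x + v - y) \<le> r \<or> norm (x - y) < \<delta>" for y
        unfolding Qmem
      proof
        fix i
        have "norm (y - x) \<le> \<delta>"
        proof -
          have "y - x = v - (x + v - y)" by simp
          then have "norm (y - x) \<le> norm v + norm (x + v - y)" by (metis norm_triangle_ineq4)
          then show ?thesis using that r norm_minus_commute[of x y] by linarith
        qed
        then have "norm (y - snd c) \<le> \<delta> + \<delta>/4" using cx norm_triangle_ineq[of "y - x" "x - snd c"] by simp
        then show "\<bar>y $ i - snd c $ i\<bar> \<le> 3*\<delta>/2" using component_le_norm_cart[of "y - snd c" i] \<delta> by simp
      qed
      have xQ: "x \<in> Q c" using nearQ[of x] \<delta> by simp
      have ae: "AE y in lborel. G c (t, y) \<and> ((t, y) \<in> {0<..<T} \<times> \<Omega> \<longrightarrow> M t y (F (t, y)) \<le> m (t, y))"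
        using elim(2) by eventually_elim (use c tx in auto)
      have hle: "h ?\<xi> \<le> shift_mollify K v m z" if h: "convex_on UNIV h \<and> (\<forall>\<eta>. ereal (h \<eta>) \<le> M_IQ T \<Omega> M (I c) (Q c) \<eta>)" for h
      proof -
        \<comment> \<open>Outside \<open>\<Omega>\<close> the field is 0 and \<open>M\<close> gives
          no information, so the value of the minorant at 0 is needed. It is at most
          \<open>M t y 0 = 0\<close> at any good point y of \<open>\<Omega>\<close> near
          \<open>x\<close>, and such points exist because a ball is not a null set.\<close>
        have h0: "h 0 \<le> 0"
        proof (rule ccontr)
          assume "\<not> h 0 \<le> 0"
          obtain \<rho> where \<rho>: "\<rho> > 0" "ball x \<rho> \<subseteq> \<Omega>" using \<Omega> x by (rule openE)
          define \<rho>' where "\<rho>' = min \<rho> \<delta>"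
          have "AE y in lborel. y \<notin> ball x \<rho>'"
            using ae
          proof eventually_elim
            case (elim y)
            show ?case
            proof
              assume y: "y \<in> ball x \<rho>'"
              then have "y \<in> \<Omega>" "y \<in> Q c" using \<rho> nearQ[of y] by (auto simp: \<rho>'_def dist_norm)
              then have "h 0 \<le> M t y 0" using elim h tI unfolding G_def by auto
              then show False using \<open>\<not> h 0 \<le> 0\<close> convex_familyD(3)[OF M, of t y] \<open>y \<in> \<Omega>\<close> tI by simp
            qed
          qed
          then have "emeasure lborel (ball x \<rho>') = 0" by (subst (asm) AE_iff_measurable[OF _ refl]) (auto simp: ball_def)
          moreover have "0 < \<rho>'" using \<rho> \<delta> by (simp add: \<rho>'_def)
          ultimately show False using content_ball_pos[of \<rho>' x] by (simp add: measure_def)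
        qed
        have "h (conv K (\<lambda>y. F (t, y)) (x + v)) \<le> conv K (\<lambda>y. m (t, y)) (x + v)"
        proof (rule jensen_conv[OF K conjunct1[OF h] F m(1)])
          show "AE y in lborel. norm (x + v - y) \<le> r \<longrightarrow> h (F (t, y)) \<le> m (t, y)"
            using ae
          proof eventually_elim
            case (elim y)
            show ?case
            proof
              assume y: "norm (x + v - y) \<le> r"
              show "h (F (t, y)) \<le> m (t, y)"
              proof (cases "y \<in> \<Omega>")
                case True
                then have "h (F (t, y)) \<le> M t y (F (t, y))" using elim h tI nearQ[of y] y unfolding G_def by auto
                then show ?thesis using elim True t by auto
              next
                case False
                then show ?thesis using F0[of "(t, y)"] h0 m(2)[of "(t, y)"] by simp
              qed
            qed
          qed
        qed
        then show ?thesis by (simp add: shift_mollify_def tx)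
      qed
      have Sm: "0 \<le> shift_mollify K v m z"
        unfolding shift_mollify_def by (rule conv_mono_bound(1)[OF K m(1)]) (rule m(2))
      \<comment> \<open>Jensen's inequality holds for each minorant with the same right-hand side,
        so it passes to their supremum.\<close>
      have cm: "convex_minorant (M_IQ T \<Omega> M (I c) (Q c)) ?\<xi> \<le> ereal (shift_mollify K v m z)"
        unfolding convex_minorant_def by (rule Sup_least) (use hle in auto)
      have d1: "0 \<le> \<delta>" "\<delta> \<le> 1" using \<delta> ineq by (auto simp: M_ineq_def)
      have \<Theta>0: "0 \<le> \<Theta> \<delta> (norm ?\<xi>)" using \<Theta> d1 by (simp add: Theta_ok_def)
      have \<Theta>C: "\<Theta> \<delta> (norm ?\<xi>) \<le> C" using \<Theta> d1 s[of z] C unfolding Theta_ok_def by (meson norm_ge_zero order_trans)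
      have "ereal (M t x ?\<xi>) \<le> ereal (\<Theta> \<delta> (norm ?\<xi>)) * convex_minorant (M_IQ T \<Omega> M (I c) (Q c)) ?\<xi>"
        using elim(1) c(1) tI xQ x big tx by auto
      also have "\<dots> \<le> ereal (\<Theta> \<delta> (norm ?\<xi>)) * ereal (shift_mollify K v m z)"
        using \<Theta>0 by (intro ereal_mult_left_mono cm) simp
      finally have "M t x ?\<xi> \<le> \<Theta> \<delta> (norm ?\<xi>) * shift_mollify K v m z" by simp
      also have "\<dots> \<le> C * shift_mollify K v m z" using \<Theta>C Sm by (rule mult_right_mono)
      finally show "M (fst z) (snd z) ?\<xi> \<le> C * shift_mollify K v m z" by (simp add: tx)
    qed
  qed
qed

subsection \<open>Truncated mollifications\<close>

lemma borel_measurable_lebesgue_on: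
  assumes "f \<in> borel_measurable borel" shows "f \<in> borel_measurable (lebesgue_on S)"
  using assms by (intro measurable_restrict_space1 measurable_completion) simp

lemma shift_mollify_eq_0:
  assumes K: "mollifier B e K" and f: "\<And>y. norm (snd z + v - y) \<le> e \<Longrightarrow> f (fst z, y) = 0"
  shows "shift_mollify K v f z = 0"
proof -
  have "(\<lambda>y. K (snd z + v - y) *\<^sub>R f (fst z, y)) = (\<lambda>y. 0)"
  proof
    fix y show "K (snd z + v - y) *\<^sub>R f (fst z, y) = 0"
      using f[of y] mollifierD(3)[OF K, of "snd z + v - y"] by (cases "norm (snd z + v - y) \<le> e") auto
  qed
  then show ?thesis by (simp add: shift_mollify_def conv_def)
qed

lemma norm_shift_mollify_le:
  fixes F :: "real \<times> (real^'n) \<Rightarrow> 'b::{banach,second_countable_topology}"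
  assumes K: "mollifier B e K" and F: "integrable lborel (\<lambda>y. F (fst z, y))" and b: "AE y in lborel. norm (F (fst z, y)) \<le> b"
  shows "norm (shift_mollify K v F z) \<le> b"
proof -
  have i: "integrable lborel (\<lambda>y. K (snd z + v - y) *\<^sub>R F (fst z, y))" by (rule integrable_mollifier_mult[OF K F])
  have "norm (shift_mollify K v F z) \<le> (\<integral>y. norm (K (snd z + v - y) *\<^sub>R F (fst z, y)) \<partial>lborel)"
    unfolding shift_mollify_def conv_def by (rule integral_norm_bound)
  also have "\<dots> \<le> (\<integral>y. K (snd z + v - y) * b \<partial>lborel)"
  proof (rule integral_mono_AE)
    show "AE y in lborel. norm (K (snd z + v - y) *\<^sub>R F (fst z, y)) \<le> K (snd z + v - y) * b"
      using b by eventually_elim (simp add: mollifierD(2)[OF K] mult_left_mono)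
  qed (use integrable_norm[OF i] integrable_mollifier_shift(1)[OF K] in \<open>simp_all del: norm_scaleR\<close>)
  also have "\<dots> = b" using integrable_mollifier_shift[OF K] by simp
  finally show ?thesis .
qed

text \<open>For fixed positive \<open>l\<close> this approximates \<open>l * sin (f / l)\<close>,
  not \<open>f\<close> itself. The truncation has values between -l and l, is 1-Lipschitz, and tends
  to the identity as \<open>l\<close> grows; that limit is taken separately.\<close>

definition approximant :: "nat \<Rightarrow> (nat \<Rightarrow> real^'n \<Rightarrow> real) \<Rightarrow> (nat \<Rightarrow> real^'n) \<Rightarrow> (real^'n \<Rightarrow> real) \<Rightarrow> real \<Rightarrow> (real \<times> (real^'n) \<Rightarrow> real) \<Rightarrow> real \<Rightarrow> real^'n \<Rightarrow> real" where
  "approximant k \<theta> v K l f t x = (\<Sum>i<k. \<theta> i x * (l * sin (shift_mollify K (v i) f (t, x) / l)))"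

text \<open>The product and chain rules, written with the mollified weak gradient \<open>g\<close>.
  As the scale vanishes, the second sum disappears on \<open>\<Omega>\<close>, because the partition
  functions have a constant sum there. Being an explicit expression in Borel functions, it also
  settles measurability.\<close>

definition approximant_grad :: "nat \<Rightarrow> (nat \<Rightarrow> real^'n \<Rightarrow> real) \<Rightarrow> (nat \<Rightarrow> real^'n) \<Rightarrow> (real^'n \<Rightarrow> real) \<Rightarrow> real \<Rightarrow> (real \<times> (real^'n) \<Rightarrow> real) \<Rightarrow> (real \<times> (real^'n) \<Rightarrow> real^'n) \<Rightarrow> real \<times> (real^'n) \<Rightarrow> real^'n" where
  "approximant_grad k \<theta> v K l f g z =
     (\<Sum>i<k. (\<theta> i (snd z) * cos (shift_mollify K (v i) f z / l)) *\<^sub>R shift_mollify K (v i) g z) +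
     (\<Sum>i<k. (l * sin (shift_mollify K (v i) f z / l)) *\<^sub>R grad (\<theta> i) (snd z))"

lemma cb_smooth_approximant:
  assumes \<theta>: "\<And>i. i < k \<Longrightarrow> cb_smooth (\<lambda>_::unit. \<theta> i)" and K: "mollifier B e K"
    and f: "\<And>t. integrable lborel (\<lambda>y. f (t, y))" and C: "\<And>t. (\<integral>y. \<bar>f (t, y)\<bar> \<partial>lborel) \<le> C"
  shows "cb_smooth (approximant k \<theta> v K l f)"
proof -
  have s: "cb_smooth (\<lambda>t x. shift_mollify K (v i) f (t, x) * (1/l))" for i
    unfolding shift_mollify_def fst_conv snd_conv
    by (rule cb_smooth_mult[OF cb_smooth_conv[OF mollifierD(1)[OF K] f C] cb_smooth_const])
  have "cb_smooth (\<lambda>t x. \<theta> i x * (l * sin (shift_mollify K (v i) f (t, x) * (1/l))))" if "i < k" for i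
    by (rule cb_smooth_mult[OF cb_smooth_reindex[OF \<theta>[OF that]]
        cb_smooth_mult[OF cb_smooth_const cb_smooth_sin[OF s[of i]]]])
  then have "cb_smooth (\<lambda>t x. \<Sum>i<k. \<theta> i x * (l * sin (shift_mollify K (v i) f (t, x) * (1/l))))"
    by (intro cb_smooth_sum) simp_all
  then show ?thesis by (simp add: approximant_def[abs_def])
qed

text \<open>The assumption \<open>fg\<close> is the weak gradient property in the form in which it
  enters here, after mollification; everything else is the classical calculus of smooth
  functions.\<close>

lemma grad_approximant:
  assumes \<theta>: "\<And>i. i < k \<Longrightarrow> cb_smooth (\<lambda>_::unit. \<theta> i)" and K: "mollifier B e K" and l: "l \<noteq> 0"
    and f: "integrable lborel (\<lambda>y. f (t, y))"
    and fg: "\<And>i x. conv (partial_deriv i K) (\<lambda>y. f (t, y)) x = conv K (\<lambda>y. g (t, y)) x $ i"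
  shows "grad (approximant k \<theta> v K l f t) x = approximant_grad k \<theta> v K l f g (t, x)"
proof -
  define S where "S i x = conv K (\<lambda>y. f (t, y)) (x + v i)" for i x
  have Sd: "S i differentiable (at x)" for i
    unfolding S_def[abs_def] by (rule conv_differentiable(1)[OF mollifierD(1)[OF K] f])
  have Sp: "partial_deriv j (S i) x = conv K (\<lambda>y. g (t, y)) (x + v i) $ j" for i j
    unfolding S_def[abs_def] using conv_differentiable(2)[OF mollifierD(1)[OF K] f] fg by simp
  have td: "\<theta> i differentiable (at x)" if "i < k" for i using cb_smoothD(2)[OF \<theta>[OF that]] .
  have sd: "((\<lambda>s. l * sin (s / l)) has_real_derivative cos (s / l)) (at s)" for s
    using l by (auto intro!: derivative_eq_intros)
  have d1: "(\<lambda>x. l * sin (S i x / l)) differentiable (at x)" for i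
    by (rule differentiable_compose_real[OF sd Sd])
  have p1: "partial_deriv j (\<lambda>x. l * sin (S i x / l)) x = cos (S i x / l) * partial_deriv j (S i) x" for i j
    by (rule partial_deriv_compose[OF sd Sd])
  have "partial_deriv j (approximant k \<theta> v K l f t) x = approximant_grad k \<theta> v K l f g (t, x) $ j" for j
  proof -
    have "approximant k \<theta> v K l f t = (\<lambda>x. \<Sum>i<k. \<theta> i x * (l * sin (S i x / l)))"
      by (simp add: approximant_def[abs_def] S_def shift_mollify_def)
    then have "partial_deriv j (approximant k \<theta> v K l f t) x = (\<Sum>i<k. partial_deriv j (\<lambda>x. \<theta> i x * (l * sin (S i x / l))) x)"
      by (simp only:) (rule partial_deriv_sum, use td d1 in \<open>auto intro!: differentiable_mult\<close>)
    also have "\<dots> = (\<Sum>i<k. \<theta> i x * (cos (S i x / l) * partial_deriv j (S i) x) + partial_deriv j (\<theta> i) x * (l * sin (S i x / l)))"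
      using td d1 by (intro sum.cong refl) (simp add: partial_deriv_mult p1)
    also have "\<dots> = approximant_grad k \<theta> v K l f g (t, x) $ j"
      by (simp add: approximant_grad_def shift_mollify_def Sp grad_def S_def[symmetric] sum.distrib mult_ac)
    finally show ?thesis .
  qed
  then show ?thesis by (simp add: grad_def vec_eq_iff)
qed

lemma abs_l_sin_le: "\<bar>l * sin (a / l) - l * sin (b / l)\<bar> \<le> \<bar>a - b\<bar>" if l: "0 < (l::real)"
proof -
  have "\<bar>sin (a / l) - sin (b / l)\<bar> \<le> \<bar>a / l - b / l\<bar>"
  proof -
    have "norm (sin (a / l) - sin (b / l)) \<le> 1 * norm (a / l - b / l)"
      by (rule field_differentiable_bound[of UNIV sin cos]) (auto intro: DERIV_sin)
    then show ?thesis by simp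
  qed
  then have "l * \<bar>sin (a / l) - sin (b / l)\<bar> \<le> l * \<bar>a / l - b / l\<bar>" using l by simp
  then have "\<bar>l * (sin (a / l) - sin (b / l))\<bar> \<le> \<bar>l * (a / l - b / l)\<bar>" using l by (simp only: abs_mult abs_of_pos)
  then show ?thesis using l by (simp add: right_diff_distrib)
qed

lemma abs_l_sin_le': "\<bar>l * sin (a / l)\<bar> \<le> \<bar>a\<bar>" "\<bar>l * sin (a / l)\<bar> \<le> l" if l: "0 < (l::real)"
  using abs_l_sin_le[OF l, of a 0] l by (auto simp: abs_mult mult_left_le)

text \<open>Let \<open>\<theta> i x\<close> be nonzero. If x is closer than \<open>e\<close> to a
  point \<open>w\<close> of the complement, each y in the ball of radius \<open>e\<close> about
  \<open>x + e *\<^sub>R a i\<close> equals \<open>w + e *\<^sub>R a i + z\<close> with z of norm at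
  most \<open>2 * e\<close>; hence y is outside \<open>\<Omega>\<close>, where \<open>f\<close> is
  0. So all supports lie in the set of points at distance at least \<open>e\<close> from the
  complement, which is compact and the same for all times.\<close>

lemma approximant_in_Linf_Cc:
  fixes \<Omega> :: "(real^'n) set"
  assumes \<Omega>: "open \<Omega>" "bounded \<Omega>" and \<theta>: "\<And>i. i < k \<Longrightarrow> cb_smooth (\<lambda>_::unit. \<theta> i)" and K: "mollifier B e K" and e: "0 < e" "e < r0"
    and tr: "\<And>i x w e z. i < k \<Longrightarrow> \<theta> i x \<noteq> 0 \<Longrightarrow> w \<notin> \<Omega> \<Longrightarrow> dist x w < r0 \<Longrightarrow> 0 < e \<Longrightarrow> e < r0 \<Longrightarrow> norm z \<le> 2 * e \<Longrightarrow>
       w + e *\<^sub>R a i + z \<notin> \<Omega>"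
    and f[measurable]: "f \<in> borel_measurable borel" and ft: "\<And>t. integrable lborel (\<lambda>y. f (t, y))" and C: "\<And>t. (\<integral>y. \<bar>f (t, y)\<bar> \<partial>lborel) \<le> C"
    and f0: "\<And>t y. y \<notin> \<Omega> \<Longrightarrow> f (t, y) = 0"
  shows "in_Linf_Cc T \<Omega> (approximant k \<theta> (\<lambda>i. e *\<^sub>R a i) K l f)"
proof -
  let ?\<Phi> = "approximant k \<theta> (\<lambda>i. e *\<^sub>R a i) K l f"
  have sm: "cb_smooth ?\<Phi>" by (rule cb_smooth_approximant[OF \<theta> K ft C])
  note [measurable] = mollifierD(7)[OF K]
  have [measurable]: "i < k \<Longrightarrow> \<theta> i \<in> borel_measurable borel" for i using cb_smooth_facts(2)[OF \<theta>] .
  have "(\<lambda>z. ?\<Phi> (fst z) (snd z)) \<in> borel_measurable borel"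
    unfolding approximant_def by (intro borel_measurable_sum) measurable
  then have meas: "(\<lambda>z. ?\<Phi> (fst z) (snd z)) \<in> borel_measurable (lebesgue_on ({0<..<T} \<times> \<Omega>))"
    by (rule borel_measurable_lebesgue_on)
  define C' where "C' = {x. \<forall>w. w \<notin> \<Omega> \<longrightarrow> e \<le> dist x w}"
  have C'\<Omega>: "C' \<subseteq> \<Omega>" using e by (force simp: C'_def)
  have "closed C'"
  proof -
    have "C' = (\<Inter>w\<in>-\<Omega>. {x. e \<le> dist x w})" by (auto simp: C'_def)
    moreover have "closed {x. e \<le> dist x w}" for w :: "real^'n" by (intro closed_Collect_le continuous_intros)
    ultimately show ?thesis by (simp add: closed_INT)
  qed
  moreover have "bounded C'" using bounded_subset[OF \<Omega>(2) C'\<Omega>] .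
  ultimately have C'c: "compact C'" by (simp add: compact_eq_bounded_closed)
  have supp: "x \<in> C'" if nz: "?\<Phi> t x \<noteq> 0" for t x
  proof (rule ccontr)
    assume "x \<notin> C'"
    then obtain w where w: "w \<notin> \<Omega>" "dist x w < e" by (auto simp: C'_def not_le)
    have "\<theta> i x * (l * sin (shift_mollify K (e *\<^sub>R a i) f (t, x) / l)) = 0" if i: "i < k" for i
    proof (cases "\<theta> i x = 0")
      case False
      have "shift_mollify K (e *\<^sub>R a i) f (t, x) = 0"
      proof (rule shift_mollify_eq_0[OF K])
        fix y assume y: "norm (snd (t, x) + e *\<^sub>R a i - y) \<le> e"
        define z where "z = (x - w) - (x + e *\<^sub>R a i - y)"
        have "norm z \<le> norm (x - w) + norm (x + e *\<^sub>R a i - y)" unfolding z_def by (rule norm_triangle_ineq4)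
        then have "norm z \<le> 2 * e" using y w(2) by (simp add: dist_norm)
        then have "w + e *\<^sub>R a i + z \<notin> \<Omega>" using tr[OF i False w(1) _ e] w(2) e by simp
        then have "y \<notin> \<Omega>" by (simp add: z_def)
        then show "f (fst (t, x), y) = 0" by (simp add: f0)
      qed
      then show ?thesis by simp
    qed simp
    then have "?\<Phi> t x = 0" unfolding approximant_def by (intro sum.neutral) simp
    then show False using nz by simp
  qed
  have cl: "closure {x. ?\<Phi> t x \<noteq> 0} \<subseteq> C'" for t
    using supp \<open>closed C'\<close> by (intro closure_minimal) auto
  have bd: "\<exists>D. AE t in lebesgue_on {0<..<T}. \<forall>x. \<bar>iter_pd is (?\<Phi> t) x\<bar> \<le> D" for "is"
  proof -
    obtain D where "\<And>t x. \<bar>iter_pd is (?\<Phi> t) x\<bar> \<le> D" using cb_smoothD(1)[OF cb_smooth_iter_pd[OF sm, of "is"]] by blast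
    then show ?thesis by (intro exI[of _ D]) auto
  qed
  show ?thesis unfolding in_Linf_Cc_def
    using meas C'c C'\<Omega> cl cb_smooth_imp_smooth_fun[OF sm] bd by (intro conjI exI[of _ C']) auto
qed

text \<open>Mollification, \<open>l * sin (s / l)\<close> and convex combination all preserve a
  bound \<open>b\<close>; this is where the constant 1 in the supremum estimate comes from.\<close>

lemma approximant_bound:
  assumes \<theta>0: "\<And>i. i < k \<Longrightarrow> 0 \<le> \<theta> i x" and s: "(\<Sum>i<k. \<theta> i x) = 1" and K: "mollifier B e K" and l: "0 < l"
    and ft: "integrable lborel (\<lambda>y. f (t, y))" and b: "AE y in lborel. \<bar>f (t, y)\<bar> \<le> b"
  shows "\<bar>approximant k \<theta> v K l f t x\<bar> \<le> b"
proof -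
  have "\<bar>shift_mollify K (v i) f (t, x)\<bar> \<le> b" for i
    using norm_shift_mollify_le[OF K, of f "(t, x)" b "v i"] ft b by simp
  then have "\<bar>l * sin (shift_mollify K (v i) f (t, x) / l)\<bar> \<le> b" for i
    using abs_l_sin_le'(1)[OF l] order_trans by blast
  then have "\<bar>\<theta> i x * (l * sin (shift_mollify K (v i) f (t, x) / l))\<bar> \<le> \<theta> i x * b" if "i < k" for i
    using \<theta>0[OF that] by (subst abs_mult) (simp add: mult_left_mono)
  then have "\<bar>approximant k \<theta> v K l f t x\<bar> \<le> (\<Sum>i<k. \<theta> i x * b)"
    unfolding approximant_def by (intro order_trans[OF sum_abs] sum_mono) auto
  then show ?thesis using s by (simp add: sum_distrib_right[symmetric])
qed

lemma approximant_diff: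
  assumes \<theta>0: "\<And>i. i < k \<Longrightarrow> 0 \<le> \<theta> i x" and s: "(\<Sum>i<k. \<theta> i x) = 1" and l: "0 < l"
  shows "\<bar>approximant k \<theta> v K l f t x - l * sin (f (t, x) / l)\<bar> \<le> (\<Sum>i<k. \<bar>shift_mollify K (v i) f (t, x) - f (t, x)\<bar>)"
proof -
  have le1: "\<theta> i x \<le> 1" if "i < k" for i
    using member_le_sum[of i "{..<k}" "\<lambda>i. \<theta> i x"] that \<theta>0 s by auto
  have "approximant k \<theta> v K l f t x - l * sin (f (t, x) / l)
    = (\<Sum>i<k. \<theta> i x * (l * sin (shift_mollify K (v i) f (t, x) / l))) - (\<Sum>i<k. \<theta> i x) * (l * sin (f (t, x) / l))"
    by (simp add: approximant_def s)
  also have "\<dots> = (\<Sum>i<k. \<theta> i x * (l * sin (shift_mollify K (v i) f (t, x) / l) - l * sin (f (t, x) / l)))"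
    by (simp add: sum_distrib_right right_diff_distrib sum_subtractf)
  finally have "\<bar>approximant k \<theta> v K l f t x - l * sin (f (t, x) / l)\<bar>
    \<le> (\<Sum>i<k. \<bar>\<theta> i x * (l * sin (shift_mollify K (v i) f (t, x) / l) - l * sin (f (t, x) / l))\<bar>)"
    by (simp only: sum_abs)
  also have "\<dots> \<le> (\<Sum>i<k. \<bar>shift_mollify K (v i) f (t, x) - f (t, x)\<bar>)"
  proof (rule sum_mono)
    fix i assume "i \<in> {..<k}"
    then have i: "i < k" by simp
    have "\<theta> i x * \<bar>l * sin (shift_mollify K (v i) f (t, x) / l) - l * sin (f (t, x) / l)\<bar> \<le> 1 * \<bar>shift_mollify K (v i) f (t, x) - f (t, x)\<bar>"
      using \<theta>0[OF i] le1[OF i] abs_l_sin_le[OF l] by (intro mult_mono) auto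
    then show "\<bar>\<theta> i x * (l * sin (shift_mollify K (v i) f (t, x) / l) - l * sin (f (t, x) / l))\<bar> \<le> \<bar>shift_mollify K (v i) f (t, x) - f (t, x)\<bar>"
      using \<theta>0[OF i] by (simp only: abs_mult abs_of_nonneg mult_1)
  qed
  finally show ?thesis .
qed

text \<open>A majorant of \<open>M\<close> on the ball of radius \<open>r\<close>, by the last of
  \<open>even_convex_facts\<close>. It involves \<open>M\<close> only at constant vectors and is
  therefore integrable when \<open>M\<close> is locally integrable.\<close>

definition modular_sup_bound :: "(real \<Rightarrow> real^'n \<Rightarrow> real^'n \<Rightarrow> real) \<Rightarrow> real \<Rightarrow> real \<times> (real^'n) \<Rightarrow> real" where
  "modular_sup_bound M r z = (\<Sum>i\<in>UNIV. M (fst z) (snd z) ((real CARD('n) * r) *\<^sub>R axis i 1))"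

section \<open>Modular estimates for mollified fields and for the approximant\<close>

lemma shift_mollify_add:
  fixes f g :: "real \<times> (real^'n) \<Rightarrow> 'b::{banach,second_countable_topology}"
  assumes K: "mollifier B e K" and "integrable lborel (\<lambda>y. f (fst z, y))" "integrable lborel (\<lambda>y. g (fst z, y))"
  shows "shift_mollify K v (\<lambda>z. f z + g z) z = shift_mollify K v f z + shift_mollify K v g z"
  unfolding shift_mollify_def conv_def scaleR_add_right
  by (rule Bochner_Integration.integral_add) (rule integrable_mollifier_mult[OF K assms(2)], rule integrable_mollifier_mult[OF K assms(3)])

lemma shift_mollify_scaleR:
  fixes f :: "real \<times> (real^'n) \<Rightarrow> 'b::{banach,second_countable_topology}"
  shows "shift_mollify K v (\<lambda>z. c *\<^sub>R f z) z = c *\<^sub>R shift_mollify K v f z"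
proof -
  have "(\<lambda>y. K (snd z + v - y) *\<^sub>R c *\<^sub>R f (fst z, y)) = (\<lambda>y. c *\<^sub>R (K (snd z + v - y) *\<^sub>R f (fst z, y)))"
    by (simp add: mult.commute)
  then show ?thesis by (simp only: shift_mollify_def conv_def integral_scaleR_right)
qed

text \<open>The field is split at level \<open>n\<close>. The small part stays bounded under
  mollification, so \<open>modular_sup_bound\<close> covers it. For the large part, Jensen's
  inequality for the q-th power of the norm gives the bound
  \<open>\<delta> powr (- real CARD('n) / q)\<close> at which \<open>\<Theta>\<close> is controlled.
  Values of norm at most \<open>norm \<xi>0\<close>, about which the condition is silent, are again
  covered by \<open>modular_sup_bound\<close>. The factor 2 in front of \<open>\<kappa>\<close>
  comes from recombining the two parts.\<close>

lemma shift_mollify_modular_le: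
  fixes \<Omega> :: "(real^'n) set" and g :: "real \<times> (real^'n) \<Rightarrow> real^'n"
  assumes M: "convex_family T \<Omega> M" and \<Omega>: "open \<Omega>" and ineq: "M_ineq T \<Omega> M \<Theta> \<xi>0 \<delta>0" and \<Theta>: "Theta_ok \<Theta>"
    and q: "1 \<le> q" and e: "0 < e" and A: "0 \<le> A" "norm a \<le> A" and \<delta>: "\<delta> = (A + 1) * e" "\<delta> < \<delta>0"
    and C: "\<Theta> \<delta> (\<delta> powr (- real CARD('n) / q)) \<le> C" and B: "0 < B" and K: "mollifier B e K"
    and g[measurable]: "g \<in> borel_measurable borel" and gt: "\<And>t. integrable lborel (\<lambda>y. g (t, y))"
    and m: "\<And>t. integrable lborel (\<lambda>y. m (t, y))" "\<And>z. 0 \<le> m z"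
    and gm: "AE z in lborel. z \<in> {0<..<T} \<times> \<Omega> \<longrightarrow> M (fst z) (snd z) (g z /\<^sub>R \<kappa>) \<le> m z"
    and g0: "\<And>z. z \<notin> {0<..<T} \<times> \<Omega> \<Longrightarrow> g z = 0" and \<kappa>: "0 < \<kappa>" and n: "0 \<le> n"
    and big_int: "\<And>t. integrable lborel (\<lambda>y. norm (if n < norm (g (t, y)) then g (t, y) /\<^sub>R \<kappa> else 0) powr q)"
    and big: "\<And>t. (\<integral>y. norm (if n < norm (g (t, y)) then g (t, y) /\<^sub>R \<kappa> else 0) powr q \<partial>lborel) \<le> 1 / (B * (A + 1) ^ CARD('n))"
  shows "AE z in lborel. z \<in> {0<..<T} \<times> \<Omega> \<longrightarrow>
     M (fst z) (snd z) (shift_mollify K (e *\<^sub>R a) g z /\<^sub>R (2 * \<kappa>)) \<le>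
       modular_sup_bound M (n / \<kappa>) z + modular_sup_bound M (norm \<xi>0) z + C * shift_mollify K (e *\<^sub>R a) m z"
proof -
  let ?N = "CARD('n)" and ?v = "e *\<^sub>R a"
  define gb where "gb z = (if n < norm (g z) then g z /\<^sub>R \<kappa> else 0)" for z
  define gs where "gs z = (if n < norm (g z) then 0 else g z /\<^sub>R \<kappa>)" for z
  have [measurable]: "gb \<in> borel_measurable borel" "gs \<in> borel_measurable borel"
    unfolding gb_def[abs_def] gs_def[abs_def] by measurable
  have gk: "integrable lborel (\<lambda>y. g (t, y) /\<^sub>R \<kappa>)" for t using gt by simp
  have gbt: "integrable lborel (\<lambda>y. gb (t, y))" and gst: "integrable lborel (\<lambda>y. gs (t, y))" for t
    by (rule Bochner_Integration.integrable_bound[OF gk[of t]]; simp add: gb_def gs_def)+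
  have split: "g z /\<^sub>R \<kappa> = gb z + gs z" for z by (simp add: gb_def gs_def)
  have \<delta>0': "0 < \<delta>" using \<delta> A e by simp
  have r: "e + norm ?v \<le> \<delta>"
  proof -
    have "e * norm a \<le> e * A" using A e by (intro mult_left_mono) auto
    then show ?thesis using \<delta> e by (simp add: algebra_simps)
  qed
  \<comment> \<open>The kernel height \<open>B / e ^ ?N\<close> times the admissible mass
    \<open>1 / (B * (A + 1) ^ ?N)\<close> is \<open>1 / \<delta> ^ ?N\<close> with
    \<open>\<delta> = (A + 1) * e\<close>; this fixes the threshold in \<open>big\<close>.\<close>
  have Sgb: "norm (shift_mollify K ?v gb z) \<le> \<delta> powr (- real ?N / q)" for z
  proof -
    let ?w = "norm (shift_mollify K ?v gb z)"
    have "?w powr q \<le> conv K (\<lambda>y. norm (gb (fst z, y)) powr q) (snd z + ?v)"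
      unfolding shift_mollify_def
      by (rule jensen_conv[OF K convex_on_norm_powr[OF q] gbt]) (use big_int in \<open>simp_all add: gb_def\<close>)
    also have "\<dots> \<le> B / e ^ ?N * (\<integral>y. norm (gb (fst z, y)) powr q \<partial>lborel)"
      by (rule conv_mono_bound(2)[OF K]) (use big_int in \<open>simp_all add: gb_def\<close>)
    also have "\<dots> \<le> B / e ^ ?N * (1 / (B * (A + 1) ^ ?N))"
      using big[of "fst z"] B e by (intro mult_left_mono) (simp_all add: gb_def)
    also have "\<dots> = 1 / \<delta> ^ ?N" using B by (simp add: \<delta> power_mult_distrib)
    also have "\<dots> = \<delta> powr (- real ?N)" using \<delta>0' by (simp add: powr_minus powr_realpow divide_inverse)
    finally have le: "?w powr q \<le> \<delta> powr (- real ?N)" .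
    have "?w = (?w powr q) powr (1 / q)" using q by (simp add: powr_powr)
    also have "\<dots> \<le> (\<delta> powr (- real ?N)) powr (1 / q)" using le q by (intro powr_mono2) auto
    also have "\<dots> = \<delta> powr (- real ?N / q)" by (simp add: powr_powr)
    finally show ?thesis .
  qed
  have gbm: "AE z in lborel. z \<in> {0<..<T} \<times> \<Omega> \<longrightarrow> M (fst z) (snd z) (gb z) \<le> m z"
    using gm
  proof eventually_elim
    case (elim z)
    show ?case
    proof
      assume z: "z \<in> {0<..<T} \<times> \<Omega>"
      then have "M (fst z) (snd z) 0 = 0" using convex_familyD(3)[OF M, of "fst z" "snd z"] by auto
      then show "M (fst z) (snd z) (gb z) \<le> m z" using elim z m(2)[of z] by (auto simp: gb_def)
    qed
  qed
  have gb0: "gb z = 0" if "z \<notin> {0<..<T} \<times> \<Omega>" for z using g0[OF that] by (simp add: gb_def)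
  have key: "AE z in lborel. z \<in> {0<..<T} \<times> \<Omega> \<longrightarrow> norm \<xi>0 < norm (shift_mollify K ?v gb z) \<longrightarrow>
     M (fst z) (snd z) (shift_mollify K ?v gb z) \<le> C * shift_mollify K ?v m z"
    by (rule mollified_modular_bound[OF M \<Omega> ineq \<Theta> \<delta>0' \<delta>(2) K r C gbt m gbm gb0 Sgb])
  have d1: "\<delta> \<le> 1" using \<delta>(2) ineq by (auto simp: M_ineq_def)
  have "0 \<le> \<Theta> \<delta> (\<delta> powr (- real ?N / q))" using \<Theta> \<delta>0' d1 by (simp add: Theta_ok_def)
  then have C0: "0 \<le> C" using C by linarith
  show ?thesis
    using key
  proof eventually_elim
    case (elim z)
    show ?case
    proof
      assume z: "z \<in> {0<..<T} \<times> \<Omega>"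
      have zt: "fst z \<in> {0..T}" "snd z \<in> \<Omega>" using z by auto
      note F = even_convex_facts[OF convex_familyD[OF M zt]]
      have Sm: "0 \<le> shift_mollify K ?v m z"
        unfolding shift_mollify_def by (rule conv_mono_bound(1)[OF K m(1)]) (rule m(2))
      have nb: "norm (gs (fst z, y)) \<le> n / \<kappa>" for y using \<kappa> n by (simp add: gs_def divide_right_mono flip: divide_inverse_commute)
      have "norm (shift_mollify K ?v gs z) \<le> n / \<kappa>"
        by (rule norm_shift_mollify_le[OF K gst]) (simp add: nb)
      then have s1: "M (fst z) (snd z) (shift_mollify K ?v gs z) \<le> modular_sup_bound M (n / \<kappa>) z"
        unfolding modular_sup_bound_def by (rule F(5))
      have "M (fst z) (snd z) (shift_mollify K ?v gb z) \<le> modular_sup_bound M (norm \<xi>0) z + C * shift_mollify K ?v m z"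
      proof (cases "norm \<xi>0 < norm (shift_mollify K ?v gb z)")
        case True
        have "0 \<le> modular_sup_bound M (norm \<xi>0) z" unfolding modular_sup_bound_def by (intro sum_nonneg F(1))
        then show ?thesis using elim z True by simp
      next
        case False
        then have "M (fst z) (snd z) (shift_mollify K ?v gb z) \<le> modular_sup_bound M (norm \<xi>0) z"
          unfolding modular_sup_bound_def by (intro F(5)) simp
        then show ?thesis using mult_nonneg_nonneg[OF C0 Sm] by linarith
      qed
      moreover have "shift_mollify K ?v g z /\<^sub>R (2 * \<kappa>) = (1/2) *\<^sub>R (shift_mollify K ?v gb z + shift_mollify K ?v gs z)"
      proof -
        have "shift_mollify K ?v (\<lambda>z. inverse \<kappa> *\<^sub>R g z) z = shift_mollify K ?v (\<lambda>z. gb z + gs z) z" by (simp only: split)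
        then have "inverse \<kappa> *\<^sub>R shift_mollify K ?v g z = shift_mollify K ?v gb z + shift_mollify K ?v gs z"
          by (simp only: shift_mollify_scaleR shift_mollify_add[OF K gbt gst])
        moreover have "shift_mollify K ?v g z /\<^sub>R (2 * \<kappa>) = (1/2) *\<^sub>R (inverse \<kappa> *\<^sub>R shift_mollify K ?v g z)" by simp
        ultimately show ?thesis by (simp only:)
      qed
      ultimately show "M (fst z) (snd z) (shift_mollify K ?v g z /\<^sub>R (2 * \<kappa>)) \<le>
       modular_sup_bound M (n / \<kappa>) z + modular_sup_bound M (norm \<xi>0) z + C * shift_mollify K ?v m z"
        using F(4)[of "shift_mollify K ?v gb z" "shift_mollify K ?v gs z"] s1 by simp
    qed
  qed
qed

text \<open>Two midpoint inequalities lead from \<open>8 * \<kappa>\<close> to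
  \<open>2 * \<kappa>\<close>: one splits off the limit field, the other separates the two sums. The
  first sum is a convex combination with weights \<open>\<theta> i\<close>, and its cosine factors
  only shrink the argument. The second has norm at most \<open>k * l * G\<close>, and here the
  truncation is indispensable.\<close>

lemma approximant_grad_modular_le:
  fixes F :: "real^'n \<Rightarrow> real"
  assumes F: "convex_on UNIV F" "\<And>\<xi>. F (-\<xi>) = F \<xi>" "F 0 = 0"
    and \<theta>0: "\<And>i. i < k \<Longrightarrow> 0 \<le> \<theta> i (snd z)" and s: "(\<Sum>i<k. \<theta> i (snd z)) = 1"
    and G: "\<And>i. i < k \<Longrightarrow> norm (grad (\<theta> i) (snd z)) \<le> G" and l: "0 < l" and \<kappa>: "0 < \<kappa>"
  shows "F ((approximant_grad k \<theta> v K l f g z - cos (f z / l) *\<^sub>R g z) /\<^sub>R (8 * \<kappa>)) \<le>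
    (\<Sum>i<k. F (shift_mollify K (v i) g z /\<^sub>R (2 * \<kappa>))) +
    (\<Sum>i\<in>UNIV. F ((real CARD('n) * (real k * l * G / (2 * \<kappa>))) *\<^sub>R axis i 1)) + F (g z /\<^sub>R \<kappa>)"
proof -
  note E = even_convex_facts[OF F]
  let ?S = "\<lambda>i. shift_mollify K (v i) g z" and ?c = "\<lambda>i. cos (shift_mollify K (v i) f z / l)"
  define V1 where "V1 = (\<Sum>i<k. (\<theta> i (snd z) * ?c i) *\<^sub>R ?S i)"
  define V2 where "V2 = (\<Sum>i<k. (l * sin (shift_mollify K (v i) f z / l)) *\<^sub>R grad (\<theta> i) (snd z))"
  have ag: "approximant_grad k \<theta> v K l f g z = V1 + V2" by (simp add: approximant_grad_def V1_def V2_def)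
  have "(V1 + V2 - cos (f z / l) *\<^sub>R g z) /\<^sub>R (8 * \<kappa>) = (1/2) *\<^sub>R ((V1 + V2) /\<^sub>R (4 * \<kappa>) + (- cos (f z / l) / 4) *\<^sub>R (g z /\<^sub>R \<kappa>))"
    by (simp add: algebra_simps)
  then have a0: "F ((V1 + V2 - cos (f z / l) *\<^sub>R g z) /\<^sub>R (8 * \<kappa>)) \<le> F ((V1 + V2) /\<^sub>R (4 * \<kappa>)) + F ((- cos (f z / l) / 4) *\<^sub>R (g z /\<^sub>R \<kappa>))"
    using E(4)[of "(V1 + V2) /\<^sub>R (4 * \<kappa>)" "(- cos (f z / l) / 4) *\<^sub>R (g z /\<^sub>R \<kappa>)"] by simp
  have a1: "F ((- cos (f z / l) / 4) *\<^sub>R (g z /\<^sub>R \<kappa>)) \<le> F (g z /\<^sub>R \<kappa>)"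
    by (rule E(2)) (simp add: divide_le_eq order_trans[OF abs_cos_le_one])
  have a2: "F ((V1 + V2) /\<^sub>R (4 * \<kappa>)) \<le> F (V1 /\<^sub>R (2 * \<kappa>)) + F (V2 /\<^sub>R (2 * \<kappa>))"
  proof -
    have "(V1 + V2) /\<^sub>R (4 * \<kappa>) = (1/2) *\<^sub>R (V1 /\<^sub>R (2 * \<kappa>) + V2 /\<^sub>R (2 * \<kappa>))" by (simp add: algebra_simps)
    then show ?thesis using E(4)[of "V1 /\<^sub>R (2 * \<kappa>)" "V2 /\<^sub>R (2 * \<kappa>)"] by (simp only:)
  qed
  have a3: "F (V1 /\<^sub>R (2 * \<kappa>)) \<le> (\<Sum>i<k. F (?S i /\<^sub>R (2 * \<kappa>)))"
  proof -
    have "V1 /\<^sub>R (2 * \<kappa>) = (\<Sum>i<k. \<theta> i (snd z) *\<^sub>R (?c i *\<^sub>R (?S i /\<^sub>R (2 * \<kappa>))))"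
      by (simp add: V1_def scaleR_sum_right mult_ac)
    then have "F (V1 /\<^sub>R (2 * \<kappa>)) \<le> (\<Sum>i<k. \<theta> i (snd z) * F (?c i *\<^sub>R (?S i /\<^sub>R (2 * \<kappa>))))"
      using convex_on_sum[of "{..<k}" UNIV F "\<lambda>i. \<theta> i (snd z)" "\<lambda>i. ?c i *\<^sub>R (?S i /\<^sub>R (2 * \<kappa>))"] F(1) s \<theta>0
      by (cases "k = 0") auto
    also have "\<dots> \<le> (\<Sum>i<k. F (?S i /\<^sub>R (2 * \<kappa>)))"
    proof (rule sum_mono)
      fix i assume "i \<in> {..<k}"
      then have i: "i < k" by simp
      have "\<theta> i (snd z) \<le> 1" using member_le_sum[of i "{..<k}" "\<lambda>i. \<theta> i (snd z)"] i \<theta>0 s by auto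
      moreover have "F (?c i *\<^sub>R (?S i /\<^sub>R (2 * \<kappa>))) \<le> F (?S i /\<^sub>R (2 * \<kappa>))" by (rule E(2)) simp
      ultimately have "\<theta> i (snd z) * F (?c i *\<^sub>R (?S i /\<^sub>R (2 * \<kappa>))) \<le> 1 * F (?S i /\<^sub>R (2 * \<kappa>))"
        using \<theta>0[OF i] E(1) by (intro mult_mono) auto
      then show "\<theta> i (snd z) * F (?c i *\<^sub>R (?S i /\<^sub>R (2 * \<kappa>))) \<le> F (?S i /\<^sub>R (2 * \<kappa>))" by simp
    qed
    finally show ?thesis .
  qed
  have a4: "F (V2 /\<^sub>R (2 * \<kappa>)) \<le> (\<Sum>i\<in>UNIV. F ((real CARD('n) * (real k * l * G / (2 * \<kappa>))) *\<^sub>R axis i 1))"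
  proof (rule E(5))
    have "norm V2 \<le> (\<Sum>i<k. l * G)"
      unfolding V2_def
    proof (rule order_trans[OF norm_sum sum_mono])
      fix i assume "i \<in> {..<k}"
      then show "norm ((l * sin (shift_mollify K (v i) f z / l)) *\<^sub>R grad (\<theta> i) (snd z)) \<le> l * G"
        using abs_l_sin_le'(2)[OF l, of "shift_mollify K (v i) f z"] G[of i] l by (simp only: norm_scaleR) (intro mult_mono, auto)
    qed
    then have "norm V2 / (2 * \<kappa>) \<le> (real k * l * G) / (2 * \<kappa>)" using \<kappa> by (intro divide_right_mono) auto
    then show "norm (V2 /\<^sub>R (2 * \<kappa>)) \<le> real k * l * G / (2 * \<kappa>)" using \<kappa> by (simp add: field_simps)
  qed
  show ?thesis unfolding ag using a0 a1 a2 a3 a4 by linarith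
qed

text \<open>The majorant may vary by an error that is small in the mean: the minimum of
  \<open>F j\<close> and \<open>W\<close> is dominated by the fixed \<open>W\<close>, and what is
  cut off is at most \<open>E j\<close>.\<close>

lemma nn_integral_tendsto_0_dominated:
  fixes F E :: "nat \<Rightarrow> 'a \<Rightarrow> ennreal"
  assumes [measurable]: "\<And>j. F j \<in> borel_measurable L" "\<And>j. E j \<in> borel_measurable L" "W \<in> borel_measurable L"
    and W: "(\<integral>\<^sup>+z. W z \<partial>L) < \<infinity>" and E: "(\<lambda>j. \<integral>\<^sup>+z. E j z \<partial>L) \<longlonglongrightarrow> 0"
    and le: "\<And>j. AE z in L. F j z \<le> W z + E j z" and F: "AE z in L. (\<lambda>j. F j z) \<longlonglongrightarrow> 0"
  shows "(\<lambda>j. \<integral>\<^sup>+z. F j z \<partial>L) \<longlonglongrightarrow> 0"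
proof -
  have 1: "(\<lambda>j. \<integral>\<^sup>+z. min (F j z) (W z) \<partial>L) \<longlonglongrightarrow> (\<integral>\<^sup>+z. 0 \<partial>L)"
  proof (rule nn_integral_dominated_convergence[where w=W])
    show "AE z in L. (\<lambda>j. min (F j z) (W z)) \<longlonglongrightarrow> 0"
      using F
    proof eventually_elim
      case (elim z)
      show ?case by (rule tendsto_sandwich[OF _ _ tendsto_const elim]) auto
    qed
  qed (use W in auto)
  have 2: "(\<integral>\<^sup>+z. F j z \<partial>L) \<le> (\<integral>\<^sup>+z. min (F j z) (W z) \<partial>L) + (\<integral>\<^sup>+z. E j z \<partial>L)" for j
  proof -
    have "(\<integral>\<^sup>+z. F j z \<partial>L) \<le> (\<integral>\<^sup>+z. min (F j z) (W z) + E j z \<partial>L)"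
    proof (rule nn_integral_mono_AE)
      show "AE z in L. F j z \<le> min (F j z) (W z) + E j z"
        using le[of j] by eventually_elim (auto simp: min_def)
    qed
    also have "\<dots> = (\<integral>\<^sup>+z. min (F j z) (W z) \<partial>L) + (\<integral>\<^sup>+z. E j z \<partial>L)" by (rule nn_integral_add) measurable
    finally show ?thesis .
  qed
  have "(\<lambda>j. (\<integral>\<^sup>+z. min (F j z) (W z) \<partial>L) + (\<integral>\<^sup>+z. E j z \<partial>L)) \<longlonglongrightarrow> 0" using tendsto_add[OF 1 E] by simp
  from tendsto_sandwich[OF _ _ tendsto_const this] show ?thesis using 2 by simp
qed

subsection \<open>Convergence of the truncated mollifications\<close>

lemma nn_integral_lebesgue_on_le_lborel:
  fixes h :: "'a::euclidean_space \<Rightarrow> ennreal"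
  assumes "Z \<in> sets borel"
  shows "(\<integral>\<^sup>+z. h z \<partial>lebesgue_on Z) \<le> (\<integral>\<^sup>+z. h z \<partial>lborel)"
proof -
  have "(\<integral>\<^sup>+z. h z \<partial>lebesgue_on Z) = (\<integral>\<^sup>+z. h z * indicator Z z \<partial>lebesgue)"
    using assms by (simp add: nn_integral_restrict_space)
  also have "\<dots> \<le> (\<integral>\<^sup>+z. h z \<partial>lebesgue)" by (rule nn_integral_mono) (simp add: indicator_def)
  also have "\<dots> = (\<integral>\<^sup>+z. h z \<partial>lborel)" by (simp add: nn_integral_completion)
  finally show ?thesis .
qed

lemma integrable_lborel_lebesgue_on:
  fixes h :: "'a::euclidean_space \<Rightarrow> real"
  assumes "Z \<in> sets borel" "integrable lborel h"
  shows "integrable (lebesgue_on Z) h"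
proof -
  have [measurable]: "h \<in> borel_measurable borel" using assms(2) by auto
  have "(\<integral>\<^sup>+z. ennreal (norm (h z)) \<partial>lebesgue_on Z) < \<infinity>"
    using nn_integral_lebesgue_on_le_lborel[OF assms(1), of "\<lambda>z. ennreal (norm (h z))"] assms(2)
    by (auto simp: integrable_iff_bounded intro: le_less_trans)
  then show ?thesis unfolding integrable_iff_bounded
    by (intro conjI borel_measurable_lebesgue_on) auto
qed

lemma AE_lborel_imp_lebesgue_on:
  assumes "Z \<in> sets borel" "AE z in lborel. z \<in> Z \<longrightarrow> P z"
  shows "AE z in lebesgue_on Z. P z"
  using assms AE_lebesgue_on_iff by blast

lemma grad_partition_sum:
  fixes k :: nat
  assumes \<Omega>: "open \<Omega>" and x: "x \<in> \<Omega>" and \<theta>: "\<And>i. i < k \<Longrightarrow> cb_smooth (\<lambda>_::unit. \<theta> i)"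
    and s: "\<And>x. x \<in> \<Omega> \<Longrightarrow> (\<Sum>i<k. \<theta> i x) = 1"
  shows "(\<Sum>i<k. grad (\<theta> i) x) = 0"
proof -
  have "((\<lambda>x. \<Sum>i<k. \<theta> i x) has_derivative (\<lambda>_. 0)) (at x)"
    by (rule has_derivative_transform_within_open[OF has_derivative_const[of 1] \<Omega> x]) (simp add: s)
  then have "partial_deriv j (\<lambda>x. \<Sum>i<k. \<theta> i x) x = 0" for j by (rule has_derivative_partial_deriv)
  moreover have "partial_deriv j (\<lambda>x. \<Sum>i<k. \<theta> i x) x = (\<Sum>i<k. partial_deriv j (\<theta> i) x)" for j
    by (rule partial_deriv_sum) (use cb_smoothD(2)[OF \<theta>] in auto)
  ultimately show ?thesis by (simp add: vec_eq_iff grad_def)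
qed

lemma grad_partition_bounded:
  assumes \<theta>: "\<And>i. i < k \<Longrightarrow> cb_smooth (\<lambda>_::unit. \<theta> i :: real^'n \<Rightarrow> real)"
  shows "\<exists>G. \<forall>i<(k::nat). \<forall>x. norm (grad (\<theta> i) x) \<le> G"
proof -
  have "\<forall>i. \<exists>G. i < k \<longrightarrow> (\<forall>x. norm (grad (\<theta> i) x) \<le> G)"
  proof
    fix i
    show "\<exists>G. i < k \<longrightarrow> (\<forall>x. norm (grad (\<theta> i) x) \<le> G)"
    proof (cases "i < k")
      case True
      obtain B where B: "\<And>j x. \<bar>partial_deriv j (\<theta> i) x\<bar> \<le> B" using cb_smooth_facts(5)[OF \<theta>[OF True]] by blast
      have "norm (grad (\<theta> i) x) \<le> real CARD('n) * B" for x
      proof -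
        have "norm (grad (\<theta> i) x) \<le> (\<Sum>j\<in>UNIV. \<bar>grad (\<theta> i) x $ j\<bar>)" by (rule norm_le_l1_cart)
        also have "\<dots> \<le> (\<Sum>j\<in>(UNIV::'n set). B)" by (intro sum_mono) (simp add: grad_def B)
        finally show ?thesis by simp
      qed
      then show ?thesis by blast
    qed simp
  qed
  then obtain G where G: "\<And>i x. i < k \<Longrightarrow> norm (grad (\<theta> i) x) \<le> G i" by metis
  have "norm (grad (\<theta> i) x) \<le> (\<Sum>i<k. \<bar>G i\<bar>)" if "i < k" for i x
    using G[OF that, of x] member_le_sum[of i "{..<k}" "\<lambda>i. \<bar>G i\<bar>"] that abs_ge_self[of "G i"] by fastforce
  then show ?thesis by blast
qed

text \<open>One kernel serves the function, its gradient, the modular and all shifts at once, since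
  the thresholds in \<open>shift_mollify_L1\<close> depend only on the radius plus the length of the
  shift.\<close>

lemma choose_mollifier:
  fixes f :: "real \<times> (real^'n) \<Rightarrow> real" and g :: "real \<times> (real^'n) \<Rightarrow> real^'n" and m :: "real \<times> (real^'n) \<Rightarrow> real"
  assumes B: "\<forall>e>0. \<exists>K::real^'n \<Rightarrow> real. mollifier B e K" and A: "0 \<le> A" "\<And>i. i < k \<Longrightarrow> norm (a i) \<le> A"
    and f: "integrable lborel f" "\<And>t. integrable lborel (\<lambda>y. f (t, y))"
    and g: "integrable lborel g" "\<And>t. integrable lborel (\<lambda>y. g (t, y))"
    and m: "integrable lborel m" "\<And>t. integrable lborel (\<lambda>y. m (t, y))"
    and e0: "0 < e0" and \<eta>: "0 < \<eta>"
  shows "\<exists>e K. 0 < e \<and> e < e0 \<and> mollifier B e K \<and> (\<forall>i<(k::nat).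
     (\<integral>\<^sup>+z. norm (shift_mollify K (e *\<^sub>R a i) f z - f z) \<partial>lborel) \<le> ennreal \<eta> \<and>
     (\<integral>\<^sup>+z. norm (shift_mollify K (e *\<^sub>R a i) g z - g z) \<partial>lborel) \<le> ennreal \<eta> \<and>
     (\<integral>\<^sup>+z. norm (shift_mollify K (e *\<^sub>R a i) m z - m z) \<partial>lborel) \<le> ennreal \<eta>)"
proof -
  obtain d1 where d1: "d1 > 0" "\<forall>K v B r. mollifier B r K \<longrightarrow> r + norm v < d1 \<longrightarrow>
     (\<integral>\<^sup>+z. norm (shift_mollify K v f z - f z) \<partial>lborel) \<le> ennreal \<eta>" using shift_mollify_L1[OF f \<eta>] by auto
  obtain d2 where d2: "d2 > 0" "\<forall>K v B r. mollifier B r K \<longrightarrow> r + norm v < d2 \<longrightarrow>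
     (\<integral>\<^sup>+z. norm (shift_mollify K v g z - g z) \<partial>lborel) \<le> ennreal \<eta>" using shift_mollify_L1[OF g \<eta>] by auto
  obtain d3 where d3: "d3 > 0" "\<forall>K v B r. mollifier B r K \<longrightarrow> r + norm v < d3 \<longrightarrow>
     (\<integral>\<^sup>+z. norm (shift_mollify K v m z - m z) \<partial>lborel) \<le> ennreal \<eta>" using shift_mollify_L1[OF m \<eta>] by auto
  define d where "d = min e0 (min d1 (min d2 d3))"
  have d: "0 < d" "d \<le> e0" "d \<le> d1" "d \<le> d2" "d \<le> d3" using e0 d1 d2 d3 by (auto simp: d_def)
  \<comment> \<open>This makes \<open>(A + 1) * e\<close>, a bound for the radius plus every shift,
    equal to half of \<open>d\<close>.\<close>
  define e where "e = d / (2 * (A + 1))"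
  have e: "0 < e" using d A by (simp add: e_def)
  have "(A + 1) * e = d / 2" using A by (simp add: e_def field_simps)
  then have eA: "(A + 1) * e < d" using d by simp
  have ee: "e \<le> (A + 1) * e" using e A by (simp add: algebra_simps)
  obtain K :: "real^'n \<Rightarrow> real" where K: "mollifier B e K" using B e by blast
  have lt: "e + norm (e *\<^sub>R a i) < d" if "i < k" for i
  proof -
    have "e * norm (a i) \<le> e * A" using A(2)[OF that] e by (intro mult_left_mono) auto
    moreover have "norm (e *\<^sub>R a i) = e * norm (a i)" using e by simp
    moreover have "(A + 1) * e = e + e * A" by (simp add: algebra_simps)
    ultimately show ?thesis using eA by linarith
  qed
  have l1: "e + norm (e *\<^sub>R a i) < d1" "e + norm (e *\<^sub>R a i) < d2" "e + norm (e *\<^sub>R a i) < d3" if "i < k" for i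
    using lt[OF that] d by linarith+
  show ?thesis
  proof (intro exI[of _ e] exI[of _ K] conjI allI impI)
    show "e < e0" using ee eA d by linarith
  qed (use e K d1(2) d2(2) d3(2) l1 in blast)+
qed

lemma Limsup_finite_bound:
  fixes h :: "real \<Rightarrow> real"
  assumes "Limsup (at_right 0) (\<lambda>\<delta>. ereal (h \<delta>)) < \<infinity>"
  shows "\<exists>C\<ge>0. \<exists>d>0. \<forall>\<delta>. 0 < \<delta> \<and> \<delta> < d \<longrightarrow> h \<delta> \<le> C"
proof -
  obtain n :: nat where n: "Limsup (at_right 0) (\<lambda>\<delta>. ereal (h \<delta>)) < ereal (real n)"
    using assms less_PInf_Ex_of_nat by (metis less_irrefl)
  then have "eventually (\<lambda>\<delta>. ereal (h \<delta>) < ereal (real n)) (at_right 0)" by (rule Limsup_lessD)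
  then obtain d where "d > 0" "\<And>\<delta>. 0 < \<delta> \<Longrightarrow> \<delta> < d \<Longrightarrow> h \<delta> < real n"
    unfolding eventually_at_right_field by auto
  then show ?thesis by (intro exI[of _ "real n"] conjI exI[of _ d]) (auto intro: less_imp_le)
qed

text \<open>The data that are fixed before a function is approximated, including the scale
  \<open>\<kappa>\<close> at which the modular of its gradient will be finite. The exponent
  \<open>q\<close> is 1 under (M) and p under (Mp). \<open>A\<close> bounds the directions of the
  shifts and, with \<open>B\<close>, enters the threshold for the large part of the
  gradient.\<close>

locale smooth_truncation =
  fixes \<Omega> :: "(real^'n) set" and T :: real and M :: "real \<Rightarrow> real^'n \<Rightarrow> real^'n \<Rightarrow> real"
    and k :: nat and \<theta> :: "nat \<Rightarrow> real^'n \<Rightarrow> real" and a :: "nat \<Rightarrow> real^'n" and r0 A B :: real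
    and \<Theta> :: "real \<Rightarrow> real \<Rightarrow> real" and \<xi>0 :: "real^'n" and \<delta>0 q \<kappa> :: real
  assumes \<Omega>: "open \<Omega>" "bounded \<Omega>" and r0: "0 < r0"
    and \<theta>: "\<And>i. i < k \<Longrightarrow> cb_smooth (\<lambda>_::unit. \<theta> i)" and \<theta>0: "\<And>i x. i < k \<Longrightarrow> 0 \<le> \<theta> i x"
    and \<theta>1: "\<And>x. x \<in> \<Omega> \<Longrightarrow> (\<Sum>i<k. \<theta> i x) = 1"
    and tr: "\<And>i x w e z. i < k \<Longrightarrow> \<theta> i x \<noteq> 0 \<Longrightarrow> w \<notin> \<Omega> \<Longrightarrow> dist x w < r0 \<Longrightarrow> 0 < e \<Longrightarrow> e < r0 \<Longrightarrow> norm z \<le> 2 * e \<Longrightarrow>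
       w + e *\<^sub>R a i + z \<notin> \<Omega>"
    and A: "0 \<le> A" "\<And>i. i < k \<Longrightarrow> norm (a i) \<le> A"
    and B: "0 < B" "\<forall>e>0. \<exists>K::real^'n \<Rightarrow> real. mollifier B e K"
    and M: "convex_family T \<Omega> M"
    and Mm: "\<And>\<xi>. (\<lambda>z. M (fst z) (snd z) \<xi>) \<in> borel_measurable (lebesgue_on ({0<..<T} \<times> \<Omega>))"
    and Mi: "\<And>\<xi>. (\<integral>\<^sup>+z. ennreal (M (fst z) (snd z) \<xi>) \<partial>lebesgue_on ({0<..<T} \<times> \<Omega>)) < \<infinity>"
    and ineq: "M_ineq T \<Omega> M \<Theta> \<xi>0 \<delta>0" and \<Theta>: "Theta_ok \<Theta>" and q: "1 \<le> q"
    and lim: "Limsup (at_right 0) (\<lambda>\<delta>. ereal (\<Theta> \<delta> (\<delta> powr (- real CARD('n) / q)))) < \<infinity>"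
    and \<kappa>: "0 < \<kappa>"
begin

abbreviation "Z \<equiv> {0<..<T} \<times> \<Omega>"

lemma Z_borel [measurable]: "Z \<in> sets borel"
  using \<Omega>(1) by (intro borel_Times) auto

lemma M_facts:
  assumes "z \<in> Z"
  shows "convex_on UNIV (M (fst z) (snd z))" "\<And>\<xi>. M (fst z) (snd z) (-\<xi>) = M (fst z) (snd z) \<xi>" "M (fst z) (snd z) 0 = 0"
  using convex_familyD[OF M, of "fst z" "snd z"] assms by auto

lemma integrable_M: "integrable (lebesgue_on Z) (\<lambda>z. M (fst z) (snd z) \<xi>)"
proof -
  have "(\<integral>\<^sup>+z. ennreal (norm (M (fst z) (snd z) \<xi>)) \<partial>lebesgue_on Z) = (\<integral>\<^sup>+z. ennreal (M (fst z) (snd z) \<xi>) \<partial>lebesgue_on Z)"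
    by (rule nn_integral_cong) (use even_convex_facts(1)[OF M_facts] in auto)
  then show ?thesis unfolding integrable_iff_bounded using Mm Mi by simp
qed

lemma integrable_modular_sup_bound: "integrable (lebesgue_on Z) (modular_sup_bound M r)"
  unfolding modular_sup_bound_def[abs_def] by (intro Bochner_Integration.integrable_sum integrable_M)

lemma measurable_M_compose:
  assumes "h \<in> borel_measurable (lebesgue_on Z)"
  shows "(\<lambda>z. M (fst z) (snd z) (h z)) \<in> borel_measurable (lebesgue_on Z)"
proof (rule borel_measurable_caratheodory[OF Mm _ assms])
  fix z assume "z \<in> space (lebesgue_on Z)"
  then have "z \<in> Z" by simp
  from even_convex_facts(3)[OF M_facts[OF this]] show "continuous_on UNIV (M (fst z) (snd z))" .
qed

text \<open>The limit of vanishing scale at a fixed level \<open>n\<close> and a fixed truncation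
  \<open>l\<close>. The targets are \<open>l * sin (f / l)\<close> and its formal gradient
  \<open>cos (f / l)\<close> times \<open>g\<close>. \<open>V\<close> is a Borel version of the
  gradient of \<open>\<Phi>\<close>, kept so that modulars can later be added under the integral.
  The hypotheses on sections are imposed at every t, since the approximants must be smooth with
  bounds uniform in time.\<close>

lemma smooth_approximation:
  assumes f: "integrable lborel f" "\<And>t. integrable lborel (\<lambda>y. f (t, y))" "\<And>z. z \<notin> Z \<Longrightarrow> f z = 0"
    and fC: "\<And>t. (\<integral>y. \<bar>f (t, y)\<bar> \<partial>lborel) \<le> D"
    and g: "integrable lborel g" "\<And>t. integrable lborel (\<lambda>y. g (t, y))" "\<And>z. z \<notin> Z \<Longrightarrow> g z = 0"
    and m: "integrable lborel m" "\<And>t. integrable lborel (\<lambda>y. m (t, y))" "\<And>z. 0 \<le> m z"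
    and gm: "AE z in lborel. z \<in> Z \<longrightarrow> M (fst z) (snd z) (g z /\<^sub>R \<kappa>) \<le> m z"
    and n: "0 \<le> n"
    and big_int: "\<And>t. integrable lborel (\<lambda>y. norm (if n < norm (g (t, y)) then g (t, y) /\<^sub>R \<kappa> else 0) powr q)"
    and big: "\<And>t. (\<integral>y. norm (if n < norm (g (t, y)) then g (t, y) /\<^sub>R \<kappa> else 0) powr q \<partial>lborel) \<le> 1 / (B * (A + 1) ^ CARD('n))"
    and W: "AE t in lborel. t \<in> {0<..<T} \<longrightarrow> (\<forall>B e K i x. mollifier B e K \<longrightarrow>
       conv (partial_deriv i K) (\<lambda>y. f (t, y)) x = conv K (\<lambda>y. g (t, y)) x $ i)"
    and l: "0 < l" and \<eta>: "0 < \<eta>"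
  shows "\<exists>\<Phi> V. in_Linf_Cc T \<Omega> \<Phi> \<and> V \<in> borel_measurable borel \<and>
    (AE z in lebesgue_on Z. grad (\<Phi> (fst z)) (snd z) = V z) \<and>
    (\<integral>\<^sup>+z. ennreal \<bar>\<Phi> (fst z) (snd z) - l * sin (f z / l)\<bar> \<partial>lebesgue_on Z) \<le> ennreal \<eta> \<and>
    (\<integral>\<^sup>+z. ennreal (M (fst z) (snd z) ((V z - cos (f z / l) *\<^sub>R g z) /\<^sub>R (8 * \<kappa>))) \<partial>lebesgue_on Z) \<le> ennreal \<eta> \<and>
    (\<forall>t x b. x \<in> \<Omega> \<longrightarrow> (AE y in lborel. \<bar>f (t, y)\<bar> \<le> b) \<longrightarrow> \<bar>\<Phi> t x\<bar> \<le> b)"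
proof -
  have [measurable]: "f \<in> borel_measurable borel" "g \<in> borel_measurable borel" "m \<in> borel_measurable borel"
    using f(1) g(1) m(1) by auto
  obtain C d0 where C: "0 \<le> C" and d0: "0 < d0" "\<And>\<delta>. 0 < \<delta> \<Longrightarrow> \<delta> < d0 \<Longrightarrow> \<Theta> \<delta> (\<delta> powr (- real CARD('n) / q)) \<le> C"
    using Limsup_finite_bound[OF lim] by blast
  have \<delta>0: "0 < \<delta>0" using ineq by (simp add: M_ineq_def)
  \<comment> \<open>\<open>r0\<close> keeps the supports inside \<open>\<Omega>\<close>; the other
    two terms put \<open>(A + 1) * e\<close>, the scale at which the condition is applied, below
    both of its thresholds.\<close>
  define e0 where "e0 = min r0 (min (d0 / (A + 1)) (\<delta>0 / (A + 1)))"
  have e0: "0 < e0" using r0 d0 \<delta>0 A by (simp add: e0_def)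
  define P where "P j e K \<longleftrightarrow> 0 < e \<and> e < e0 \<and> mollifier B e K \<and> (\<forall>i<k.
     (\<integral>\<^sup>+z. norm (shift_mollify K (e *\<^sub>R a i) f z - f z) \<partial>lborel) \<le> ennreal (1 / real (Suc j)) \<and>
     (\<integral>\<^sup>+z. norm (shift_mollify K (e *\<^sub>R a i) g z - g z) \<partial>lborel) \<le> ennreal (1 / real (Suc j)) \<and>
     (\<integral>\<^sup>+z. norm (shift_mollify K (e *\<^sub>R a i) m z - m z) \<partial>lborel) \<le> ennreal (1 / real (Suc j)))" for j e K
  have "\<exists>e K. P j e K" for j
    unfolding P_def by (rule choose_mollifier[OF B(2) A f(1,2) g(1,2) m(1,2) e0]) simp_all
  then obtain e K where P: "\<And>j. P j (e j) (K j)" by metis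
  have eK: "\<And>j. 0 < e j" "\<And>j. e j < e0" "\<And>j. mollifier B (e j) (K j)"
    and Ef: "\<And>j i. i < k \<Longrightarrow> (\<integral>\<^sup>+z. norm (shift_mollify (K j) (e j *\<^sub>R a i) f z - f z) \<partial>lborel) \<le> ennreal (1 / real (Suc j))"
    and Eg: "\<And>j i. i < k \<Longrightarrow> (\<integral>\<^sup>+z. norm (shift_mollify (K j) (e j *\<^sub>R a i) g z - g z) \<partial>lborel) \<le> ennreal (1 / real (Suc j))"
    and Em: "\<And>j i. i < k \<Longrightarrow> (\<integral>\<^sup>+z. norm (shift_mollify (K j) (e j *\<^sub>R a i) m z - m z) \<partial>lborel) \<le> ennreal (1 / real (Suc j))"
    using P unfolding P_def by simp_all
  note [measurable] = mollifierD(7)[OF eK(3)]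
  define Sf where "Sf j i = shift_mollify (K j) (e j *\<^sub>R a i) f" for j i
  define Sg where "Sg j i = shift_mollify (K j) (e j *\<^sub>R a i) g" for j i
  define Sm where "Sm j i = shift_mollify (K j) (e j *\<^sub>R a i) m" for j i
  have [measurable]: "Sf j i \<in> borel_measurable borel" "Sg j i \<in> borel_measurable borel" "Sm j i \<in> borel_measurable borel" for j i
    unfolding Sf_def Sg_def Sm_def by measurable
  \<comment> \<open>All errors of \<open>f\<close> and \<open>g\<close> are collected in one
    function, so that a single subsequence gives convergence almost everywhere for all shifts
    together.\<close>
  define U where "U j z = (\<Sum>i<k. \<bar>Sf j i z - f z\<bar> + norm (Sg j i z - g z))" for j z
  have Unn: "0 \<le> U j z" for j z unfolding U_def by (intro sum_nonneg) simp
  have Uint: "(\<integral>\<^sup>+z. ennreal (U j z) \<partial>lborel) \<le> ennreal (real k * (2 / real (Suc j)))" for j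
  proof -
    have "(\<integral>\<^sup>+z. ennreal (U j z) \<partial>lborel) = (\<integral>\<^sup>+z. (\<Sum>i<k. ennreal \<bar>Sf j i z - f z\<bar> + ennreal (norm (Sg j i z - g z))) \<partial>lborel)"
      by (simp add: U_def flip: sum_ennreal)
    also have "\<dots> = (\<Sum>i<k. (\<integral>\<^sup>+z. ennreal \<bar>Sf j i z - f z\<bar> \<partial>lborel) + (\<integral>\<^sup>+z. ennreal (norm (Sg j i z - g z)) \<partial>lborel))"
      by (subst nn_integral_sum, measurable) (intro sum.cong refl nn_integral_add; measurable)
    also have "\<dots> \<le> (\<Sum>i<k. ennreal (1 / real (Suc j)) + ennreal (1 / real (Suc j)))"
      using Ef Eg by (intro sum_mono add_mono) (auto simp: Sf_def Sg_def)
    also have "\<dots> = ennreal (real k * (2 / real (Suc j)))"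
      using ennreal_mult[of "real k" "2 / real (Suc j)"]
      by (simp flip: ennreal_plus add: ennreal_of_nat_eq_real_of_nat)
    finally show ?thesis .
  qed
  have Ui: "integrable lborel (U j)" for j
  proof -
    have "U j \<in> borel_measurable lborel" unfolding U_def[abs_def] by measurable
    then show ?thesis unfolding integrable_iff_bounded using Uint[of j] Unn by (auto intro: le_less_trans)
  qed
  have UI: "(\<integral>z. norm (U j z) \<partial>lborel) \<le> real k * (2 / real (Suc j))" for j
  proof -
    have "ennreal (\<integral>z. U j z \<partial>lborel) = (\<integral>\<^sup>+z. ennreal (U j z) \<partial>lborel)"
      using nn_integral_eq_integral[OF Ui] Unn by simp
    then have "ennreal (\<integral>z. U j z \<partial>lborel) \<le> ennreal (real k * (2 / real (Suc j)))" using Uint[of j] by simp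
    then show ?thesis using Unn by (simp add: ennreal_le_iff)
  qed
  have k0: "(\<lambda>j. real k * (2 / real (Suc j))) \<longlonglongrightarrow> 0"
    using tendsto_mult_right_zero[OF tendsto_mult_right_zero[OF LIMSEQ_inverse_real_of_nat], of "real k" 2] by (simp add: divide_inverse)
  have U0: "(\<lambda>j. \<integral>z. norm (U j z) \<partial>lborel) \<longlonglongrightarrow> 0"
    by (rule tendsto_sandwich[OF _ _ tendsto_const k0]) (use UI in auto)
  obtain r where r: "strict_mono r" and Uae: "AE z in lborel. (\<lambda>j. U (r j) z) \<longlonglongrightarrow> 0"
    using tendsto_L1_AE_subseq[where u=U, OF Ui U0] by blast
  have rj: "1 / real (Suc (r j)) \<le> 1 / real (Suc j)" for j
    using seq_suble[OF r, of j] by (simp add: frac_le)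
  define v where "v j i = e (r j) *\<^sub>R a i" for j i
  define \<Phi> where "\<Phi> j = approximant k \<theta> (v j) (K (r j)) l f" for j
  define V where "V j = approximant_grad k \<theta> (v j) (K (r j)) l f g" for j
  have \<theta>b [measurable]: "i < k \<Longrightarrow> \<theta> i \<in> borel_measurable borel" for i using cb_smooth_facts(2)[OF \<theta>] .
  have \<theta>gb: "grad (\<theta> i) \<in> borel_measurable borel" if "i < k" for i
    using cb_smooth_facts(3)[OF \<theta>[OF that]]
    by (subst borel_measurable_euclidean_space) (auto simp: Basis_vec_def inner_axis grad_def)
  have Vb: "V j \<in> borel_measurable borel" for j
  proof -
    have 1: "(\<lambda>z::real \<times> (real^'n). \<theta> i (snd z)) \<in> borel_measurable borel" "(\<lambda>z::real \<times> (real^'n). grad (\<theta> i) (snd z)) \<in> borel_measurable borel" if "i < k" for i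
      using measurable_compose[OF borel_measurable_fst_snd(2) \<theta>b[OF that]] measurable_compose[OF borel_measurable_fst_snd(2) \<theta>gb[OF that]] by auto
    show ?thesis unfolding V_def approximant_grad_def[abs_def]
      by (intro borel_measurable_add borel_measurable_sum borel_measurable_scaleR borel_measurable_times 1; measurable)
  qed
  have Linf: "in_Linf_Cc T \<Omega> (\<Phi> j)" for j
    unfolding \<Phi>_def v_def
  proof (rule approximant_in_Linf_Cc[OF \<Omega> \<theta> eK(3) eK(1) _ tr])
    show "e (r j) < r0" using eK(2)[of "r j"] by (simp add: e0_def)
    show "f (t, y) = 0" if "y \<notin> \<Omega>" for t y using f(3)[of "(t, y)"] that by simp
  qed (use f(2) fC in auto)
  have bound: "\<bar>\<Phi> j t x\<bar> \<le> b" if "x \<in> \<Omega>" "AE y in lborel. \<bar>f (t, y)\<bar> \<le> b" for j t x b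
    unfolding \<Phi>_def by (rule approximant_bound[where f=f and t=t and \<theta>=\<theta> and k=k, OF \<theta>0 \<theta>1[OF that(1)] eK(3) l f(2)[of t] that(2)])
  have gradV: "AE z in lborel. z \<in> Z \<longrightarrow> grad (\<Phi> j (fst z)) (snd z) = V j z" for j
    using AE_lborel_fst[OF W]
  proof eventually_elim
    case (elim z)
    show ?case
    proof
      assume "z \<in> Z"
      then have c: "conv (partial_deriv i (K (r j))) (\<lambda>y. f (fst z, y)) x = conv (K (r j)) (\<lambda>y. g (fst z, y)) x $ i" for i x
        using elim eK(3)[of "r j"] by auto
      have "grad (approximant k \<theta> (v j) (K (r j)) l f (fst z)) (snd z) = approximant_grad k \<theta> (v j) (K (r j)) l f g (fst z, snd z)"
        by (rule grad_approximant[OF \<theta> eK(3)[of "r j"]]) (use l f(2) c in auto)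
      then show "grad (\<Phi> j (fst z)) (snd z) = V j z" by (simp add: \<Phi>_def V_def)
    qed
  qed
  have L1: "(\<integral>\<^sup>+z. ennreal \<bar>\<Phi> j (fst z) (snd z) - l * sin (f z / l)\<bar> \<partial>lebesgue_on Z) \<le> ennreal (real k * (2 / real (Suc j)))" for j
  proof -
    have "(\<integral>\<^sup>+z. ennreal \<bar>\<Phi> j (fst z) (snd z) - l * sin (f z / l)\<bar> \<partial>lebesgue_on Z) \<le> (\<integral>\<^sup>+z. ennreal (U (r j) z) \<partial>lebesgue_on Z)"
    proof (rule nn_integral_mono)
      fix z assume "z \<in> space (lebesgue_on Z)"
      then have z: "snd z \<in> \<Omega>" by auto
      have "\<bar>\<Phi> j (fst z) (snd z) - l * sin (f z / l)\<bar> \<le> (\<Sum>i<k. \<bar>Sf (r j) i z - f z\<bar>)"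
        using approximant_diff[where \<theta>=\<theta> and k=k, OF \<theta>0 \<theta>1[OF z] l, of "v j" "K (r j)" f "fst z"] by (simp add: \<Phi>_def Sf_def v_def)
      also have "\<dots> \<le> U (r j) z" unfolding U_def by (intro sum_mono) simp
      finally show "ennreal \<bar>\<Phi> j (fst z) (snd z) - l * sin (f z / l)\<bar> \<le> ennreal (U (r j) z)" by (rule ennreal_leI)
    qed
    also have "\<dots> \<le> (\<integral>\<^sup>+z. ennreal (U (r j) z) \<partial>lborel)" by (rule nn_integral_lebesgue_on_le_lborel) measurable
    also have "\<dots> \<le> ennreal (real k * (2 / real (Suc (r j))))" by (rule Uint)
    also have "\<dots> \<le> ennreal (real k * (2 / real (Suc j)))"
      using mult_left_mono[OF rj[of j], of "real k * 2"] by (intro ennreal_leI) simp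
    finally show ?thesis .
  qed
  define F where "F j z = M (fst z) (snd z) ((V j z - cos (f z / l) *\<^sub>R g z) /\<^sub>R (8 * \<kappa>))" for j z
  obtain G where G: "\<And>i x. i < k \<Longrightarrow> norm (grad (\<theta> i) x) \<le> G" using grad_partition_bounded[of k \<theta>, OF \<theta>] by blast
  \<comment> \<open>\<open>H\<close> is the fixed integrable majorant, with every mollified modular
    replaced by \<open>m\<close>. The price of the replacement goes into \<open>E\<close>, which
    tends to 0 in the mean.\<close>
  define H where "H z = real k * (modular_sup_bound M (n / \<kappa>) z + modular_sup_bound M (norm \<xi>0) z) + modular_sup_bound M (real k * l * G / (2 * \<kappa>)) z + (real k * C + 1) * m z" for z
  define E where "E j z = C * (\<Sum>i<k. \<bar>Sm (r j) i z - m z\<bar>)" for j z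
  have Hi: "integrable (lebesgue_on Z) H"
    unfolding H_def[abs_def]
    by (intro Bochner_Integration.integrable_add integrable_mult_right integrable_modular_sup_bound integrable_lborel_lebesgue_on[OF Z_borel m(1)])
  have Fm: "F j \<in> borel_measurable (lebesgue_on Z)" for j
    unfolding F_def[abs_def]
    by (intro measurable_M_compose borel_measurable_lebesgue_on) (use Vb[of j] in measurable)
  have Eb [measurable]: "E j \<in> borel_measurable borel" for j unfolding E_def[abs_def] by measurable
  have "(\<lambda>j. \<integral>\<^sup>+z. ennreal (F j z) \<partial>lebesgue_on Z) \<longlonglongrightarrow> 0"
  proof (rule nn_integral_tendsto_0_dominated[where W="\<lambda>z. ennreal (H z)" and E="\<lambda>j z. ennreal (E j z)"])
    show "(\<lambda>z. ennreal (F j z)) \<in> borel_measurable (lebesgue_on Z)" for j using Fm[of j] by measurable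
    show "(\<lambda>z. ennreal (E j z)) \<in> borel_measurable (lebesgue_on Z)" for j
      by (rule borel_measurable_lebesgue_on) measurable
    show "(\<lambda>z. ennreal (H z)) \<in> borel_measurable (lebesgue_on Z)" using Hi by auto
    have "(\<integral>\<^sup>+z. ennreal (H z) \<partial>lebesgue_on Z) \<le> (\<integral>\<^sup>+z. ennreal (norm (H z)) \<partial>lebesgue_on Z)"
      by (intro nn_integral_mono ennreal_leI) simp
    also have "\<dots> < \<infinity>" using Hi by (simp add: integrable_iff_bounded)
    finally show "(\<integral>\<^sup>+z. ennreal (H z) \<partial>lebesgue_on Z) < \<infinity>" .
    have Ele: "(\<integral>\<^sup>+z. ennreal (E j z) \<partial>lebesgue_on Z) \<le> ennreal (C * real k * (1 / real (Suc j)))" for j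
    proof -
      have "(\<integral>\<^sup>+z. ennreal (E j z) \<partial>lebesgue_on Z) \<le> (\<integral>\<^sup>+z. ennreal (E j z) \<partial>lborel)"
        by (rule nn_integral_lebesgue_on_le_lborel) measurable
      also have "\<dots> = (\<integral>\<^sup>+z. ennreal C * (\<Sum>i<k. ennreal \<bar>Sm (r j) i z - m z\<bar>) \<partial>lborel)"
        using C by (simp add: E_def ennreal_mult sum_nonneg)
      also have "\<dots> = ennreal C * (\<Sum>i<k. \<integral>\<^sup>+z. ennreal \<bar>Sm (r j) i z - m z\<bar> \<partial>lborel)"
        by (subst nn_integral_cmult, measurable) (subst nn_integral_sum, measurable)
      also have "\<dots> \<le> ennreal C * (\<Sum>i<k. ennreal (1 / real (Suc j)))"
      proof (intro mult_left_mono sum_mono)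
        fix i assume "i \<in> {..<k}"
        then have "(\<integral>\<^sup>+z. ennreal \<bar>Sm (r j) i z - m z\<bar> \<partial>lborel) \<le> ennreal (1 / real (Suc (r j)))"
          using Em[of i "r j"] by (simp add: Sm_def)
        also have "\<dots> \<le> ennreal (1 / real (Suc j))" by (rule ennreal_leI[OF rj])
        finally show "(\<integral>\<^sup>+z. ennreal \<bar>Sm (r j) i z - m z\<bar> \<partial>lborel) \<le> ennreal (1 / real (Suc j))" .
      qed simp
      also have "\<dots> = ennreal (C * real k * (1 / real (Suc j)))"
      proof -
        have "(\<Sum>i<k. ennreal (1 / real (Suc j))) = ennreal (real k * (1 / real (Suc j)))"
          using ennreal_mult[of "real k" "1 / real (Suc j)"] by (simp add: ennreal_of_nat_eq_real_of_nat)
        then show ?thesis using C ennreal_mult[of C "real k * (1 / real (Suc j))"] by (simp add: mult.assoc)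
      qed
      finally show ?thesis .
    qed
    have "(\<lambda>j. C * real k * (1 / real (Suc j))) \<longlonglongrightarrow> 0"
      using tendsto_mult_right_zero[OF LIMSEQ_inverse_real_of_nat, of "C * real k"] by (simp add: divide_inverse)
    from tendsto_ennrealI[OF this] have "(\<lambda>j. ennreal (C * real k * (1 / real (Suc j)))) \<longlonglongrightarrow> 0" by simp
    from tendsto_sandwich[OF _ _ tendsto_const this]
    show "(\<lambda>j. \<integral>\<^sup>+z. ennreal (E j z) \<partial>lebesgue_on Z) \<longlonglongrightarrow> 0" using Ele by simp
    show "AE z in lebesgue_on Z. ennreal (F j z) \<le> ennreal (H z) + ennreal (E j z)" for j
    proof (rule AE_lborel_imp_lebesgue_on[OF Z_borel])
      have "AE z in lborel. z \<in> Z \<longrightarrow> M (fst z) (snd z) (Sg (r j) i z /\<^sub>R (2 * \<kappa>)) \<le>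
         modular_sup_bound M (n / \<kappa>) z + modular_sup_bound M (norm \<xi>0) z + C * Sm (r j) i z" if i: "i < k" for i
      proof -
        let ?\<delta> = "(A + 1) * e (r j)"
        have "e (r j) < d0 / (A + 1)" "e (r j) < \<delta>0 / (A + 1)" using eK(2)[of "r j"] by (simp_all add: e0_def)
        then have d: "?\<delta> < d0" "?\<delta> < \<delta>0" using A(1) by (simp_all add: less_divide_eq mult.commute)
        have "0 < ?\<delta>" using A(1) eK(1)[of "r j"] by simp
        from d0(2)[OF this d(1)]
        show ?thesis unfolding Sg_def Sm_def
          by (intro shift_mollify_modular_le[OF M \<Omega>(1) ineq \<Theta> q eK(1) A(1) A(2)[OF i] refl d(2) _ B(1) eK(3) _ g(2) m(2,3) gm g(3) \<kappa> n big_int big]) auto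
      qed
      then have "AE z in lborel. \<forall>i\<in>{..<k}. z \<in> Z \<longrightarrow> M (fst z) (snd z) (Sg (r j) i z /\<^sub>R (2 * \<kappa>)) \<le>
         modular_sup_bound M (n / \<kappa>) z + modular_sup_bound M (norm \<xi>0) z + C * Sm (r j) i z"
        by (intro AE_finite_allI) auto
      then show "AE z in lborel. z \<in> Z \<longrightarrow> ennreal (F j z) \<le> ennreal (H z) + ennreal (E j z)"
        using gm
      proof eventually_elim
        case (elim z)
        show ?case
        proof
          assume z: "z \<in> Z"
          then have zO: "snd z \<in> \<Omega>" by auto
          note nn = even_convex_facts(1)[OF M_facts[OF z]]
          have "F j z \<le> (\<Sum>i<k. M (fst z) (snd z) (Sg (r j) i z /\<^sub>R (2 * \<kappa>))) +
              modular_sup_bound M (real k * l * G / (2 * \<kappa>)) z + M (fst z) (snd z) (g z /\<^sub>R \<kappa>)"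
            unfolding F_def V_def Sg_def modular_sup_bound_def v_def[symmetric]
            by (rule approximant_grad_modular_le[OF M_facts[OF z] \<theta>0 \<theta>1[OF zO] G l \<kappa>])
          also have "\<dots> \<le> (\<Sum>i<k. modular_sup_bound M (n / \<kappa>) z + modular_sup_bound M (norm \<xi>0) z + (C * m z + C * \<bar>Sm (r j) i z - m z\<bar>)) +
              modular_sup_bound M (real k * l * G / (2 * \<kappa>)) z + m z"
          proof (intro add_mono sum_mono order_refl)
            fix i assume i: "i \<in> {..<k}"
            have "C * Sm (r j) i z \<le> C * (m z + \<bar>Sm (r j) i z - m z\<bar>)" using C by (intro mult_left_mono) auto
            then show "M (fst z) (snd z) (Sg (r j) i z /\<^sub>R (2 * \<kappa>)) \<le> modular_sup_bound M (n / \<kappa>) z + modular_sup_bound M (norm \<xi>0) z + (C * m z + C * \<bar>Sm (r j) i z - m z\<bar>)"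
              using elim(1)[rule_format, OF i z] unfolding distrib_left by linarith
          qed (use elim(2) z in auto)
          also have "\<dots> = H z + E j z"
            by (simp add: H_def E_def sum.distrib sum_distrib_left algebra_simps)
          finally have "F j z \<le> H z + E j z" .
          moreover have "0 \<le> H z"
            unfolding H_def modular_sup_bound_def using nn C m(3)[of z]
            by (intro add_nonneg_nonneg mult_nonneg_nonneg sum_nonneg) auto
          moreover have "0 \<le> E j z" unfolding E_def using C by (intro mult_nonneg_nonneg sum_nonneg) auto
          ultimately show "ennreal (F j z) \<le> ennreal (H z) + ennreal (E j z)"
            by (simp add: ennreal_leI flip: ennreal_plus)
        qed
      qed
    qed
    show "AE z in lebesgue_on Z. (\<lambda>j. ennreal (F j z)) \<longlonglongrightarrow> 0"
    proof (rule AE_lborel_imp_lebesgue_on[OF Z_borel])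
      show "AE z in lborel. z \<in> Z \<longrightarrow> (\<lambda>j. ennreal (F j z)) \<longlonglongrightarrow> 0"
        using Uae
      proof eventually_elim
        case (elim z)
        show ?case
        proof
          assume z: "z \<in> Z"
          then have zO: "snd z \<in> \<Omega>" by auto
          have Ule: "\<bar>Sf (r j) i z - f z\<bar> \<le> U (r j) z" "norm (Sg (r j) i z - g z) \<le> U (r j) z" if "i < k" for i j
          proof -
            have "\<bar>Sf (r j) i z - f z\<bar> + norm (Sg (r j) i z - g z) \<le> U (r j) z"
              unfolding U_def using that by (intro member_le_sum[of i "{..<k}" "\<lambda>i. \<bar>Sf (r j) i z - f z\<bar> + norm (Sg (r j) i z - g z)"]) auto
            then show "\<bar>Sf (r j) i z - f z\<bar> \<le> U (r j) z" "norm (Sg (r j) i z - g z) \<le> U (r j) z"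
              using norm_ge_zero[of "Sg (r j) i z - g z"] abs_ge_zero[of "Sf (r j) i z - f z"] by linarith+
          qed
          have Sfl: "(\<lambda>j. Sf (r j) i z) \<longlonglongrightarrow> f z" if "i < k" for i
            by (rule LIM_zero_cancel, rule Lim_null_comparison[OF _ elim]) (use Ule(1)[OF that] in auto)
          have Sgl: "(\<lambda>j. Sg (r j) i z) \<longlonglongrightarrow> g z" if "i < k" for i
            by (rule LIM_zero_cancel, rule Lim_null_comparison[OF _ elim]) (use Ule(2)[OF that] in auto)
          \<comment> \<open>The limits of the mollified quantities are the same for all shifts, so
            the sums reduce to the total weight 1 and the total gradient 0 of the partition.\<close>
          have "(\<lambda>j. V j z) \<longlonglongrightarrow> (\<Sum>i<k. (\<theta> i (snd z) * cos (f z / l)) *\<^sub>R g z) + (\<Sum>i<k. (l * sin (f z / l)) *\<^sub>R grad (\<theta> i) (snd z))"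
            unfolding V_def approximant_grad_def v_def Sf_def[symmetric] Sg_def[symmetric]
            by (intro tendsto_add tendsto_sum tendsto_scaleR tendsto_mult tendsto_const tendsto_sin tendsto_cos tendsto_divide Sfl Sgl) (use l in auto)
          also have "(\<Sum>i<k. (\<theta> i (snd z) * cos (f z / l)) *\<^sub>R g z) + (\<Sum>i<k. (l * sin (f z / l)) *\<^sub>R grad (\<theta> i) (snd z)) = cos (f z / l) *\<^sub>R g z"
            using \<theta>1[OF zO] grad_partition_sum[OF \<Omega>(1) zO \<theta> \<theta>1]
            by (simp flip: scaleR_sum_left scaleR_sum_right sum_distrib_right)
          finally have Vl: "(\<lambda>j. V j z) \<longlonglongrightarrow> cos (f z / l) *\<^sub>R g z" .
          have "(\<lambda>j. (V j z - cos (f z / l) *\<^sub>R g z) /\<^sub>R (8 * \<kappa>)) \<longlonglongrightarrow> (cos (f z / l) *\<^sub>R g z - cos (f z / l) *\<^sub>R g z) /\<^sub>R (8 * \<kappa>)"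
            by (intro tendsto_scaleR tendsto_diff tendsto_const Vl)
          then have t0: "(\<lambda>j. (V j z - cos (f z / l) *\<^sub>R g z) /\<^sub>R (8 * \<kappa>)) \<longlonglongrightarrow> 0" by simp
          have "isCont (M (fst z) (snd z)) 0"
            using even_convex_facts(3)[OF M_facts[OF z]] by (simp add: continuous_on_eq_continuous_at)
          from isCont_tendsto_compose[OF this t0] have "(\<lambda>j. F j z) \<longlonglongrightarrow> 0" using M_facts(3)[OF z] by (simp add: F_def)
          from tendsto_ennrealI[OF this] show "(\<lambda>j. ennreal (F j z)) \<longlonglongrightarrow> 0" by simp
        qed
      qed
    qed
  qed
  then have ev1: "eventually (\<lambda>j. (\<integral>\<^sup>+z. ennreal (F j z) \<partial>lebesgue_on Z) < ennreal \<eta>) sequentially"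
    using \<eta> by (intro order_tendstoD(2)) auto
  have ev2: "eventually (\<lambda>j. real k * (2 / real (Suc j)) < \<eta>) sequentially"
    using k0 \<eta> by (rule order_tendstoD(2))
  obtain j where j: "(\<integral>\<^sup>+z. ennreal (F j z) \<partial>lebesgue_on Z) < ennreal \<eta>" "real k * (2 / real (Suc j)) < \<eta>"
    using eventually_happens[OF eventually_conj[OF ev1 ev2]] by auto
  have gV: "AE z in lebesgue_on Z. grad (\<Phi> j (fst z)) (snd z) = V j z"
    by (rule AE_lborel_imp_lebesgue_on[OF Z_borel gradV])
  show ?thesis
  proof (intro exI[of _ "\<Phi> j"] exI[of _ "V j"] conjI)
    show "in_Linf_Cc T \<Omega> (\<Phi> j)" by (rule Linf)
    show "(\<integral>\<^sup>+z. ennreal \<bar>\<Phi> j (fst z) (snd z) - l * sin (f z / l)\<bar> \<partial>lebesgue_on Z) \<le> ennreal \<eta>"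
      by (rule order_trans[OF L1 ennreal_leI]) (use j in simp)
    show "(\<integral>\<^sup>+z. ennreal (M (fst z) (snd z) ((V j z - cos (f z / l) *\<^sub>R g z) /\<^sub>R (8 * \<kappa>))) \<partial>lebesgue_on Z) \<le> ennreal \<eta>"
      using j(1) by (simp add: F_def)
    show "V j \<in> borel_measurable borel" by (rule Vb)
    show "AE z in lebesgue_on Z. grad (\<Phi> j (fst z)) (snd z) = V j z" by (rule gV)
    show "\<forall>t x b. x \<in> \<Omega> \<longrightarrow> (AE y in lborel. \<bar>f (t, y)\<bar> \<le> b) \<longrightarrow> \<bar>\<Phi> j t x\<bar> \<le> b" using bound by blast
  qed
qed

end

subsection \<open>Borel representatives and growth\<close>

text \<open>The hypotheses concern Lebesgue measurable functions on a cylinder, while sections and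
  Fubini are used for Borel functions on the whole space. Vanishing outside \<open>Z\<close> makes
  the representative the extension by zero.\<close>

lemma borel_representative_real:
  fixes u :: "'a::euclidean_space \<Rightarrow> real"
  assumes Z: "Z \<in> sets borel" and u: "u \<in> borel_measurable (lebesgue_on Z)"
  shows "\<exists>f\<in>borel_measurable borel. (\<forall>z. z \<notin> Z \<longrightarrow> f z = 0) \<and> (AE z in lborel. z \<in> Z \<longrightarrow> f z = u z)"
proof -
  have "(\<lambda>z. indicator Z z *\<^sub>R u z) \<in> borel_measurable lebesgue"
    using u Z by (subst (asm) borel_measurable_restrict_space_iff) auto
  from completion_ex_borel_measurable_real[OF this]
  obtain h where h: "h \<in> borel_measurable lborel" "AE z in lborel. indicator Z z *\<^sub>R u z = h z" by blast
  show ?thesis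
  proof (intro bexI[of _ "\<lambda>z. indicator Z z * h z"] conjI allI impI)
    show "AE z in lborel. z \<in> Z \<longrightarrow> indicator Z z * h z = u z" using h(2) by eventually_elim auto
    show "(\<lambda>z. indicator Z z * h z) \<in> borel_measurable borel" using h(1) Z by measurable
  qed auto
qed

lemma borel_representative_vec:
  fixes u :: "'a::euclidean_space \<Rightarrow> real^'n"
  assumes Z: "Z \<in> sets borel" and u: "u \<in> borel_measurable (lebesgue_on Z)"
  shows "\<exists>f\<in>borel_measurable borel. (\<forall>z. z \<notin> Z \<longrightarrow> f z = 0) \<and> (AE z in lborel. z \<in> Z \<longrightarrow> f z = u z)"
proof -
  have "(\<lambda>z. u z $ i) \<in> borel_measurable (lebesgue_on Z)" for i
    using borel_measurable_continuous_on[OF _ u, of "\<lambda>v. v $ i"] by (simp add: continuous_on_component)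
  then have "\<forall>i. \<exists>f. f \<in> borel_measurable borel \<and> (\<forall>z. z \<notin> Z \<longrightarrow> f z = 0) \<and> (AE z in lborel. z \<in> Z \<longrightarrow> f z = u z $ i)"
    using borel_representative_real[OF Z] by blast
  then obtain f where f: "\<And>i. f i \<in> borel_measurable borel" "\<And>i z. z \<notin> Z \<Longrightarrow> f i z = 0" "\<And>i. AE z in lborel. z \<in> Z \<longrightarrow> f i z = u z $ i"
    by metis
  show ?thesis
  proof (intro bexI[of _ "\<lambda>z. \<chi> i. f i z"] conjI allI impI)
    show "(\<lambda>z. \<chi> i. f i z) \<in> borel_measurable borel"
      using f(1) by (subst borel_measurable_euclidean_space) (auto simp: Basis_vec_def inner_axis)
    show "(\<chi> i. f i z) = 0" if "z \<notin> Z" for z using f(2)[OF that] by (simp add: vec_eq_iff)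
    have "AE z in lborel. \<forall>i\<in>UNIV. z \<in> Z \<longrightarrow> f i z = u z $ i" using f(3) by (intro AE_finite_allI) auto
    then show "AE z in lborel. z \<in> Z \<longrightarrow> (\<chi> i. f i z) = u z" by eventually_elim (auto simp: vec_eq_iff)
  qed
qed

lemma nn_integral_representative:
  fixes f u :: "'a::euclidean_space \<Rightarrow> 'b::real_normed_vector"
  assumes Z: "Z \<in> sets borel" and f: "\<And>z. z \<notin> Z \<Longrightarrow> f z = 0" and fu: "AE z in lborel. z \<in> Z \<longrightarrow> f z = u z"
  shows "(\<integral>\<^sup>+z. ennreal (norm (f z)) \<partial>lborel) = (\<integral>\<^sup>+z. ennreal (norm (u z)) \<partial>lebesgue_on Z)"
proof -
  have "(\<integral>\<^sup>+z. ennreal (norm (u z)) \<partial>lebesgue_on Z) = (\<integral>\<^sup>+z. ennreal (norm (u z)) * indicator Z z \<partial>lebesgue)"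
    using Z by (simp add: nn_integral_restrict_space)
  also have "\<dots> = (\<integral>\<^sup>+z. ennreal (norm (f z)) \<partial>lebesgue)"
  proof (rule nn_integral_cong_AE)
    show "AE z in lebesgue. ennreal (norm (u z)) * indicator Z z = ennreal (norm (f z))"
      using AE_completion[OF fu]
    proof eventually_elim
      case (elim z)
      then show ?case using f[of z] by (auto simp: indicator_def)
    qed
  qed
  also have "\<dots> = (\<integral>\<^sup>+z. ennreal (norm (f z)) \<partial>lborel)" by (simp add: nn_integral_completion)
  finally show ?thesis by simp
qed

section \<open>Limits of the truncation and superlinear growth\<close>

lemma tendsto_scaled_sin: "(\<lambda>n. real (Suc n) * sin (x / real (Suc n))) \<longlonglongrightarrow> x"
proof (cases "x = 0")
  case False
  have "((\<lambda>h. sin h / h) \<longlongrightarrow> 1) (at (0::real))" using DERIV_sin[of 0] by (simp add: DERIV_def)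
  moreover have "(\<lambda>n. x / real (Suc n)) \<longlonglongrightarrow> 0"
    using tendsto_mult_right_zero[OF LIMSEQ_inverse_real_of_nat, of x] by (simp add: divide_inverse)
  then have "filterlim (\<lambda>n. x / real (Suc n)) (at 0) sequentially" using False by (simp add: filterlim_at)
  ultimately have "(\<lambda>n. sin (x / real (Suc n)) / (x / real (Suc n))) \<longlonglongrightarrow> 1" by (rule filterlim_compose)
  from tendsto_mult_left[OF this, of x] False show ?thesis by (simp add: mult.commute)
qed simp

lemma tendsto_cos_scaled: "(\<lambda>n. cos (x / real (Suc n))) \<longlonglongrightarrow> 1"
proof -
  have "(\<lambda>n. x / real (Suc n)) \<longlonglongrightarrow> 0"
    using tendsto_mult_right_zero[OF LIMSEQ_inverse_real_of_nat, of x] by (simp add: divide_inverse)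
  from tendsto_cos[OF this] show ?thesis by simp
qed

text \<open>The essential infimum yields the bound for one vector at a time; density and continuity
  in the vector then give a common null set.\<close>

lemma superlinear_growth_AE:
  fixes \<Omega> :: "(real^'n) set"
  assumes N: "N_function T \<Omega> M" and \<Omega>: "open \<Omega>"
  shows "\<exists>R. AE z in lborel. z \<in> {0..T} \<times> \<Omega> \<longrightarrow> (\<forall>\<xi>. R < norm \<xi> \<longrightarrow> norm \<xi> \<le> M (fst z) (snd z) \<xi>)"
proof -
  let ?A = "{0..T} \<times> \<Omega>"
  have A: "?A \<in> sets borel" using \<Omega> by (intro borel_Times) auto
  have "((\<lambda>\<xi>. ess_inf_on ?A (\<lambda>z. M (fst z) (snd z) \<xi> / norm \<xi>)) \<longlongrightarrow> \<infinity>) at_infinity"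
    using N by (simp add: N_function_def)
  then have "eventually (\<lambda>\<xi>. 1 < ess_inf_on ?A (\<lambda>z. M (fst z) (snd z) \<xi> / norm \<xi>)) at_infinity"
    by (rule order_tendstoD(1)) simp
  then obtain R where R: "\<And>\<xi>. R \<le> norm \<xi> \<Longrightarrow> 1 < ess_inf_on ?A (\<lambda>z. M (fst z) (snd z) \<xi> / norm \<xi>)"
    unfolding eventually_at_infinity by blast
  obtain D :: "(real^'n) set" where D: "countable D" "\<And>U. open U \<Longrightarrow> U \<noteq> {} \<Longrightarrow> \<exists>d\<in>D. d \<in> U"
    using countable_dense_setE by blast
  \<comment> \<open>\<open>R\<close> may be negative; the maximum with 0 keeps the vector away from
    0, so that the division by its norm can be undone.\<close>
  have pt: "AE z in lborel. z \<in> ?A \<longrightarrow> max R 0 < norm \<xi> \<longrightarrow> norm \<xi> \<le> M (fst z) (snd z) \<xi>" for \<xi>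
  proof (cases "max R 0 < norm \<xi>")
    case True
    have "AE z in lborel. z \<in> ?A \<longrightarrow> ess_inf_on ?A (\<lambda>z. M (fst z) (snd z) \<xi> / norm \<xi>) \<le> ereal (M (fst z) (snd z) \<xi> / norm \<xi>)"
      using ess_inf_on_le_AE[of ?A "\<lambda>z. M (fst z) (snd z) \<xi> / norm \<xi>"] AE_lebesgue_on_iff[OF A] by simp
    then show ?thesis
    proof eventually_elim
      case (elim z)
      show ?case
      proof (intro impI)
        assume "z \<in> ?A"
        then have "ess_inf_on ?A (\<lambda>z. M (fst z) (snd z) \<xi> / norm \<xi>) \<le> ereal (M (fst z) (snd z) \<xi> / norm \<xi>)"
          by (rule elim[THEN mp])
        moreover have "1 < ess_inf_on ?A (\<lambda>z. M (fst z) (snd z) \<xi> / norm \<xi>)" using R[of \<xi>] True by simp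
        ultimately have "1 < ereal (M (fst z) (snd z) \<xi> / norm \<xi>)" by (rule less_le_trans[rotated])
        then have "1 < M (fst z) (snd z) \<xi> / norm \<xi>" by (simp add: one_ereal_def)
        then show "norm \<xi> \<le> M (fst z) (snd z) \<xi>" using True by (simp add: less_divide_eq)
      qed
    qed
  next
    case False
    then show ?thesis by (intro AE_I2) blast
  qed
  have "AE z in lborel. \<forall>\<xi>\<in>D. z \<in> ?A \<longrightarrow> max R 0 < norm \<xi> \<longrightarrow> norm \<xi> \<le> M (fst z) (snd z) \<xi>"
    unfolding AE_ball_countable[OF D(1)] by (intro ballI pt)
  then have "AE z in lborel. z \<in> ?A \<longrightarrow> (\<forall>\<xi>. max R 0 < norm \<xi> \<longrightarrow> norm \<xi> \<le> M (fst z) (snd z) \<xi>)"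
  proof eventually_elim
    case (elim z)
    show ?case
    proof (intro impI allI)
      fix \<xi> :: "real^'n" assume z: "z \<in> ?A" and \<xi>: "max R 0 < norm \<xi>"
      have "convex_on UNIV (M (fst z) (snd z))" using N z unfolding N_function_def by auto
      then have c: "continuous_on UNIV (M (fst z) (snd z))" by (rule convex_on_continuous[OF open_UNIV])
      have o: "open {\<xi>::real^'n. max R 0 < norm \<xi>}" by (intro open_Collect_less continuous_intros)
      show "norm \<xi> \<le> M (fst z) (snd z) \<xi>"
        by (rule countable_dense_le[OF D(2) continuous_on_norm_id c o]) (use elim z \<xi> in auto)
    qed
  qed
  then show ?thesis by blast
qed

text \<open>Condition (M) is the case \<open>q = 1\<close> of condition (Mp): superlinearity supplies the lower bound.\<close>

lemma growth_condition:
  fixes \<Omega> :: "(real^'n) set"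
  assumes N: "N_function T \<Omega> M" and \<Omega>: "open \<Omega>" and c: "cond_M T \<Omega> M \<or> cond_Mp T \<Omega> M"
  obtains q c0 R \<Theta> \<xi>0 \<delta>0 where "1 \<le> q" "0 < c0" "Theta_ok \<Theta>"
    "Limsup (at_right 0) (\<lambda>\<delta>. ereal (\<Theta> \<delta> (\<delta> powr (- real CARD('n) / q)))) < \<infinity>" "M_ineq T \<Omega> M \<Theta> \<xi>0 \<delta>0"
    "AE z in lborel. z \<in> {0..T} \<times> \<Omega> \<longrightarrow> (\<forall>\<xi>. R < norm \<xi> \<longrightarrow> c0 * norm \<xi> powr q \<le> M (fst z) (snd z) \<xi>)"
  using c
proof
  assume "cond_M T \<Omega> M"
  then obtain \<Theta> \<xi>0 \<delta>0 where *: "Theta_ok \<Theta>" "Limsup (at_right 0) (\<lambda>\<delta>. ereal (\<Theta> \<delta> (\<delta> powr (- real CARD('n))))) < \<infinity>" "M_ineq T \<Omega> M \<Theta> \<xi>0 \<delta>0"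
    unfolding cond_M_def by blast
  obtain R where R: "AE z in lborel. z \<in> {0..T} \<times> \<Omega> \<longrightarrow> (\<forall>\<xi>. R < norm \<xi> \<longrightarrow> norm \<xi> \<le> M (fst z) (snd z) \<xi>)"
    using superlinear_growth_AE[OF N \<Omega>] by blast
  show thesis
  proof (rule that[of 1 1 \<Theta> \<xi>0 \<delta>0 R])
    show "AE z in lborel. z \<in> {0..T} \<times> \<Omega> \<longrightarrow> (\<forall>\<xi>. R < norm \<xi> \<longrightarrow> 1 * norm \<xi> powr 1 \<le> M (fst z) (snd z) \<xi>)"
      using R by simp
  qed (use * in simp_all)
next
  assume "cond_Mp T \<Omega> M"
  then obtain p c_gr \<xi>p \<Theta> \<xi>0 \<delta>0 where *: "1 < p" "0 < c_gr"
     "\<forall>t\<in>{0..T}. \<forall>x\<in>\<Omega>. \<forall>\<xi>. norm \<xi> > norm (\<xi>p::real^'n) \<longrightarrow> c_gr * norm \<xi> powr p \<le> M t x \<xi>"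
     "Theta_ok \<Theta>" "Limsup (at_right 0) (\<lambda>\<delta>. ereal (\<Theta> \<delta> (\<delta> powr (- real CARD('n) / p)))) < \<infinity>" "M_ineq T \<Omega> M \<Theta> \<xi>0 \<delta>0"
    unfolding cond_Mp_def by blast
  show thesis
    by (rule that[of p c_gr \<Theta> \<xi>0 \<delta>0 "norm \<xi>p"]) (use * in auto)
qed

subsection \<open>Cutting off exceptional times\<close>

context smooth_truncation
begin

text \<open>The level is compared with \<open>norm (g z)\<close>, while the value is scaled by
  \<open>\<kappa>\<close>; accordingly the complementary part of
  \<open>g z /\<^sub>R \<kappa>\<close> has norm at most \<open>n / \<kappa>\<close>.\<close>

definition large_part :: "real \<Rightarrow> (real \<times> (real^'n) \<Rightarrow> real^'n) \<Rightarrow> real \<times> (real^'n) \<Rightarrow> real" where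
  "large_part n g z = norm (if n < norm (g z) then g z /\<^sub>R \<kappa> else 0) powr q"

text \<open>The last bound is what gives \<open>norm (shift_mollify K v \<xi> z) \<le> \<delta> powr (- N / q)\<close> for the part \<open>\<xi>\<close> of
  \<open>g\<close> above level \<open>n\<close> when the mollification scale is \<open>\<delta> / (A + 1)\<close>. The exceptional times are discarded
  by setting the function to 0 there, which is harmless since nothing is required of it in time.\<close>

definition good_times :: "nat \<Rightarrow> (real \<times> (real^'n) \<Rightarrow> real) \<Rightarrow> (real \<times> (real^'n) \<Rightarrow> real^'n) \<Rightarrow> (real \<times> (real^'n) \<Rightarrow> real) \<Rightarrow> real set" where
  "good_times n f g m = {t. (\<integral>\<^sup>+y. ennreal \<bar>f (t, y)\<bar> \<partial>lborel) \<le> ennreal (real n) \<and> (\<integral>\<^sup>+y. ennreal (norm (g (t, y))) \<partial>lborel) \<le> ennreal (real n) \<and>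
     (\<integral>\<^sup>+y. ennreal (m (t, y)) \<partial>lborel) \<le> ennreal (real n) \<and>
     (\<integral>\<^sup>+y. ennreal (large_part (real n) g (t, y)) \<partial>lborel) \<le> ennreal (1 / (B * (A + 1) ^ CARD('n)))}"

lemma measurable_large_part [measurable]: "g \<in> borel_measurable borel \<Longrightarrow> large_part n g \<in> borel_measurable borel"
  unfolding large_part_def[abs_def] by measurable

lemma good_times_borel:
  assumes [measurable]: "f \<in> borel_measurable borel" "g \<in> borel_measurable borel" "m \<in> borel_measurable borel"
  shows "good_times n f g m \<in> sets borel"
proof -
  have [measurable]: "(\<lambda>t. \<integral>\<^sup>+y. ennreal (h (t, y)) \<partial>lborel) \<in> borel_measurable borel" if [measurable]: "h \<in> borel_measurable borel"
    for h :: "real \<times> (real^'n) \<Rightarrow> real"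
    by (rule lborel.borel_measurable_nn_integral) measurable
  have [measurable]: "(\<lambda>t. \<integral>\<^sup>+y. ennreal \<bar>f (t, y)\<bar> \<partial>lborel) \<in> borel_measurable borel"
    "(\<lambda>t. \<integral>\<^sup>+y. ennreal (norm (g (t, y))) \<partial>lborel) \<in> borel_measurable borel"
    by (rule lborel.borel_measurable_nn_integral, measurable)+
  show ?thesis unfolding good_times_def by measurable
qed

text \<open>Sections of integrable functions are integrable at almost every time, which settles
  three of the four conditions for large n. For the last one the large part tends to 0 pointwise and
  is dominated by \<open>m (t, y) / c0\<close>, thanks to the growth bound.\<close>

lemma good_times_eventually:
  assumes f: "integrable lborel f" and g: "integrable lborel g" and m: "integrable lborel m" and m0: "\<And>z. 0 \<le> m z"
    and c0: "0 < c0" and gr: "AE z in lborel. R < norm (g z /\<^sub>R \<kappa>) \<longrightarrow> c0 * norm (g z /\<^sub>R \<kappa>) powr q \<le> m z"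
  shows "AE t in lborel. eventually (\<lambda>n. t \<in> good_times n f g m) sequentially"
proof -
  have [measurable]: "f \<in> borel_measurable borel" "g \<in> borel_measurable borel" "m \<in> borel_measurable borel" using f g m by auto
  have sec: "AE t in lborel. integrable lborel (\<lambda>y. h (t, y))" if "integrable lborel h"
    for h :: "real \<times> (real^'n) \<Rightarrow> 'b::{banach,second_countable_topology}"
    by (rule lborel_pair.AE_integrable_fst') (use that in \<open>simp only: lborel_prod\<close>)
  have ev: "eventually (\<lambda>n. x \<le> ennreal (real n)) sequentially" if x: "x < \<infinity>" for x
  proof -
    obtain r where "x = ennreal r" using x by (cases x) auto
    moreover obtain k where "r \<le> real k" using real_arch_simple by blast
    ultimately have k: "x \<le> ennreal (real k)" by (simp add: ennreal_leI)
    show ?thesis using eventually_ge_at_top[of k]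
      by eventually_elim (rule order_trans[OF k], simp add: ennreal_leI)
  qed
  show ?thesis
    using sec[OF f] sec[OF g] sec[OF m] AE_lborel_sections[OF gr]
  proof eventually_elim
    case (elim t)
    have e1: "eventually (\<lambda>n. (\<integral>\<^sup>+y. ennreal \<bar>f (t, y)\<bar> \<partial>lborel) \<le> ennreal (real n)) sequentially"
      by (rule ev) (use elim(1) in \<open>simp add: integrable_iff_bounded\<close>)
    have e2: "eventually (\<lambda>n. (\<integral>\<^sup>+y. ennreal (norm (g (t, y))) \<partial>lborel) \<le> ennreal (real n)) sequentially"
      by (rule ev) (use elim(2) in \<open>simp add: integrable_iff_bounded\<close>)
    have mfin: "(\<integral>\<^sup>+y. ennreal (m (t, y)) \<partial>lborel) < \<infinity>"
      using elim(3) m0 by (simp add: integrable_iff_bounded)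
    have e3: "eventually (\<lambda>n. (\<integral>\<^sup>+y. ennreal (m (t, y)) \<partial>lborel) \<le> ennreal (real n)) sequentially"
      by (rule ev[OF mfin])
    \<comment> \<open>Above the level \<open>\<kappa> * R\<close> the rescaled gradient exceeds
      \<open>R\<close>, where the growth bound applies; hence the offset \<open>n1\<close>.\<close>
    obtain n1 :: nat where n1: "\<kappa> * R \<le> real n1" using real_arch_simple by blast
    have "(\<lambda>n. \<integral>\<^sup>+y. ennreal (large_part (real (n + n1)) g (t, y)) \<partial>lborel) \<longlonglongrightarrow> (\<integral>\<^sup>+y. 0 \<partial>(lborel :: (real^'n) measure))"
    proof (rule nn_integral_dominated_convergence[where w="\<lambda>y. ennreal (m (t, y) / c0)"])
      show "AE y in lborel. ennreal (large_part (real (n + n1)) g (t, y)) \<le> ennreal (m (t, y) / c0)" for n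
        using elim(4)
      proof eventually_elim
        case (elim y)
        show ?case
        proof (rule ennreal_leI, cases "real (n + n1) < norm (g (t, y))")
          case True
          then have "\<kappa> * R < norm (g (t, y))" using n1 by simp
          then have "R < norm (g (t, y) /\<^sub>R \<kappa>)" using \<kappa> by (simp add: field_simps)
          then show "large_part (real (n + n1)) g (t, y) \<le> m (t, y) / c0"
            using elim True c0 by (simp add: large_part_def le_divide_eq mult.commute)
        next
          case False
          then show "large_part (real (n + n1)) g (t, y) \<le> m (t, y) / c0" using m0[of "(t, y)"] c0 by (simp add: large_part_def)
        qed
      qed
      have "(\<integral>\<^sup>+y. ennreal (m (t, y) / c0) \<partial>lborel) = (\<integral>\<^sup>+y. ennreal (1 / c0) * ennreal (m (t, y)) \<partial>lborel)"
        using c0 m0 by (intro nn_integral_cong) (simp flip: ennreal_mult)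
      also have "\<dots> < \<infinity>" using mfin by (subst nn_integral_cmult) (auto simp: ennreal_mult_less_top)
      finally show "(\<integral>\<^sup>+y. ennreal (m (t, y) / c0) \<partial>lborel) < \<infinity>" .
      show "AE y in lborel. (\<lambda>n. ennreal (large_part (real (n + n1)) g (t, y))) \<longlonglongrightarrow> 0"
      proof (intro AE_I2 tendsto_eventually)
        fix y
        obtain n2 :: nat where n2: "norm (g (t, y)) \<le> real n2" using real_arch_simple by blast
        show "eventually (\<lambda>n. ennreal (large_part (real (n + n1)) g (t, y)) = 0) sequentially"
          using eventually_ge_at_top[of n2] by eventually_elim (use n2 in \<open>simp add: large_part_def\<close>)
      qed
    qed measurable
    then have "(\<lambda>n. \<integral>\<^sup>+y. ennreal (large_part (real n) g (t, y)) \<partial>lborel) \<longlonglongrightarrow> 0"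
      by (simp only: nn_integral_const mult_zero_left) (rule LIMSEQ_offset)
    then have "eventually (\<lambda>n. (\<integral>\<^sup>+y. ennreal (large_part (real n) g (t, y)) \<partial>lborel) < ennreal (1 / (B * (A + 1) ^ CARD('n)))) sequentially"
      by (rule order_tendstoD(2)) (use A(1) B(1) in simp)
    then show ?case using e1 e2 e3
      by eventually_elim (simp add: good_times_def less_imp_le)
  qed
qed

text \<open>Multiplication by an indicator in time commutes with the spatial gradient. It makes the
  requirements on sections hold at every time: by definition of the good times, and trivially at the
  discarded ones. The truncation \<open>real (Suc n)\<close> lets one index drive both limits and is
  never 0.\<close>

lemma cutoff_smooth_approximation:
  fixes \<phi> :: "real \<Rightarrow> real^'n \<Rightarrow> real" and G :: "real \<Rightarrow> real^'n \<Rightarrow> real^'n"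
  assumes f: "integrable lborel f" "\<And>z. z \<notin> Z \<Longrightarrow> f z = 0" and fu: "AE z in lborel. z \<in> Z \<longrightarrow> f z = \<phi> (fst z) (snd z)"
    and g: "integrable lborel g" "\<And>z. z \<notin> Z \<Longrightarrow> g z = 0" and gu: "AE z in lborel. z \<in> Z \<longrightarrow> g z = G (fst z) (snd z)"
    and m: "integrable lborel m" "\<And>z. 0 \<le> m z"
    and gm: "AE z in lborel. z \<in> Z \<longrightarrow> M (fst z) (snd z) (g z /\<^sub>R \<kappa>) \<le> m z"
    and W: "AE t in lborel. t \<in> {0<..<T} \<longrightarrow> W011_0 \<Omega> (\<phi> t) (G t)"
    and \<eta>: "0 < \<eta>"
  defines "fn \<equiv> \<lambda>n z. indicat_real (good_times n f g m) (fst z) * f z"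
    and "gn \<equiv> \<lambda>n z. indicat_real (good_times n f g m) (fst z) *\<^sub>R g z"
  shows "\<exists>\<Phi> V. in_Linf_Cc T \<Omega> \<Phi> \<and> V \<in> borel_measurable borel \<and>
    (AE z in lebesgue_on Z. grad (\<Phi> (fst z)) (snd z) = V z) \<and>
    (\<integral>\<^sup>+z. ennreal \<bar>\<Phi> (fst z) (snd z) - real (Suc n) * sin (fn n z / real (Suc n))\<bar> \<partial>lebesgue_on Z) \<le> ennreal \<eta> \<and>
    (\<integral>\<^sup>+z. ennreal (M (fst z) (snd z) ((V z - cos (fn n z / real (Suc n)) *\<^sub>R gn n z) /\<^sub>R (8 * \<kappa>))) \<partial>lebesgue_on Z) \<le> ennreal \<eta> \<and>
    (\<forall>t x b. x \<in> \<Omega> \<longrightarrow> (AE y in lborel. \<bar>fn n (t, y)\<bar> \<le> b) \<longrightarrow> \<bar>\<Phi> t x\<bar> \<le> b)"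
proof -
  have [measurable]: "f \<in> borel_measurable borel" "g \<in> borel_measurable borel" "m \<in> borel_measurable borel" using f(1) g(1) m(1) by auto
  let ?A = "good_times n f g m"
  have [measurable]: "?A \<in> sets borel" by (rule good_times_borel) measurable
  let ?i = "indicat_real ?A"
  define mn where "mn z = ?i (fst z) * m z" for z
  have [measurable]: "fn n \<in> borel_measurable borel" "gn n \<in> borel_measurable borel" "mn \<in> borel_measurable borel"
    unfolding fn_def gn_def mn_def[abs_def] by measurable
  have le_top: "x \<le> ennreal r \<Longrightarrow> x < \<infinity>" for x r by (auto intro: le_less_trans)
  have sf: "integrable lborel (\<lambda>y. f (t, y))" and sg: "integrable lborel (\<lambda>y. g (t, y))" and sm: "integrable lborel (\<lambda>y. m (t, y))"
    and sl: "integrable lborel (\<lambda>y. large_part (real n) g (t, y))" if "t \<in> ?A" for t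
    using that m(2) unfolding good_times_def integrable_iff_bounded by (auto simp: large_part_def dest: le_top)
  have sec: "integrable lborel (\<lambda>y. fn n (t, y))" "integrable lborel (\<lambda>y. gn n (t, y))" "integrable lborel (\<lambda>y. mn (t, y))" for t
    by (cases "t \<in> ?A"; simp add: fn_def gn_def mn_def sf sg sm)+
  have int: "integrable lborel (fn n)" "integrable lborel (gn n)" "integrable lborel mn"
    by (rule Bochner_Integration.integrable_bound[OF f(1)], simp, simp add: fn_def indicator_def)
       (rule Bochner_Integration.integrable_bound[OF g(1)], simp, simp add: gn_def indicator_def,
        rule Bochner_Integration.integrable_bound[OF m(1)], simp, simp add: mn_def indicator_def)
  have lp: "norm (if real n < norm (gn n (t, y)) then gn n (t, y) /\<^sub>R \<kappa> else 0) powr q = ?i t * large_part (real n) g (t, y)" for t y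
    by (cases "t \<in> ?A") (simp_all add: gn_def large_part_def)
  show ?thesis
  proof (rule smooth_approximation[where m=mn and n="real n" and D="real n"])
    show "(\<integral>y. \<bar>fn n (t, y)\<bar> \<partial>lborel) \<le> real n" for t
    proof (cases "t \<in> ?A")
      case True
      then have "ennreal (\<integral>y. \<bar>f (t, y)\<bar> \<partial>lborel) \<le> ennreal (real n)"
        using nn_integral_eq_integral[OF integrable_abs[OF sf[OF True]]] by (simp add: good_times_def)
      then show ?thesis using True by (simp add: fn_def)
    qed (simp add: fn_def)
    show "AE z in lborel. z \<in> Z \<longrightarrow> M (fst z) (snd z) (gn n z /\<^sub>R \<kappa>) \<le> mn z"
      using gm
    proof eventually_elim
      case (elim z)
      then show ?case using M_facts(3)[of z] by (auto simp: gn_def mn_def indicator_def)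
    qed
    show "integrable lborel (\<lambda>y. norm (if real n < norm (gn n (t, y)) then gn n (t, y) /\<^sub>R \<kappa> else 0) powr q)" for t
      unfolding lp by (cases "t \<in> ?A") (simp_all add: sl)
    show "(\<integral>y. norm (if real n < norm (gn n (t, y)) then gn n (t, y) /\<^sub>R \<kappa> else 0) powr q \<partial>lborel) \<le> 1 / (B * (A + 1) ^ CARD('n))" for t
    proof (cases "t \<in> ?A")
      case True
      have "ennreal (\<integral>y. large_part (real n) g (t, y) \<partial>lborel) \<le> ennreal (1 / (B * (A + 1) ^ CARD('n)))"
        using nn_integral_eq_integral[OF sl[OF True]] True by (simp add: good_times_def large_part_def)
      then show ?thesis unfolding lp using True A(1) B(1) by (subst (asm) ennreal_le_iff) auto
    next
      case False
      then show ?thesis unfolding lp using A(1) B(1) by simp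
    qed
    show "AE t in lborel. t \<in> {0<..<T} \<longrightarrow> (\<forall>B e K i x. mollifier B e K \<longrightarrow>
       conv (partial_deriv i K) (\<lambda>y. fn n (t, y)) x = conv K (\<lambda>y. gn n (t, y)) x $ i)"
      using W AE_lborel_sections[OF fu] AE_lborel_sections[OF gu]
    proof eventually_elim
      case (elim t)
      show ?case
      proof (intro impI allI)
        fix B' e i x and K :: "real^'n \<Rightarrow> real"
        assume t: "t \<in> {0<..<T}" and K: "mollifier B' e K"
        show "conv (partial_deriv i K) (\<lambda>y. fn n (t, y)) x = conv K (\<lambda>y. gn n (t, y)) x $ i"
        proof (cases "t \<in> ?A")
          case True
          have a1: "AE y in lborel. f (t, y) = (if y \<in> \<Omega> then \<phi> t y else 0)"
            using elim(2) by eventually_elim (use t f(2) in auto)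
          have a2: "AE y in lborel. g (t, y) = (if y \<in> \<Omega> then G t y else 0)"
            using elim(3) by eventually_elim (use t g(2) in auto)
          have "W011_0 \<Omega> (\<phi> t) (G t)" using elim(1) t by blast
          from conv_W011_0[OF K this \<Omega>(1) sf[OF True] sg[OF True] a1 a2]
          show ?thesis using True by (simp add: fn_def gn_def)
        qed (simp add: fn_def gn_def conv_def)
      qed
    qed
  qed (use int sec f(2) g(2) m(2) \<eta> in \<open>auto simp: fn_def gn_def mn_def\<close>)
qed

text \<open>Cutoff and truncation are removed by letting n grow: at almost every z the time is
  eventually good, and the majorants are \<open>2 * \<bar>f z\<bar>\<close> for the function and
  \<open>m z\<close> for the modular. One more midpoint inequality, between the error of this limit
  and that of the vanishing scale, turns \<open>8 * \<kappa>\<close> into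
  \<open>16 * \<kappa>\<close>.\<close>

lemma smooth_approximation_in_V:
  assumes V: "in_V T \<Omega> M \<phi> G"
    and fin: "(\<integral>\<^sup>+z. ennreal (M (fst z) (snd z) (G (fst z) (snd z) /\<^sub>R \<kappa>)) \<partial>lebesgue_on Z) < \<infinity>"
    and c0: "0 < c0" and gr: "AE z in lborel. z \<in> {0..T} \<times> \<Omega> \<longrightarrow> (\<forall>\<xi>. R < norm \<xi> \<longrightarrow> c0 * norm \<xi> powr q \<le> M (fst z) (snd z) \<xi>)"
    and \<eta>: "0 < \<eta>"
  shows "\<exists>\<Phi>. in_Linf_Cc T \<Omega> \<Phi> \<and>
    (\<integral>\<^sup>+z. ennreal \<bar>\<Phi> (fst z) (snd z) - \<phi> (fst z) (snd z)\<bar> \<partial>lebesgue_on Z) \<le> ennreal \<eta> \<and>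
    (\<integral>\<^sup>+z. ennreal (M (fst z) (snd z) ((grad (\<Phi> (fst z)) (snd z) - G (fst z) (snd z)) /\<^sub>R (16 * \<kappa>))) \<partial>lebesgue_on Z) \<le> ennreal \<eta> \<and>
    Linf_norm T \<Omega> \<Phi> \<le> Linf_norm T \<Omega> \<phi>"
proof -
  let ?\<phi> = "\<lambda>z. \<phi> (fst z) (snd z)" and ?G = "\<lambda>z. G (fst z) (snd z)"
  have \<phi>m: "?\<phi> \<in> borel_measurable (lebesgue_on Z)" and Gm: "?G \<in> borel_measurable (lebesgue_on Z)"
    and sum: "(\<integral>\<^sup>+z. ennreal (\<bar>?\<phi> z\<bar> + norm (?G z)) \<partial>lebesgue_on Z) < \<infinity>"
    and W0: "AE t in lebesgue_on {0<..<T}. W011_0 \<Omega> (\<phi> t) (G t)" using V by (auto simp: in_V_def)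
  have W: "AE t in lborel. t \<in> {0<..<T} \<longrightarrow> W011_0 \<Omega> (\<phi> t) (G t)" using W0 by (subst (asm) AE_lebesgue_on_iff) auto
  obtain f where f[measurable]: "f \<in> borel_measurable borel" and f0: "\<And>z. z \<notin> Z \<Longrightarrow> f z = 0" and fu: "AE z in lborel. z \<in> Z \<longrightarrow> f z = ?\<phi> z"
    using borel_representative_real[OF Z_borel \<phi>m] by blast
  obtain g where g[measurable]: "g \<in> borel_measurable borel" and g0: "\<And>z. z \<notin> Z \<Longrightarrow> g z = 0" and gu: "AE z in lborel. z \<in> Z \<longrightarrow> g z = ?G z"
    using borel_representative_vec[OF Z_borel Gm] by blast
  have um: "(\<lambda>z. M (fst z) (snd z) (?G z /\<^sub>R \<kappa>)) \<in> borel_measurable (lebesgue_on Z)"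
    by (rule measurable_M_compose) (use Gm in measurable)
  obtain m' where m'[measurable]: "m' \<in> borel_measurable borel" and m'0: "\<And>z. z \<notin> Z \<Longrightarrow> m' z = 0"
    and m'u: "AE z in lborel. z \<in> Z \<longrightarrow> m' z = M (fst z) (snd z) (?G z /\<^sub>R \<kappa>)"
    using borel_representative_real[OF Z_borel um] by blast
  \<comment> \<open>The representative may be negative on a null set; the absolute value makes
    nonnegativity hold everywhere.\<close>
  define m where "m z = \<bar>m' z\<bar>" for z
  have [measurable]: "m \<in> borel_measurable borel" unfolding m_def[abs_def] by measurable
  have m0: "0 \<le> m z" for z by (simp add: m_def)
  have fi: "integrable lborel f"
  proof -
    have "(\<integral>\<^sup>+z. ennreal (norm (f z)) \<partial>lborel) = (\<integral>\<^sup>+z. ennreal (norm (?\<phi> z)) \<partial>lebesgue_on Z)"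
      by (rule nn_integral_representative[OF Z_borel f0 fu])
    also have "\<dots> \<le> (\<integral>\<^sup>+z. ennreal (\<bar>?\<phi> z\<bar> + norm (?G z)) \<partial>lebesgue_on Z)" by (intro nn_integral_mono ennreal_leI) simp
    finally show ?thesis unfolding integrable_iff_bounded using sum by (auto intro: le_less_trans)
  qed
  have gi: "integrable lborel g"
  proof -
    have "(\<integral>\<^sup>+z. ennreal (norm (g z)) \<partial>lborel) = (\<integral>\<^sup>+z. ennreal (norm (?G z)) \<partial>lebesgue_on Z)"
      by (rule nn_integral_representative[OF Z_borel g0 gu])
    also have "\<dots> \<le> (\<integral>\<^sup>+z. ennreal (\<bar>?\<phi> z\<bar> + norm (?G z)) \<partial>lebesgue_on Z)" by (intro nn_integral_mono ennreal_leI) simp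
    finally show ?thesis unfolding integrable_iff_bounded using sum by (auto intro: le_less_trans)
  qed
  have mi: "integrable lborel m"
  proof -
    have "(\<integral>\<^sup>+z. ennreal (norm (m' z)) \<partial>lborel) = (\<integral>\<^sup>+z. ennreal (norm (M (fst z) (snd z) (?G z /\<^sub>R \<kappa>))) \<partial>lebesgue_on Z)"
      by (rule nn_integral_representative[OF Z_borel m'0 m'u])
    also have "\<dots> = (\<integral>\<^sup>+z. ennreal (M (fst z) (snd z) (?G z /\<^sub>R \<kappa>)) \<partial>lebesgue_on Z)"
      by (rule nn_integral_cong) (use even_convex_facts(1)[OF M_facts] in auto)
    finally show ?thesis unfolding integrable_iff_bounded using fin by (simp add: m_def)
  qed
  have gm: "AE z in lborel. z \<in> Z \<longrightarrow> M (fst z) (snd z) (g z /\<^sub>R \<kappa>) \<le> m z"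
    using gu m'u by eventually_elim (auto simp: m_def)
  have gr': "AE z in lborel. R < norm (g z /\<^sub>R \<kappa>) \<longrightarrow> c0 * norm (g z /\<^sub>R \<kappa>) powr q \<le> m z"
    using gm gr
  proof eventually_elim
    case (elim z)
    show ?case
    proof (cases "z \<in> Z")
      case True
      then have "z \<in> {0..T} \<times> \<Omega>" by auto
      then show ?thesis using elim True by (meson order_trans)
    qed (simp add: g0 m0)
  qed
  have good: "AE z in (lborel :: (real \<times> (real^'n)) measure). eventually (\<lambda>n. fst z \<in> good_times n f g m) sequentially"
    by (rule AE_lborel_fst[OF good_times_eventually[OF fi gi mi m0 c0 gr']])
  define fn where "fn n z = indicat_real (good_times n f g m) (fst z) * f z" for n z
  define gn where "gn n z = indicat_real (good_times n f g m) (fst z) *\<^sub>R g z" for n z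
  have [measurable]: "good_times n f g m \<in> sets borel" for n by (rule good_times_borel) measurable
  have [measurable]: "fn n \<in> borel_measurable borel" "gn n \<in> borel_measurable borel" for n
    unfolding fn_def[abs_def] gn_def[abs_def] by measurable
  have ind: "AE z in lborel. eventually (\<lambda>n. fn n z = f z \<and> gn n z = g z) sequentially"
    using good by eventually_elim (auto simp: fn_def gn_def elim: eventually_mono)
  let ?s = "\<lambda>n z. real (Suc n) * sin (fn n z / real (Suc n))" and ?c = "\<lambda>n z. cos (fn n z / real (Suc n)) *\<^sub>R gn n z"
  have lim1: "(\<lambda>n. \<integral>\<^sup>+z. ennreal \<bar>?s n z - f z\<bar> \<partial>lborel) \<longlonglongrightarrow> (\<integral>\<^sup>+z. 0 \<partial>(lborel :: (real \<times> (real^'n)) measure))"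
  proof (rule nn_integral_dominated_convergence[where w="\<lambda>z. ennreal (2 * \<bar>f z\<bar>)"])
    show "AE z in lborel. ennreal \<bar>?s n z - f z\<bar> \<le> ennreal (2 * \<bar>f z\<bar>)" for n
    proof (intro AE_I2 ennreal_leI)
      fix z
      have "\<bar>?s n z\<bar> \<le> \<bar>fn n z\<bar>" by (rule abs_l_sin_le') simp
      also have "\<dots> \<le> \<bar>f z\<bar>" by (simp add: fn_def indicator_def)
      finally show "\<bar>?s n z - f z\<bar> \<le> 2 * \<bar>f z\<bar>" by linarith
    qed
    have "integrable lborel (\<lambda>z. 2 * \<bar>f z\<bar>)" using fi by simp
    then have "(\<integral>\<^sup>+z. ennreal (norm (2 * \<bar>f z\<bar>)) \<partial>lborel) < \<infinity>" unfolding integrable_iff_bounded by blast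
    then show "(\<integral>\<^sup>+z. ennreal (2 * \<bar>f z\<bar>) \<partial>lborel) < \<infinity>" by simp
    show "AE z in lborel. (\<lambda>n. ennreal \<bar>?s n z - f z\<bar>) \<longlonglongrightarrow> 0"
      using ind
    proof eventually_elim
      case (elim z)
      have "(\<lambda>n. \<bar>real (Suc n) * sin (f z / real (Suc n)) - f z\<bar>) \<longlonglongrightarrow> 0"
        using tendsto_scaled_sin[of "f z"] by (intro tendsto_rabs_zero LIM_zero)
      from tendsto_ennrealI[OF this] have "(\<lambda>n. ennreal \<bar>real (Suc n) * sin (f z / real (Suc n)) - f z\<bar>) \<longlonglongrightarrow> 0" by simp
      then show ?case by (rule Lim_transform_eventually) (use elim in eventually_elim, simp)
    qed
  qed measurable
  have Fm: "(\<lambda>z. M (fst z) (snd z) ((?c n z - g z) /\<^sub>R (8 * \<kappa>))) \<in> borel_measurable (lebesgue_on Z)" for n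
    by (intro measurable_M_compose borel_measurable_lebesgue_on) measurable
  have lim2: "(\<lambda>n. \<integral>\<^sup>+z. ennreal (M (fst z) (snd z) ((?c n z - g z) /\<^sub>R (8 * \<kappa>))) \<partial>lebesgue_on Z) \<longlonglongrightarrow> (\<integral>\<^sup>+z. 0 \<partial>lebesgue_on Z)"
  proof (rule nn_integral_dominated_convergence[where w="\<lambda>z. ennreal (m z)"])
    show "(\<lambda>z. ennreal (M (fst z) (snd z) ((?c n z - g z) /\<^sub>R (8 * \<kappa>)))) \<in> borel_measurable (lebesgue_on Z)" for n
      using Fm[of n] by measurable
    show "(\<lambda>z. ennreal (m z)) \<in> borel_measurable (lebesgue_on Z)" by (rule borel_measurable_lebesgue_on) measurable
    have "(\<integral>\<^sup>+z. ennreal (m z) \<partial>lborel) < \<infinity>" using mi m0 by (simp add: integrable_iff_bounded)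
    then show "(\<integral>\<^sup>+z. ennreal (m z) \<partial>lebesgue_on Z) < \<infinity>"
      using nn_integral_lebesgue_on_le_lborel[OF Z_borel] by (rule le_less_trans[rotated])
    show "AE z in lebesgue_on Z. ennreal (M (fst z) (snd z) ((?c n z - g z) /\<^sub>R (8 * \<kappa>))) \<le> ennreal (m z)" for n
    proof (rule AE_lborel_imp_lebesgue_on[OF Z_borel])
      show "AE z in lborel. z \<in> Z \<longrightarrow> ennreal (M (fst z) (snd z) ((?c n z - g z) /\<^sub>R (8 * \<kappa>))) \<le> ennreal (m z)"
        using gm
      proof eventually_elim
        case (elim z)
        show ?case
        proof
          assume z: "z \<in> Z"
          \<comment> \<open>Cosine and indicator form one scalar of modulus at most 1, so the error
            is \<open>(c - 1) / 8\<close> times \<open>g z /\<^sub>R \<kappa>\<close> and its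
            modular lies below \<open>m z\<close>.\<close>
          define c where "c = cos (fn n z / real (Suc n)) * indicat_real (good_times n f g m) (fst z)"
          have "\<bar>c\<bar> \<le> 1" by (simp add: c_def indicator_def)
          then have "\<bar>(c - 1) / 8\<bar> \<le> 1" by (simp add: abs_le_iff)
          from even_convex_facts(2)[OF M_facts[OF z] this, of "g z /\<^sub>R \<kappa>"]
          have "M (fst z) (snd z) (((c - 1) / 8) *\<^sub>R (g z /\<^sub>R \<kappa>)) \<le> m z" using elim z by auto
          moreover have "((c - 1) / 8) *\<^sub>R (g z /\<^sub>R \<kappa>) = (?c n z - g z) /\<^sub>R (8 * \<kappa>)"
          proof -
            have "?c n z - g z = (c - 1) *\<^sub>R g z" by (simp add: c_def gn_def scaleR_diff_left)
            moreover have "(c - 1) / 8 * inverse \<kappa> = inverse (8 * \<kappa>) * (c - 1)" using \<kappa> by (simp add: field_simps)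
            ultimately show ?thesis by (simp only: scaleR_scaleR)
          qed
          ultimately show "ennreal (M (fst z) (snd z) ((?c n z - g z) /\<^sub>R (8 * \<kappa>))) \<le> ennreal (m z)" by (simp add: ennreal_leI)
        qed
      qed
    qed
    show "AE z in lebesgue_on Z. (\<lambda>n. ennreal (M (fst z) (snd z) ((?c n z - g z) /\<^sub>R (8 * \<kappa>)))) \<longlonglongrightarrow> 0"
    proof (rule AE_lborel_imp_lebesgue_on[OF Z_borel])
      show "AE z in lborel. z \<in> Z \<longrightarrow> (\<lambda>n. ennreal (M (fst z) (snd z) ((?c n z - g z) /\<^sub>R (8 * \<kappa>)))) \<longlonglongrightarrow> 0"
        using ind
      proof eventually_elim
        case (elim z)
        show ?case
        proof
          assume z: "z \<in> Z"
          have "(\<lambda>n. (cos (f z / real (Suc n)) *\<^sub>R g z - g z) /\<^sub>R (8 * \<kappa>)) \<longlonglongrightarrow> (1 *\<^sub>R g z - g z) /\<^sub>R (8 * \<kappa>)"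
            by (intro tendsto_scaleR tendsto_diff tendsto_const tendsto_cos_scaled)
          then have "(\<lambda>n. (cos (f z / real (Suc n)) *\<^sub>R g z - g z) /\<^sub>R (8 * \<kappa>)) \<longlonglongrightarrow> 0" by simp
          then have t0: "(\<lambda>n. (?c n z - g z) /\<^sub>R (8 * \<kappa>)) \<longlonglongrightarrow> 0"
            by (rule Lim_transform_eventually) (use elim in eventually_elim, simp)
          have "isCont (M (fst z) (snd z)) 0"
            using even_convex_facts(3)[OF M_facts[OF z]] by (simp add: continuous_on_eq_continuous_at)
          from isCont_tendsto_compose[OF this t0] have "(\<lambda>n. M (fst z) (snd z) ((?c n z - g z) /\<^sub>R (8 * \<kappa>))) \<longlonglongrightarrow> 0"
            using M_facts(3)[OF z] by simp
          from tendsto_ennrealI[OF this] show "(\<lambda>n. ennreal (M (fst z) (snd z) ((?c n z - g z) /\<^sub>R (8 * \<kappa>)))) \<longlonglongrightarrow> 0" by simp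
        qed
      qed
    qed
  qed simp
  have \<eta>2: "0 < ennreal (\<eta> / 2)" using \<eta> by simp
  have "eventually (\<lambda>n. (\<integral>\<^sup>+z. ennreal \<bar>?s n z - f z\<bar> \<partial>lborel) < ennreal (\<eta> / 2)) sequentially"
    using lim1 \<eta>2 by (intro order_tendstoD(2)[of _ 0]) simp_all
  moreover have "eventually (\<lambda>n. (\<integral>\<^sup>+z. ennreal (M (fst z) (snd z) ((?c n z - g z) /\<^sub>R (8 * \<kappa>))) \<partial>lebesgue_on Z) < ennreal (\<eta> / 2)) sequentially"
    using lim2 \<eta>2 by (intro order_tendstoD(2)[of _ 0]) simp_all
  ultimately have "eventually (\<lambda>n. (\<integral>\<^sup>+z. ennreal \<bar>?s n z - f z\<bar> \<partial>lborel) < ennreal (\<eta> / 2) \<and>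
     (\<integral>\<^sup>+z. ennreal (M (fst z) (snd z) ((?c n z - g z) /\<^sub>R (8 * \<kappa>))) \<partial>lebesgue_on Z) < ennreal (\<eta> / 2)) sequentially"
    by (rule eventually_conj)
  then obtain n where n1: "(\<integral>\<^sup>+z. ennreal \<bar>?s n z - f z\<bar> \<partial>lborel) < ennreal (\<eta> / 2)"
    and n2: "(\<integral>\<^sup>+z. ennreal (M (fst z) (snd z) ((?c n z - g z) /\<^sub>R (8 * \<kappa>))) \<partial>lebesgue_on Z) < ennreal (\<eta> / 2)"
    using eventually_happens by fastforce
  have "\<exists>\<Phi> V. in_Linf_Cc T \<Omega> \<Phi> \<and> V \<in> borel_measurable borel \<and>
    (AE z in lebesgue_on Z. grad (\<Phi> (fst z)) (snd z) = V z) \<and>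
    (\<integral>\<^sup>+z. ennreal \<bar>\<Phi> (fst z) (snd z) - ?s n z\<bar> \<partial>lebesgue_on Z) \<le> ennreal (\<eta> / 2) \<and>
    (\<integral>\<^sup>+z. ennreal (M (fst z) (snd z) ((V z - ?c n z) /\<^sub>R (8 * \<kappa>))) \<partial>lebesgue_on Z) \<le> ennreal (\<eta> / 2) \<and>
    (\<forall>t x b. x \<in> \<Omega> \<longrightarrow> (AE y in lborel. \<bar>fn n (t, y)\<bar> \<le> b) \<longrightarrow> \<bar>\<Phi> t x\<bar> \<le> b)"
    unfolding fn_def gn_def
    by (rule cutoff_smooth_approximation[OF fi f0 fu gi g0 gu mi m0 gm W]) (use \<eta> in auto)
  then obtain \<Phi> V where \<Phi>: "in_Linf_Cc T \<Omega> \<Phi>" and V[measurable]: "V \<in> borel_measurable borel"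
    and gV: "AE z in lebesgue_on Z. grad (\<Phi> (fst z)) (snd z) = V z"
    and e1: "(\<integral>\<^sup>+z. ennreal \<bar>\<Phi> (fst z) (snd z) - ?s n z\<bar> \<partial>lebesgue_on Z) \<le> ennreal (\<eta> / 2)"
    and e2: "(\<integral>\<^sup>+z. ennreal (M (fst z) (snd z) ((V z - ?c n z) /\<^sub>R (8 * \<kappa>))) \<partial>lebesgue_on Z) \<le> ennreal (\<eta> / 2)"
    and bd: "\<And>t x b. x \<in> \<Omega> \<Longrightarrow> (AE y in lborel. \<bar>fn n (t, y)\<bar> \<le> b) \<Longrightarrow> \<bar>\<Phi> t x\<bar> \<le> b"
    by blast
  have \<Phi>m: "(\<lambda>z. \<Phi> (fst z) (snd z)) \<in> borel_measurable (lebesgue_on Z)" using \<Phi> by (simp add: in_Linf_Cc_def)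
  have half: "ennreal (\<eta> / 2) + ennreal (\<eta> / 2) = ennreal \<eta>" using \<eta> by (simp flip: ennreal_plus)
  have fuL: "AE z in lebesgue_on Z. f z = ?\<phi> z" and guL: "AE z in lebesgue_on Z. g z = ?G z"
    by (rule AE_lborel_imp_lebesgue_on[OF Z_borel fu], rule AE_lborel_imp_lebesgue_on[OF Z_borel gu])
  have sm: "(\<lambda>z. ?s n z) \<in> borel_measurable (lebesgue_on Z)" and fmL: "f \<in> borel_measurable (lebesgue_on Z)"
    by (rule borel_measurable_lebesgue_on, measurable)+
  have r1: "(\<integral>\<^sup>+z. ennreal \<bar>\<Phi> (fst z) (snd z) - ?\<phi> z\<bar> \<partial>lebesgue_on Z) \<le> ennreal \<eta>"
  proof -
    have "(\<integral>\<^sup>+z. ennreal \<bar>\<Phi> (fst z) (snd z) - ?\<phi> z\<bar> \<partial>lebesgue_on Z) \<le>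
      (\<integral>\<^sup>+z. ennreal \<bar>\<Phi> (fst z) (snd z) - ?s n z\<bar> + ennreal \<bar>?s n z - f z\<bar> \<partial>lebesgue_on Z)"
    proof (rule nn_integral_mono_AE)
      show "AE z in lebesgue_on Z. ennreal \<bar>\<Phi> (fst z) (snd z) - ?\<phi> z\<bar> \<le> ennreal \<bar>\<Phi> (fst z) (snd z) - ?s n z\<bar> + ennreal \<bar>?s n z - f z\<bar>"
        using fuL
      proof eventually_elim
        case (elim z)
        have "\<bar>\<Phi> (fst z) (snd z) - ?\<phi> z\<bar> \<le> \<bar>\<Phi> (fst z) (snd z) - ?s n z\<bar> + \<bar>?s n z - f z\<bar>" using elim by linarith
        then show ?case by (simp add: ennreal_leI flip: ennreal_plus)
      qed
    qed
    also have "\<dots> = (\<integral>\<^sup>+z. ennreal \<bar>\<Phi> (fst z) (snd z) - ?s n z\<bar> \<partial>lebesgue_on Z) + (\<integral>\<^sup>+z. ennreal \<bar>?s n z - f z\<bar> \<partial>lebesgue_on Z)"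
      by (intro nn_integral_add measurable_compose[OF _ measurable_ennreal] borel_measurable_abs borel_measurable_diff \<Phi>m sm fmL)
    also have "\<dots> \<le> ennreal (\<eta> / 2) + ennreal (\<eta> / 2)"
      using nn_integral_lebesgue_on_le_lborel[OF Z_borel, of "\<lambda>z. ennreal \<bar>?s n z - f z\<bar>"] n1 by (intro add_mono e1) simp
    finally show ?thesis by (simp only: half)
  qed
  have Vm: "(\<lambda>z. M (fst z) (snd z) ((V z - ?c n z) /\<^sub>R (8 * \<kappa>))) \<in> borel_measurable (lebesgue_on Z)"
    by (intro measurable_M_compose borel_measurable_lebesgue_on) measurable
  have r2: "(\<integral>\<^sup>+z. ennreal (M (fst z) (snd z) ((grad (\<Phi> (fst z)) (snd z) - ?G z) /\<^sub>R (16 * \<kappa>))) \<partial>lebesgue_on Z) \<le> ennreal \<eta>"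
  proof -
    have "(\<integral>\<^sup>+z. ennreal (M (fst z) (snd z) ((grad (\<Phi> (fst z)) (snd z) - ?G z) /\<^sub>R (16 * \<kappa>))) \<partial>lebesgue_on Z) \<le>
      (\<integral>\<^sup>+z. ennreal (M (fst z) (snd z) ((V z - ?c n z) /\<^sub>R (8 * \<kappa>))) + ennreal (M (fst z) (snd z) ((?c n z - g z) /\<^sub>R (8 * \<kappa>))) \<partial>lebesgue_on Z)"
    proof (rule nn_integral_mono_AE)
      show "AE z in lebesgue_on Z. ennreal (M (fst z) (snd z) ((grad (\<Phi> (fst z)) (snd z) - ?G z) /\<^sub>R (16 * \<kappa>))) \<le>
        ennreal (M (fst z) (snd z) ((V z - ?c n z) /\<^sub>R (8 * \<kappa>))) + ennreal (M (fst z) (snd z) ((?c n z - g z) /\<^sub>R (8 * \<kappa>)))"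
        using guL gV AE_space
      proof eventually_elim
        case (elim z)
        then have z: "z \<in> Z" by simp
        note F = even_convex_facts[OF M_facts[OF z]]
        have "(V z - g z) /\<^sub>R (16 * \<kappa>) = (1/2) *\<^sub>R ((V z - ?c n z) /\<^sub>R (8 * \<kappa>) + (?c n z - g z) /\<^sub>R (8 * \<kappa>))"
          by (simp flip: scaleR_add_right)
        then have "M (fst z) (snd z) ((V z - g z) /\<^sub>R (16 * \<kappa>)) \<le> M (fst z) (snd z) ((V z - ?c n z) /\<^sub>R (8 * \<kappa>)) + M (fst z) (snd z) ((?c n z - g z) /\<^sub>R (8 * \<kappa>))"
          using F(4)[of "(V z - ?c n z) /\<^sub>R (8 * \<kappa>)" "(?c n z - g z) /\<^sub>R (8 * \<kappa>)"] by (simp only:)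
        then have "ennreal (M (fst z) (snd z) ((V z - g z) /\<^sub>R (16 * \<kappa>))) \<le> ennreal (M (fst z) (snd z) ((V z - ?c n z) /\<^sub>R (8 * \<kappa>)) + M (fst z) (snd z) ((?c n z - g z) /\<^sub>R (8 * \<kappa>)))"
          by (rule ennreal_leI)
        then show ?case using elim by (simp only: ennreal_plus[OF F(1) F(1)])
      qed
    qed
    also have "\<dots> = (\<integral>\<^sup>+z. ennreal (M (fst z) (snd z) ((V z - ?c n z) /\<^sub>R (8 * \<kappa>))) \<partial>lebesgue_on Z) + (\<integral>\<^sup>+z. ennreal (M (fst z) (snd z) ((?c n z - g z) /\<^sub>R (8 * \<kappa>))) \<partial>lebesgue_on Z)"
      by (intro nn_integral_add measurable_compose[OF _ measurable_ennreal] Vm Fm)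
    also have "\<dots> \<le> ennreal (\<eta> / 2) + ennreal (\<eta> / 2)" using n2 by (intro add_mono e2) simp
    finally show ?thesis by (simp only: half)
  qed
  have r3: "Linf_norm T \<Omega> \<Phi> \<le> Linf_norm T \<Omega> \<phi>"
  proof -
    let ?b = "Linf_norm T \<Omega> \<phi>"
    have ae: "AE z in lebesgue_on Z. ereal \<bar>?\<phi> z\<bar> \<le> ?b"
      unfolding Linf_norm_def ess_sup_on_def by (rule esssup_AE)
    \<comment> \<open>A finite nonnegative bound is inherited by the construction. An infinite one
      is trivial, and a negative one can occur only if the cylinder is a null set.\<close>
    have "AE z in lebesgue_on Z. ereal \<bar>\<Phi> (fst z) (snd z)\<bar> \<le> ?b"
    proof (cases "0 \<le> ?b \<and> ?b \<noteq> \<infinity>")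
      case True
      then obtain b where b: "?b = ereal b" "0 \<le> b" by (cases ?b) auto
      have "AE z in lborel. z \<in> Z \<longrightarrow> \<bar>?\<phi> z\<bar> \<le> b" using ae b(1) AE_lebesgue_on_iff[OF Z_borel] by simp
      then have "AE z in lborel. \<bar>fn n z\<bar> \<le> b"
        using fu
      proof eventually_elim
        case (elim z)
        have "\<bar>f z\<bar> \<le> b" using elim f0[of z] b(2) by (cases "z \<in> Z") auto
        then show ?case using b(2) by (simp add: fn_def indicator_def)
      qed
      from AE_lborel_fst[OF AE_lborel_sections[OF this]]
      have "AE z in lborel. z \<in> Z \<longrightarrow> ereal \<bar>\<Phi> (fst z) (snd z)\<bar> \<le> ?b"
        by eventually_elim (use bd b in auto)
      then show ?thesis by (rule AE_lborel_imp_lebesgue_on[OF Z_borel])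
    next
      case False
      show ?thesis
        using ae
      proof eventually_elim
        case (elim z)
        then have "0 \<le> ?b" by (rule order_trans[rotated]) simp
        then show ?case using False by simp
      qed
    qed
    then show ?thesis unfolding Linf_norm_def[of T \<Omega> \<Phi>] ess_sup_on_def by (rule esssup_I[rotated]) (use \<Phi>m in measurable)
  qed
  show ?thesis using \<Phi> r1 r2 r3 by blast
qed

end

section \<open>Choice of the data and of the family\<close>

theorem theorem3p1:
  fixes \<Omega> :: "(real^'n) set"
  assumes "bounded \<Omega>" and "lipschitz_domain \<Omega>"
  shows "\<exists>c>0. \<forall>(T::real) M \<phi> G.
     0 < T \<and> N_function T \<Omega> M \<and> locally_integrable_N T \<Omega> M \<and>
     (cond_M T \<Omega> M \<or> cond_Mp T \<Omega> M) \<and> in_V T \<Omega> M \<phi> G \<longrightarrow>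
     (\<exists>\<Phi> :: real \<Rightarrow> real \<Rightarrow> real^'n \<Rightarrow> real.
        (\<forall>\<delta>>0. in_Linf_Cc T \<Omega> (\<Phi> \<delta>)) \<and>
        ((\<lambda>\<delta>. \<integral>\<^sup>+z. ennreal \<bar>\<Phi> \<delta> (fst z) (snd z) - \<phi> (fst z) (snd z)\<bar> \<partial>lebesgue_on ({0<..<T} \<times> \<Omega>))
           \<longlongrightarrow> 0) (at_right 0) \<and>
        modular_conv T \<Omega> M (\<lambda>\<delta> z. grad (\<Phi> \<delta> (fst z)) (snd z)) (\<lambda>z. G (fst z) (snd z)) \<and>
        (\<forall>\<delta>>0. Linf_norm T \<Omega> (\<Phi> \<delta>) \<le> ereal c * Linf_norm T \<Omega> \<phi>))"
proof (intro exI[of _ 1] conjI allI impI)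
  fix T M \<phi> G
  assume H: "0 < T \<and> N_function T \<Omega> M \<and> locally_integrable_N T \<Omega> M \<and> (cond_M T \<Omega> M \<or> cond_Mp T \<Omega> M) \<and> in_V T \<Omega> M \<phi> G"
  then have N: "N_function T \<Omega> M" and li: "locally_integrable_N T \<Omega> M"
    and cond: "cond_M T \<Omega> M \<or> cond_Mp T \<Omega> M" and V: "in_V T \<Omega> M \<phi> G" by blast+
  let ?Z = "{0<..<T} \<times> \<Omega>"
  have \<Omega>: "open \<Omega>" using assms(2) by (simp add: lipschitz_domain_def)
  have Zb: "?Z \<in> sets borel" using \<Omega> by (intro borel_Times) auto
  obtain k :: nat and a \<theta> r0 where r0: "0 < r0"
    and \<theta>: "\<And>i. i < k \<Longrightarrow> cb_smooth (\<lambda>_::unit. \<theta> i)" "\<And>i x. i < k \<Longrightarrow> 0 \<le> \<theta> i x" "\<And>x. x \<in> \<Omega> \<Longrightarrow> (\<Sum>i<k. \<theta> i x) = 1"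
    and tr: "\<And>i x w e z. i < k \<Longrightarrow> \<theta> i x \<noteq> 0 \<Longrightarrow> w \<notin> \<Omega> \<Longrightarrow> dist x w < r0 \<Longrightarrow> 0 < e \<Longrightarrow> e < r0 \<Longrightarrow> norm z \<le> 2 * e \<Longrightarrow>
       w + e *\<^sub>R a i + z \<notin> \<Omega>"
    by (rule lipschitz_domain_partition[OF assms]) (rule that, assumption+)
  obtain B where B: "0 < B" "\<forall>e>0. \<exists>K::real^'n \<Rightarrow> real. mollifier B e K" using mollifier_exists by blast
  obtain q c0 R \<Theta> \<xi>0 \<delta>0 where gc: "1 \<le> q" "0 < c0" "Theta_ok \<Theta>"
    "Limsup (at_right 0) (\<lambda>\<delta>. ereal (\<Theta> \<delta> (\<delta> powr (- real CARD('n) / q)))) < \<infinity>" "M_ineq T \<Omega> M \<Theta> \<xi>0 \<delta>0"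
    and gr: "AE z in lborel. z \<in> {0..T} \<times> \<Omega> \<longrightarrow> (\<forall>\<xi>. R < norm \<xi> \<longrightarrow> c0 * norm \<xi> powr q \<le> M (fst z) (snd z) \<xi>)"
    using growth_condition[OF N \<Omega> cond] .
  \<comment> \<open>Membership of the gradient in the Musielak-Orlicz space supplies the scale from
    which all later multiples are formed.\<close>
  obtain \<kappa> where fin: "0 < \<kappa>" "(\<integral>\<^sup>+z. ennreal (M (fst z) (snd z) (G (fst z) (snd z) /\<^sub>R \<kappa>)) \<partial>lebesgue_on ?Z) < \<infinity>"
    using V unfolding in_V_def in_LM_def by blast
  have cf: "convex_family T \<Omega> M" using N unfolding N_function_def convex_family_def by blast
  have Mm: "(\<lambda>z. M (fst z) (snd z) \<xi>) \<in> borel_measurable (lebesgue_on ?Z)" for \<xi>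
  proof -
    have "(\<lambda>z. M (fst z) (snd z) \<xi>) \<in> borel_measurable (lebesgue_on ({0..T} \<times> \<Omega>))" using N unfolding N_function_def by blast
    then show ?thesis by (rule measurable_restrict_mono) auto
  qed
  have Mi: "(\<integral>\<^sup>+z. ennreal (M (fst z) (snd z) \<xi>) \<partial>lebesgue_on ?Z) < \<infinity>" for \<xi>
  proof -
    have "?Z \<in> sets lebesgue" using Zb by simp
    then show ?thesis using li unfolding locally_integrable_N_def by (simp add: nn_integral_restrict_space)
  qed
  \<comment> \<open>The sum of the lengths is a common bound for all directions, also when
    \<open>k = 0\<close>.\<close>
  have A: "norm (a i) \<le> (\<Sum>i<k. norm (a i))" if "i < k" for i
    using that by (intro member_le_sum[of i "{..<k}" "\<lambda>i. norm (a i)"]) auto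
  interpret smooth_truncation \<Omega> T M k \<theta> a r0 "\<Sum>i<k. norm (a i)" B \<Theta> \<xi>0 \<delta>0 q \<kappa>
    by unfold_locales (use \<Omega> assms(1) r0 \<theta> tr A B cf Mm Mi gc fin(1) in \<open>auto simp: sum_nonneg\<close>)
  \<comment> \<open>The parameter \<open>\<delta>\<close> itself is taken as the admissible error,
    so members of the family are chosen independently of each other and both convergences follow
    from a bound by \<open>\<delta>\<close>.\<close>
  have "\<forall>\<delta>. \<exists>\<Phi>. \<delta> > 0 \<longrightarrow> in_Linf_Cc T \<Omega> \<Phi> \<and>
    (\<integral>\<^sup>+z. ennreal \<bar>\<Phi> (fst z) (snd z) - \<phi> (fst z) (snd z)\<bar> \<partial>lebesgue_on ?Z) \<le> ennreal \<delta> \<and>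
    (\<integral>\<^sup>+z. ennreal (M (fst z) (snd z) ((grad (\<Phi> (fst z)) (snd z) - G (fst z) (snd z)) /\<^sub>R (16 * \<kappa>))) \<partial>lebesgue_on ?Z) \<le> ennreal \<delta> \<and>
    Linf_norm T \<Omega> \<Phi> \<le> Linf_norm T \<Omega> \<phi>"
    using smooth_approximation_in_V[OF V fin(2) gc(2) gr] by blast
  from choice[OF this] obtain \<Phi> where \<Phi>: "\<And>\<delta>. \<delta> > 0 \<Longrightarrow> in_Linf_Cc T \<Omega> (\<Phi> \<delta>)"
    "\<And>\<delta>. \<delta> > 0 \<Longrightarrow> (\<integral>\<^sup>+z. ennreal \<bar>\<Phi> \<delta> (fst z) (snd z) - \<phi> (fst z) (snd z)\<bar> \<partial>lebesgue_on ?Z) \<le> ennreal \<delta>"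
    "\<And>\<delta>. \<delta> > 0 \<Longrightarrow> (\<integral>\<^sup>+z. ennreal (M (fst z) (snd z) ((grad (\<Phi> \<delta> (fst z)) (snd z) - G (fst z) (snd z)) /\<^sub>R (16 * \<kappa>))) \<partial>lebesgue_on ?Z) \<le> ennreal \<delta>"
    "\<And>\<delta>. \<delta> > 0 \<Longrightarrow> Linf_norm T \<Omega> (\<Phi> \<delta>) \<le> Linf_norm T \<Omega> \<phi>"
    by blast
  have lim: "(h \<longlongrightarrow> 0) (at_right 0)" if h: "\<And>\<delta>. \<delta> > 0 \<Longrightarrow> h \<delta> \<le> ennreal \<delta>" for h :: "real \<Rightarrow> ennreal"
  proof (rule tendsto_zero_ennreal)
    fix r :: real assume r: "0 < r"
    have "eventually (\<lambda>\<delta>. \<delta> \<in> {0<..<r}) (at_right 0)" using r by (rule eventually_at_right_real)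
    then show "eventually (\<lambda>\<delta>. h \<delta> < ennreal r) (at_right 0)"
    proof eventually_elim
      case (elim \<delta>)
      then show ?case using r by (intro le_less_trans[OF h] ennreal_lessI) auto
    qed
  qed
  show "\<exists>\<Phi> :: real \<Rightarrow> real \<Rightarrow> real^'n \<Rightarrow> real.
        (\<forall>\<delta>>0. in_Linf_Cc T \<Omega> (\<Phi> \<delta>)) \<and>
        ((\<lambda>\<delta>. \<integral>\<^sup>+z. ennreal \<bar>\<Phi> \<delta> (fst z) (snd z) - \<phi> (fst z) (snd z)\<bar> \<partial>lebesgue_on ({0<..<T} \<times> \<Omega>))
           \<longlongrightarrow> 0) (at_right 0) \<and>
        modular_conv T \<Omega> M (\<lambda>\<delta> z. grad (\<Phi> \<delta> (fst z)) (snd z)) (\<lambda>z. G (fst z) (snd z)) \<and>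
        (\<forall>\<delta>>0. Linf_norm T \<Omega> (\<Phi> \<delta>) \<le> ereal 1 * Linf_norm T \<Omega> \<phi>)"
  proof (intro exI[of _ \<Phi>] conjI allI impI)
    show "((\<lambda>\<delta>. \<integral>\<^sup>+z. ennreal \<bar>\<Phi> \<delta> (fst z) (snd z) - \<phi> (fst z) (snd z)\<bar> \<partial>lebesgue_on ?Z) \<longlongrightarrow> 0) (at_right 0)"
      by (rule lim) (rule \<Phi>(2))
    show "modular_conv T \<Omega> M (\<lambda>\<delta> z. grad (\<Phi> \<delta> (fst z)) (snd z)) (\<lambda>z. G (fst z) (snd z))"
      unfolding modular_conv_def
    proof (intro exI[of _ "16 * \<kappa>"] conjI)
      show "((\<lambda>\<delta>. \<integral>\<^sup>+z. ennreal (M (fst z) (snd z) ((grad (\<Phi> \<delta> (fst z)) (snd z) - G (fst z) (snd z)) /\<^sub>R (16 * \<kappa>))) \<partial>lebesgue_on ?Z) \<longlongrightarrow> 0) (at_right 0)"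
        by (rule lim) (rule \<Phi>(3))
    qed (use fin(1) in simp)
    show "Linf_norm T \<Omega> (\<Phi> \<delta>) \<le> ereal 1 * Linf_norm T \<Omega> \<phi>" if "\<delta> > 0" for \<delta>
      using \<Phi>(4)[OF that] by (simp flip: one_ereal_def)
  qed (rule \<Phi>(1))
qed simp

end
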